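(* Let $\Omega=C_0([0,T];\mathbb R)$, $\mathfrak M_\Lambda$, $\mathcal A_\Lambda$, the regularized dyadic square sums $q^n:\Omega\to\mathcal A_\Lambda$ and the functional $Q_t(x)=\limsup_{n\to\infty}q^n_t(x)$ be as defined in the context. Then: (i) $Q$ is a Borel causal map defined on all of $\Omega$ with values in $\mathcal A_\Lambda$. (ii) For every $P\in\mathfrak M_\Lambda$, $Q(X)=\langle X\rangle^P$ $P$-almost surely. Moreover, for every $r\ge 2$ there is a constant $C_{r,\Lambda,T}<\infty$ such that for all $n$ $$\sup_{P\in\mathfrak M_\Lambda}\Bigl(E^P\bigl[\|q^n-Q\|_\infty^r\bigr]\Bigr)^{1/r}\le C_{r,\Lambda,T}\,2^{-n/2}.$$ (iii) There is an increasing sequence of compact sets $(K_R)_{R\ge1}$ in $\Omega$ with $\sup_{P\in\mathfrak M_\Lambda}P(K_R^c)\to0$ as $R\to\infty$ such that $q^n\to Q$ uniformly on every $K_R$ (in the supremum norm of $C([0,T])$). In particular, $Q|_{K_R}$ is continuous in the raw uniform topology for every $R$.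
   Context: Fix $T,\Lambda>0$. $\Omega=C_0([0,T];\mathbb R)$ is the space of continuous real paths on $[0,T]$ starting at $0$, with the uniform topology; $X_t(x)=x_t$ is the coordinate process. $\mathfrak M_\Lambda$ is the set of Borel probability measures $P$ on $\Omega$ under which $X$ is a square-integrable martingale with respect to the usual augmentation of its natural filtration and such that the continuous predictable version $\langle X\rangle^P$ of its bracket satisfies, on one $P$-full set, $\langle X\rangle^P_t-\langle X\rangle^P_s\le\Lambda(t-s)$ for all $0\le s\le t\le T$. $\mathcal A_\Lambda=\{q\in C([0,T]):q_0=0,\ 0\le q_t-q_s\le\Lambda(t-s)\text{ for }0\le s\le t\le T\}$, with the supremum norm. With $t_k^n=kT2^{-n}$, $0\le k\le 2^n$, put $V^n_t(x)=\sum_{k:\,t^n_{k+1}\le t}(x_{t^n_{k+1}}-x_{t^n_k})^2$. For a nonnegative increasing function $a$ on $[0,T]$ with $a_0=0$ put $(\mathcal R_\Lambda a)_t=\inf_{0\le u\le t}\{a_u+\Lambda(t-u)\}$. Define $q^n(x)=\mathcal R_\Lambda V^n(x)$ and $Q_t(x)=\limsup_{n\to\infty}q^n_t(x)$ for every $x\in\Omega$, $t\in[0,T]$. A map $F$ from $\Omega$ to paths on $[0,T]$ is causal if, for every $t$, $F_t(x)$ depends only on the restriction of $x$ to $[0,t]$. *)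

theory Defs
  imports "HOL-Probability.Probability"
begin

section \<open>Path spaces\<close>

type_synonym path = "real \<Rightarrow> real"

text \<open>\<open>C([0,T])\<close> with the supremum distance. Elements of the library space \<open>cfunspace\<close> are
  extensional functions (\<open>undefined\<close> off \<open>[0,T]\<close>), so that distinct elements are distinct paths
  on \<open>[0,T]\<close>.\<close>

definition cpaths :: "real \<Rightarrow> path metric" where
  "cpaths T = cfunspace (top_of_set {0..T}) euclidean_metric"

definition Omega :: "real \<Rightarrow> path metric" where
  "Omega T = submetric (cpaths T) {x. x 0 = 0}"

definition borel_of :: "'a topology \<Rightarrow> 'a measure" where
  "borel_of X = sigma (topspace X) {U. openin X U}"

definition Abr :: "real \<Rightarrow> real \<Rightarrow> path set" where
  "Abr T \<Lambda> = {q \<in> mspace (cpaths T). q 0 = 0 \<and>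
      (\<forall>s t. 0 \<le> s \<and> s \<le> t \<and> t \<le> T \<longrightarrow> 0 \<le> q t - q s \<and> q t - q s \<le> \<Lambda> * (t - s))}"

definition causal :: "real \<Rightarrow> (path \<Rightarrow> path) \<Rightarrow> bool" where
  "causal T F \<longleftrightarrow> (\<forall>t\<in>{0..T}. \<forall>x\<in>mspace (Omega T). \<forall>y\<in>mspace (Omega T).
      (\<forall>s\<in>{0..t}. x s = y s) \<longrightarrow> F x t = F y t)"

lemma mspace_cpaths:
  "mspace (cpaths T) = {x \<in> extensional {0..T}. continuous_on {0..T} x}"
  unfolding cpaths_def by (subst compactin_mspace_cfunspace) (auto simp: compactin_subtopology)

lemma mdist_cpaths:
  assumes "0 \<le> T" "x \<in> mspace (cpaths T)" "y \<in> mspace (cpaths T)"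
  shows "mdist (cpaths T) x y = (SUP t\<in>{0..T}. \<bar>x t - y t\<bar>)"
  using assms
  by (auto simp: cpaths_def cfunspace_def Metric_space.fdist_def[OF Met_TC.Metric_space_axioms]
      dist_real_def)

section \<open>Regularized dyadic square sums\<close>

definition tdyad :: "real \<Rightarrow> nat \<Rightarrow> nat \<Rightarrow> real" where
  "tdyad T n k = real k * T / 2 ^ n"

definition dyad_sq :: "real \<Rightarrow> nat \<Rightarrow> path \<Rightarrow> path" where
  "dyad_sq T n x t = (\<Sum>k | k < 2 ^ n \<and> tdyad T n (Suc k) \<le> t. (x (tdyad T n (Suc k)) - x (tdyad T n k))\<^sup>2)"

definition regularize :: "real \<Rightarrow> path \<Rightarrow> path" where
  "regularize \<Lambda> a t = (INF u\<in>{0..t}. a u + \<Lambda> * (t - u))"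

definition qn :: "real \<Rightarrow> real \<Rightarrow> nat \<Rightarrow> path \<Rightarrow> path" where
  "qn T \<Lambda> n x = (\<lambda>t\<in>{0..T}. regularize \<Lambda> (dyad_sq T n x) t)"

text \<open>The limsup is formed in \<open>[-\<infinity>,\<infinity>]\<close>; it is finite, see \<open>ereal_Qlim\<close> below.\<close>

definition Qlim :: "real \<Rightarrow> real \<Rightarrow> path \<Rightarrow> path" where
  "Qlim T \<Lambda> x = (\<lambda>t\<in>{0..T}. real_of_ereal (limsup (\<lambda>n. ereal (qn T \<Lambda> n x t))))"

lemma regularize_props:
  assumes "0 \<le> \<Lambda>" and a0: "a 0 = 0" and a: "\<And>s t. 0 \<le> s \<Longrightarrow> s \<le> t \<Longrightarrow> a s \<le> a t"
  shows "regularize \<Lambda> a 0 = 0"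
    and "0 \<le> s \<Longrightarrow> s \<le> t \<Longrightarrow> regularize \<Lambda> a s \<le> regularize \<Lambda> a t"
    and "0 \<le> s \<Longrightarrow> s \<le> t \<Longrightarrow> regularize \<Lambda> a t \<le> regularize \<Lambda> a s + \<Lambda> * (t - s)"
proof -
  show "regularize \<Lambda> a 0 = 0"
    by (simp add: regularize_def a0)
  have lower: "regularize \<Lambda> a t \<le> a u + \<Lambda> * (t - u)" if "0 \<le> u" "u \<le> t" for t u
  proof -
    have "0 \<le> a v + \<Lambda> * (t - v)" if "0 \<le> v" "v \<le> t" for v
      using a[of 0 v] that a0 \<open>0 \<le> \<Lambda>\<close> by (simp add: add_nonneg_nonneg)
    then have "bdd_below ((\<lambda>u. a u + \<Lambda> * (t - u)) ` {0..t})"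
      by (intro bdd_belowI2[of _ 0]) auto
    then show ?thesis
      unfolding regularize_def using that by (intro cINF_lower) auto
  qed
  assume st: "0 \<le> s" "s \<le> t"
  show "regularize \<Lambda> a s \<le> regularize \<Lambda> a t"
    unfolding regularize_def[of _ _ t]
  proof (rule cINF_greatest)
    fix u assume u: "u \<in> {0..t}"
    show "regularize \<Lambda> a s \<le> a u + \<Lambda> * (t - u)"
    proof (cases "u \<le> s")
      case True
      have "\<Lambda> * (s - u) \<le> \<Lambda> * (t - u)"
        using st \<open>0 \<le> \<Lambda>\<close> by (intro mult_left_mono) auto
      then show ?thesis
        using lower[of u s] True u by auto
    next
      case False
      have "0 \<le> \<Lambda> * (t - u)"
        using u \<open>0 \<le> \<Lambda>\<close> by simp
      then show ?thesis
        using lower[of s s] a[of s u] False st by simp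
    qed
  qed (use st in auto)
  have "regularize \<Lambda> a t - \<Lambda> * (t - s) \<le> regularize \<Lambda> a s"
    unfolding regularize_def[of _ _ s]
  proof (rule cINF_greatest)
    fix u assume u: "u \<in> {0..s}"
    have "\<Lambda> * (t - u) = \<Lambda> * (s - u) + \<Lambda> * (t - s)"
      by (simp add: algebra_simps)
    then show "regularize \<Lambda> a t - \<Lambda> * (t - s) \<le> a u + \<Lambda> * (s - u)"
      using lower[of u t] u st by simp
  qed (use st in auto)
  then show "regularize \<Lambda> a t \<le> regularize \<Lambda> a s + \<Lambda> * (t - s)"
    by simp
qed

lemma dyad_sq_0:
  assumes "0 < T" shows "dyad_sq T n x 0 = 0"
proof -
  have "\<not> tdyad T n (Suc k) \<le> 0" for k
    using assms by (simp add: tdyad_def not_le)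
  then show ?thesis
    by (simp add: dyad_sq_def)
qed

lemma dyad_sq_mono: "s \<le> t \<Longrightarrow> dyad_sq T n x s \<le> dyad_sq T n x t"
  unfolding dyad_sq_def by (intro sum_mono2) auto

lemma qn_in_Abr:
  assumes "0 < T" "0 \<le> \<Lambda>"
  shows "qn T \<Lambda> n x \<in> Abr T \<Lambda>"
proof -
  note R = regularize_props[of \<Lambda> "dyad_sq T n x", OF assms(2) dyad_sq_0[OF assms(1)] dyad_sq_mono]
  have "\<Lambda>-lipschitz_on {0..T} (regularize \<Lambda> (dyad_sq T n x))"
  proof (rule lipschitz_on_leI)
    fix s t assume "s \<in> {0..T}" "t \<in> {0..T}" "s \<le> t"
    then show "dist (regularize \<Lambda> (dyad_sq T n x) s) (regularize \<Lambda> (dyad_sq T n x) t) \<le> \<Lambda> * dist s t"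
      using R(2)[of s t] R(3)[of s t] by (simp add: dist_real_def abs_if)
  qed fact
  then have "continuous_on {0..T} (regularize \<Lambda> (dyad_sq T n x))"
    by (rule lipschitz_on_continuous_on)
  then have "continuous_on {0..T} (qn T \<Lambda> n x)"
    by (subst continuous_on_cong[OF refl]) (auto simp: qn_def)
  then show ?thesis
    using R assms by (auto simp: Abr_def mspace_cpaths qn_def algebra_simps)
qed

lemma ereal_Qlim:
  assumes "0 < T" "0 \<le> \<Lambda>" "t \<in> {0..T}"
  shows "ereal (Qlim T \<Lambda> x t) = limsup (\<lambda>n. ereal (qn T \<Lambda> n x t))"
proof -
  have "0 \<le> qn T \<Lambda> n x t \<and> qn T \<Lambda> n x t \<le> \<Lambda> * t" for n
    using qn_in_Abr[OF assms(1,2), of n x] assms(3) by (force simp: Abr_def)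
  then have "0 \<le> limsup (\<lambda>n. ereal (qn T \<Lambda> n x t))"
      "limsup (\<lambda>n. ereal (qn T \<Lambda> n x t)) \<le> ereal (\<Lambda> * t)"
    by (auto intro!: Limsup_bounded le_Limsup)
  then show ?thesis
    using assms(3) by (cases "limsup (\<lambda>n. ereal (qn T \<Lambda> n x t))") (auto simp: Qlim_def)
qed

section \<open>Martingale measures with bracket rate at most \<open>\<Lambda>\<close>\<close>

text \<open>Generators of the \<open>\<sigma>\<close>-algebra generated by the coordinates up to time \<open>t\<close>.\<close>

definition coord_gen :: "real \<Rightarrow> real \<Rightarrow> path set set" where
  "coord_gen T t = {{x \<in> mspace (Omega T). x u \<in> B} | u B. u \<in> {0..t} \<and> B \<in> sets borel}"

text \<open>The usual augmentation: all null sets of the completion are added, and the filtration is made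
  right-continuous. Capping \<open>s\<close> at \<open>T\<close> makes the \<open>\<sigma>\<close>-algebra at time \<open>T\<close> the completed natural one.
  The intersection is itself a \<open>\<sigma>\<close>-algebra, so \<^const>\<open>sigma\<close> only turns it into a measure space.\<close>

definition aug_filt :: "real \<Rightarrow> path measure \<Rightarrow> real \<Rightarrow> path measure" where
  "aug_filt T P t = sigma (mspace (Omega T))
     (\<Inter>s\<in>{t<..}. sigma_sets (mspace (Omega T)) (coord_gen T (min s T) \<union> null_sets (completion P)))"

definition martingale :: "real \<Rightarrow> 'a measure \<Rightarrow> (real \<Rightarrow> 'a measure) \<Rightarrow> (real \<Rightarrow> 'a \<Rightarrow> real) \<Rightarrow> bool" where
  "martingale T M F Y \<longleftrightarrow>
     (\<forall>t\<in>{0..T}. Y t \<in> borel_measurable (F t) \<and> integrable M (Y t)) \<and>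
     (\<forall>s t. 0 \<le> s \<and> s \<le> t \<and> t \<le> T \<longrightarrow> (AE x in M. real_cond_exp M (F s) (Y t) x = Y s x))"

definition predictable_sigma :: "real \<Rightarrow> 'a set \<Rightarrow> (real \<Rightarrow> 'a measure) \<Rightarrow> (real \<times> 'a) measure" where
  "predictable_sigma T \<Omega> F = sigma ({0..T} \<times> \<Omega>)
     ({{0} \<times> B | B. B \<in> sets (F 0)} \<union>
      {{s<..t} \<times> B | s t B. 0 \<le> s \<and> s \<le> t \<and> t \<le> T \<and> B \<in> sets (F s)})"

text \<open>\<open>A\<close> is a continuous predictable version of the bracket of the coordinate process under \<open>P\<close>:
  the (up to indistinguishability unique) continuous, increasing, predictable process started
  at \<open>0\<close> for which \<open>X\<^sup>2 - A\<close> is a martingale.\<close>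

definition is_bracket :: "real \<Rightarrow> path measure \<Rightarrow> (real \<Rightarrow> path \<Rightarrow> real) \<Rightarrow> bool" where
  "is_bracket T P A \<longleftrightarrow>
     (\<lambda>(t, x). A t x) \<in> borel_measurable (predictable_sigma T (mspace (Omega T)) (aug_filt T P)) \<and>
     (AE x in P. A 0 x = 0 \<and> continuous_on {0..T} (\<lambda>t. A t x) \<and> mono_on {0..T} (\<lambda>t. A t x)) \<and>
     martingale T (completion P) (aug_filt T P) (\<lambda>t x. (x t)\<^sup>2 - A t x)"

definition MLam :: "real \<Rightarrow> real \<Rightarrow> path measure set" where
  "MLam T \<Lambda> = {P. prob_space P \<and> sets P = sets (borel_of (mtopology_of (Omega T))) \<and>
     martingale T (completion P) (aug_filt T P) (\<lambda>t x. x t) \<and>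
     (\<forall>t\<in>{0..T}. integrable P (\<lambda>x. (x t)\<^sup>2)) \<and>
     (\<exists>A. is_bracket T P A \<and>
        (AE x in P. \<forall>s t. 0 \<le> s \<and> s \<le> t \<and> t \<le> T \<longrightarrow> A t x - A s x \<le> \<Lambda> * (t - s)))}"

end

theory Submission
  imports Defs "HOL-Complex_Analysis.Great_Picard"
begin

text \<open>No stochastic integration is used. Under \<open>P \<in> MLam T \<Lambda>\<close> the conditional second moments of increments
  are at most \<open>\<Lambda> (t - s)\<close>, and path continuity yields a Lindeberg condition; a second order Taylor expansion
  along ever finer partitions then bounds all even moments of increments, conditionally on the past.
  Consequently the differences between dyadic square sums and the bracket are discrete martingales whose
  \<open>2m\<close>-th moments are \<open>O(2 ^ (- n m))\<close> by a discrete Gronwall argument, uniformly in \<open>P\<close>, and Doob's inequality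
  controls their maxima. Regularization is \<open>1\<close>-Lipschitz for the supremum norm and fixes \<open>\<Lambda>\<close>-Lipschitz
  increasing functions, so the same bounds hold for \<open>q\<^sup>n\<close> minus the bracket; summability in \<open>n\<close> identifies
  the limit. The compact sets are cut out by a modulus of continuity on dyadic increments and a geometric
  rate for \<open>q\<^sup>n - q\<^sup>n\<^sup>+\<^sup>1\<close>, both closed conditions.\<close>

text \<open>Conditional statements are phrased as integrals against weights known at the earlier
  time; conditional expectations enter only through \<open>martingale_weighted\<close>. At the start
  only second moments of the process are known, so higher powers of increments cannot be expanded
  directly. The expansion is applied to functions whose second derivative is a truncated power, and
  integrability of the next even power then comes out of monotone convergence, in place of stopping
  times. Exponents \<open>4 * Suc l\<close> arise because the maximum is estimated in L^2 for the
  submartingale of powers \<open>2 * Suc l\<close>; a general exponent is reached by scaling the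
  error with 2^(-n/2). The class supplies one bracket with the rate bound, while the theorem speaks
  about every bracket, so uniqueness has to be proved as well, for a second bracket that is only
  known to be integrable, continuous and increasing. The augmented filtration contains null sets of
  the completion, hence the probabilistic argument runs on \<open>completion P\<close>.\<close>

locale filtered_prob = prob_space M for M :: "'a measure" +
  fixes F :: "real \<Rightarrow> 'a measure" and T :: real
  assumes subalgebra_F: "t \<in> {0..T} \<Longrightarrow> subalgebra M (F t)"
    and F_mono: "0 \<le> s \<Longrightarrow> s \<le> t \<Longrightarrow> t \<le> T \<Longrightarrow> sets (F s) \<subseteq> sets (F t)"
begin

lemma space_F: "t \<in> {0..T} \<Longrightarrow> space (F t) = space M"
  using subalgebra_F by (simp add: subalgebra_def)

lemma measurable_F_mono:
  assumes "f \<in> borel_measurable (F s)" "0 \<le> s" "s \<le> t" "t \<le> T"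
  shows "f \<in> borel_measurable (F t)"
proof (rule measurable_from_subalg[OF _ assms(1)])
  show "subalgebra (F t) (F s)"
    using assms F_mono space_F[of s] space_F[of t] by (auto simp: subalgebra_def)
qed

lemma measurable_F: "t \<in> {0..T} \<Longrightarrow> f \<in> borel_measurable (F t) \<Longrightarrow> f \<in> borel_measurable M"
  by (rule measurable_from_subalg[OF subalgebra_F])

lemma martingale_adapted: "martingale T M F Y \<Longrightarrow> t \<in> {0..T} \<Longrightarrow> Y t \<in> borel_measurable (F t)"
  and martingale_integrable: "martingale T M F Y \<Longrightarrow> t \<in> {0..T} \<Longrightarrow> integrable M (Y t)"
  by (auto simp: martingale_def)

lemma martingale_weighted:
  assumes Y: "martingale T M F Y" and st: "0 \<le> s" "s \<le> t" "t \<le> T"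
    and f: "f \<in> borel_measurable (F s)" and int: "integrable M (\<lambda>x. f x * Y t x)"
  shows "integrable M (\<lambda>x. f x * Y s x)" "(\<integral>x. f x * Y t x \<partial>M) = (\<integral>x. f x * Y s x \<partial>M)"
proof -
  have s: "s \<in> {0..T}" and t: "t \<in> {0..T}"
    using st by auto
  interpret fs: finite_measure_subalgebra M "F s"
    by unfold_locales (rule subalgebra_F[OF s])
  note Ym[measurable] = measurable_F[OF s martingale_adapted[OF Y s]]
    measurable_F[OF t martingale_adapted[OF Y t]] measurable_F[OF s f]
  have ae: "AE x in M. f x * real_cond_exp M (F s) (Y t) x = f x * Y s x"
  proof -
    have "AE x in M. real_cond_exp M (F s) (Y t) x = Y s x"
      using Y st by (simp add: martingale_def)
    then show ?thesis by eventually_elim simp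
  qed
  note * = fs.real_cond_exp_intg[OF int f]
  show "integrable M (\<lambda>x. f x * Y s x)"
    using *(1) by (rule integrable_cong_AE_imp) (use ae in \<open>auto\<close>)
  have "(\<integral>x. f x * real_cond_exp M (F s) (Y t) x \<partial>M) = (\<integral>x. f x * Y s x \<partial>M)"
    using ae by (intro integral_cong_AE) auto
  then show "(\<integral>x. f x * Y t x \<partial>M) = (\<integral>x. f x * Y s x \<partial>M)"
    using *(2) by simp
qed

end

section \<open>Weighted second moments of a martingale with Lipschitz bracket\<close>

lemma integrable_bounded_mult:
  fixes f g :: "'a \<Rightarrow> real"
  assumes "integrable M f" "g \<in> borel_measurable M" "\<And>x. \<bar>g x\<bar> \<le> b"
  shows "integrable M (\<lambda>x. g x * f x)"
proof (rule Bochner_Integration.integrable_bound)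
  show "integrable M (\<lambda>x. b * f x)"
    using assms by simp
  show "AE x in M. norm (g x * f x) \<le> norm (b * f x)"
  proof (intro AE_I2)
    fix x
    have "\<bar>g x\<bar> * \<bar>f x\<bar> \<le> \<bar>b\<bar> * \<bar>f x\<bar>"
      using assms(3)[of x] by (intro mult_right_mono) auto
    then show "norm (g x * f x) \<le> norm (b * f x)" by (simp add: abs_mult)
  qed
qed (use assms in measurable)

lemma integrable_mult_of_squares:
  fixes f g :: "'a \<Rightarrow> real"
  assumes [measurable]: "f \<in> borel_measurable M" "g \<in> borel_measurable M"
    and "integrable M (\<lambda>x. (f x)\<^sup>2)" "integrable M (\<lambda>x. (g x)\<^sup>2)"
  shows "integrable M (\<lambda>x. f x * g x)"
proof (rule Bochner_Integration.integrable_bound)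
  show "integrable M (\<lambda>x. (f x)\<^sup>2 + (g x)\<^sup>2)"
    using assms by simp
  have "\<bar>a * b\<bar> \<le> a\<^sup>2 + b\<^sup>2" for a b :: real
  proof -
    have "0 \<le> (\<bar>a\<bar> - \<bar>b\<bar>)\<^sup>2 + a\<^sup>2 + b\<^sup>2" by simp
    then show ?thesis by (simp add: power2_eq_square abs_mult algebra_simps)
  qed
  then show "AE x in M. norm (f x * g x) \<le> norm ((f x)\<^sup>2 + (g x)\<^sup>2)"
    by (intro AE_I2) simp
qed measurable

text \<open>\<open>M\<close> will be the completion of a law in the class, \<open>X\<close> the
  coordinate process and \<open>A\<close> one bracket obeying the rate bound. Properties of the
  paths of \<open>A\<close> are available almost surely, continuity of \<open>X\<close> at every
  point.\<close>

locale bracket_process = filtered_prob +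
  fixes X A :: "real \<Rightarrow> 'a \<Rightarrow> real" and \<Lambda> :: real
  assumes Lam_nonneg: "0 \<le> \<Lambda>"
    and X_mart: "martingale T M F X"
    and X_sq_int: "t \<in> {0..T} \<Longrightarrow> integrable M (\<lambda>x. (X t x)\<^sup>2)"
    and XA_mart: "martingale T M F (\<lambda>t x. (X t x)\<^sup>2 - A t x)"
    and X_cont: "x \<in> space M \<Longrightarrow> continuous_on {0..T} (\<lambda>t. X t x)"
    and A_0: "AE x in M. A 0 x = 0"
    and A_lip: "AE x in M. \<forall>s t. 0 \<le> s \<and> s \<le> t \<and> t \<le> T \<longrightarrow> 0 \<le> A t x - A s x \<and> A t x - A s x \<le> \<Lambda> * (t - s)"
begin

lemma X_F: "0 \<le> s \<Longrightarrow> s \<le> t \<Longrightarrow> t \<le> T \<Longrightarrow> X s \<in> borel_measurable (F t)"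
  using measurable_F_mono[of "X s" s t] martingale_adapted[OF X_mart, of s] by auto

lemma X_M [measurable]: "t \<in> {0..T} \<Longrightarrow> X t \<in> borel_measurable M"
  using measurable_F X_F[of t t] by auto

lemma A_F: assumes "0 \<le> s" "s \<le> t" "t \<le> T" shows "A s \<in> borel_measurable (F t)"
proof -
  have s: "s \<in> {0..T}"
    using assms by auto
  have "(\<lambda>x. (X s x)\<^sup>2 - ((X s x)\<^sup>2 - A s x)) \<in> borel_measurable (F s)"
    by (rule borel_measurable_diff[OF borel_measurable_power[OF martingale_adapted[OF X_mart s]]
      martingale_adapted[OF XA_mart s]])
  then have "A s \<in> borel_measurable (F s)" by simp
  then show ?thesis
    using assms by (rule measurable_F_mono)
qed

lemma A_M [measurable]: "t \<in> {0..T} \<Longrightarrow> A t \<in> borel_measurable M"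
  using measurable_F A_F[of t t] by auto

lemma A_int: assumes "t \<in> {0..T}" shows "integrable M (A t)"
proof -
  have "integrable M (\<lambda>x. (X t x)\<^sup>2 - ((X t x)\<^sup>2 - A t x))"
    by (rule Bochner_Integration.integrable_diff[OF X_sq_int[OF assms] martingale_integrable[OF XA_mart assms]])
  then show ?thesis by simp
qed

lemma X_prod_int: "s \<in> {0..T} \<Longrightarrow> t \<in> {0..T} \<Longrightarrow> integrable M (\<lambda>x. X s x * X t x)"
  by (intro integrable_mult_of_squares X_sq_int) auto

lemma incr_sq_int: assumes "s \<in> {0..T}" "t \<in> {0..T}" shows "integrable M (\<lambda>x. (X t x - X s x)\<^sup>2)"
proof -
  have "integrable M (\<lambda>x. (X t x)\<^sup>2 + (X s x)\<^sup>2 - 2 * (X t x * X s x))"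
    using X_sq_int[of s] X_sq_int[of t] X_prod_int[of t s] assms by simp
  then show ?thesis by (simp add: power2_diff mult.assoc)
qed

context
  fixes s t :: real and Z :: "'a \<Rightarrow> real" and z :: real
  assumes st: "0 \<le> s" "s \<le> t" "t \<le> T"
    and Z: "Z \<in> borel_measurable (F s)" and Z_bound: "\<And>x. \<bar>Z x\<bar> \<le> z"
begin

private lemma Z_M [measurable]: "Z \<in> borel_measurable M"
  using Z measurable_F[of s] st by auto

lemma weighted_int:
  "integrable M (\<lambda>x. Z x * (X t x - X s x)\<^sup>2)"
  by (rule integrable_bounded_mult[OF incr_sq_int _ Z_bound]) (use st in auto)

text \<open>Orthogonality of increments: \<open>Z x * X s x\<close> is measurable at time
  \<open>s\<close>, so \<open>X t\<close> may be replaced by \<open>X s\<close> in the mixed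
  term.\<close>

lemma weighted_incr_sq_eq_diff:
  "(\<integral>x. Z x * (X t x - X s x)\<^sup>2 \<partial>M) = (\<integral>x. Z x * (X t x)\<^sup>2 \<partial>M) - (\<integral>x. Z x * (X s x)\<^sup>2 \<partial>M)"
proof -
  have T: "s \<in> {0..T}" "t \<in> {0..T}"
    using st by auto
  have ZX: "(\<lambda>x. Z x * X s x) \<in> borel_measurable (F s)"
    using Z X_F[of s s] st by auto
  note int = integrable_bounded_mult[OF _ Z_M Z_bound]
  note i1 = int[OF X_sq_int[OF T(1)]] and i2 = int[OF X_sq_int[OF T(2)]]
  have i5: "integrable M (\<lambda>x. (Z x * X s x) * X t x)"
    using int[OF X_prod_int[OF T]] by (simp add: mult.assoc)
  note m1 = martingale_weighted[OF X_mart st ZX i5]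
  have "(\<integral>x. Z x * (X t x - X s x)\<^sup>2 \<partial>M)
      = (\<integral>x. Z x * (X t x)\<^sup>2 - 2 * ((Z x * X s x) * X t x) + Z x * (X s x)\<^sup>2 \<partial>M)"
    by (intro Bochner_Integration.integral_cong) (auto simp: power2_eq_square algebra_simps)
  also have "\<dots> = (\<integral>x. Z x * (X t x)\<^sup>2 \<partial>M) - 2 * (\<integral>x. (Z x * X s x) * X t x \<partial>M) + (\<integral>x. Z x * (X s x)\<^sup>2 \<partial>M)"
    using i1 i2 i5 by simp
  also have "(\<integral>x. (Z x * X s x) * X t x \<partial>M) = (\<integral>x. Z x * (X s x)\<^sup>2 \<partial>M)"
    using m1(2) by (simp add: power2_eq_square mult.assoc)
  finally show ?thesis by simp
qed

lemma weighted_incr_sq: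
  "(\<integral>x. Z x * (X t x - X s x)\<^sup>2 \<partial>M) = (\<integral>x. Z x * (A t x - A s x) \<partial>M)"
proof -
  have T: "s \<in> {0..T}" "t \<in> {0..T}"
    using st by auto
  note int = integrable_bounded_mult[OF _ Z_M Z_bound]
  note i1 = int[OF X_sq_int[OF T(1)]] and i2 = int[OF X_sq_int[OF T(2)]]
    and i3 = int[OF A_int[OF T(1)]] and i4 = int[OF A_int[OF T(2)]]
  have i6: "integrable M (\<lambda>x. Z x * ((X t x)\<^sup>2 - A t x))"
    using i2 i4 by (simp add: right_diff_distrib)
  note m2 = martingale_weighted[OF XA_mart st Z i6]
  show ?thesis
    unfolding weighted_incr_sq_eq_diff using m2(2) i1 i2 i3 i4 by (simp add: right_diff_distrib)
qed

text \<open>The submartingale property of the square in weighted form. It transports a large value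
  at an intermediate time to the final time of a partition.\<close>

lemma weighted_sq_mono:
  assumes "\<And>x. 0 \<le> Z x"
  shows "(\<integral>x. Z x * (X s x)\<^sup>2 \<partial>M) \<le> (\<integral>x. Z x * (X t x)\<^sup>2 \<partial>M)"
proof -
  have "0 \<le> (\<integral>x. Z x * (X t x - X s x)\<^sup>2 \<partial>M)"
    using assms by (intro integral_nonneg_AE) auto
  then show ?thesis
    unfolding weighted_incr_sq_eq_diff by simp
qed

lemma weighted_incr_sq_le:
  assumes "\<And>x. 0 \<le> Z x"
  shows "(\<integral>x. Z x * (X t x - X s x)\<^sup>2 \<partial>M) \<le> \<Lambda> * (t - s) * (\<integral>x. Z x \<partial>M)"
proof -
  have T: "s \<in> {0..T}" "t \<in> {0..T}"
    using st by auto
  have Zi: "integrable M Z"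
    using integrable_bounded_mult[OF _ Z_M Z_bound, of "\<lambda>_. 1"] by simp
  have "(\<integral>x. Z x * (A t x - A s x) \<partial>M) \<le> (\<integral>x. \<Lambda> * (t - s) * Z x \<partial>M)"
  proof (rule integral_mono_AE)
    show "integrable M (\<lambda>x. Z x * (A t x - A s x))"
      by (rule integrable_bounded_mult[OF _ Z_M Z_bound]) (use A_int T in auto)
    show "AE x in M. Z x * (A t x - A s x) \<le> \<Lambda> * (t - s) * Z x"
      using A_lip
    proof eventually_elim
      case (elim x)
      then show ?case
        using st assms[of x] by (auto simp: mult.commute[of "Z x"] intro!: mult_right_mono)
    qed
  qed (use Zi in auto)
  then show ?thesis
    using Zi weighted_incr_sq by simp
qed

end

end

(* Conditional measurability rules among the premises send this simproc into a loop. *)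
declare [[simproc del: measurable]]

section \<open>The Lindeberg condition\<close>

context bracket_process
begin

lemma grid_mono:
  fixes u :: "nat \<Rightarrow> real"
  assumes "\<And>k. k < N \<Longrightarrow> u k \<le> u (Suc k)" "j \<le> k" "k \<le> N"
  shows "u j \<le> u k"
  using assms(2,3)
proof (induction k rule: dec_induct)
  case (step n)
  then show ?case
    using assms(1)[of n] by simp
qed simp

text \<open>Only the first large increment matters: after it, and wherever \<open>\<bar>X\<bar> > K\<close>, the conditional variance
  bound \<open>\<Lambda> (t - s)\<close> suffices, and at it \<open>X (u (Suc k))\<^sup>2\<close> is dominated in mean by \<open>X (u N)\<^sup>2\<close>.\<close>

lemma lindeberg_bound:
  fixes u :: "nat \<Rightarrow> real" and N :: nat and K \<delta> :: real
  defines "D \<equiv> \<lambda>k x. X (u (Suc k)) x - X (u k) x"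
  defines "E \<equiv> {x \<in> space M. \<exists>k\<in>{..<N}. \<delta> < \<bar>D k x\<bar>}"
  assumes u0: "0 \<le> u 0" and u_Suc: "\<And>k. k < N \<Longrightarrow> u k \<le> u (Suc k)" and uN: "u N \<le> T"
    and K: "0 < K"
  shows "(\<Sum>k<N. \<integral>x. (if \<delta> < \<bar>D k x\<bar> then (D k x)\<^sup>2 else 0) \<partial>M)
    \<le> (\<Lambda> * T + 2 * K\<^sup>2) * prob E + \<Lambda> * T * ((\<integral>x. (X (u N) x)\<^sup>2 \<partial>M) / K\<^sup>2)
      + 2 * (\<integral>x. indicator E x * (X (u N) x)\<^sup>2 \<partial>M)"
proof -
  \<comment> \<open>Here \<open>p\<close> marks a large increment, \<open>b\<close> an earlier large
    one, \<open>h\<close> a starting value beyond \<open>K\<close>, and \<open>J\<close> the first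
    large increment. At every large increment one of \<open>b\<close>, \<open>h\<close>,
    \<open>J\<close> equals 1. The first two are known at time \<open>u k\<close>, so the variance
    bound applies to them; \<open>J\<close> is known only at \<open>u (Suc k)\<close> and needs the
    domination by the final square.\<close>
  define p where "p = (\<lambda>k x. \<delta> < \<bar>D k x\<bar>)"
  define b :: "nat \<Rightarrow> 'a \<Rightarrow> real" where "b = (\<lambda>k x. if \<exists>j\<in>{..<k}. p j x then 1 else 0)"
  define h :: "nat \<Rightarrow> 'a \<Rightarrow> real" where "h = (\<lambda>k x. if K < \<bar>X (u k) x\<bar> then 1 else 0)"
  define J :: "nat \<Rightarrow> 'a \<Rightarrow> real" where "J = (\<lambda>k x. if p k x \<and> \<not> (\<exists>j\<in>{..<k}. p j x) then 1 else 0)"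
  define V where "V = (\<integral>x. (X (u N) x)\<^sup>2 \<partial>M)"
  note mono = grid_mono[of N u, OF u_Suc]
  have uT: "0 \<le> u k \<and> u k \<le> T" if "k \<le> N" for k
    using mono[of 0 k] mono[of k N] that u0 uN by auto
  have XF: "X (u j) \<in> borel_measurable (F (u k))" if "j \<le> k" "k \<le> N" for j k
    by (rule X_F) (use uT[of j] uT[of k] mono[of j k] that in auto)
  have XM: "X (u k) \<in> borel_measurable M" if "k \<le> N" for k
    by (rule X_M) (use uT that in auto)
  have pF: "Measurable.pred (F (u k)) (p j)" if "j < k" "k \<le> N" for j k
  proof -
    have [measurable]: "X (u (Suc j)) \<in> borel_measurable (F (u k))" "X (u j) \<in> borel_measurable (F (u k))"
      using that by (auto intro!: XF)
    show ?thesis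
      unfolding p_def D_def by measurable
  qed
  have pM: "Measurable.pred M (p j)" if "j < N" for j
  proof -
    have [measurable]: "X (u (Suc j)) \<in> borel_measurable M" "X (u j) \<in> borel_measurable M"
      using that by (auto intro!: XM)
    show ?thesis
      unfolding p_def D_def by measurable
  qed
  have bF: "b k \<in> borel_measurable (F (u k))" if "k \<le> N" for k
  proof -
    have [measurable]: "Measurable.pred (F (u k)) (\<lambda>x. \<exists>j\<in>{..<k}. p j x)"
      by (rule pred_intros_finite) (use pF that in auto)
    show ?thesis
      unfolding b_def by measurable
  qed
  have hF: "h k \<in> borel_measurable (F (u k))" if "k \<le> N" for k
  proof -
    note [measurable] = XF[OF order_refl that]
    show ?thesis
      unfolding h_def by measurable
  qed
  have JF: "J k \<in> borel_measurable (F (u (Suc k)))" if "k < N" for k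
  proof -
    have [measurable]: "Measurable.pred (F (u (Suc k))) (\<lambda>x. \<exists>j\<in>{..<k}. p j x)"
      by (rule pred_intros_finite) (use pF that in auto)
    have [measurable]: "Measurable.pred (F (u (Suc k))) (p k)"
      using pF that by auto
    show ?thesis
      unfolding J_def by measurable
  qed
  have toM: "f \<in> borel_measurable M" if "f \<in> borel_measurable (F (u k))" "k \<le> N" for f :: "'a \<Rightarrow> real" and k
    by (rule measurable_F[OF _ that(1)]) (use uT[of k] that(2) in auto)
  have E_eq: "E = {x \<in> space M. \<exists>j\<in>{..<N}. p j x}" by (simp add: E_def p_def)
  have Em[measurable]: "E \<in> sets M"
    unfolding E_eq by (rule predE, rule pred_intros_finite) (use pM in auto)
  have E_sp: "E \<inter> space M = E" by (auto simp: E_def)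
  have bdd: "\<bar>b k x\<bar> \<le> 1" "\<bar>h k x\<bar> \<le> 1" "\<bar>J k x\<bar> \<le> 1" "0 \<le> b k x" "0 \<le> h k x" "0 \<le> J k x" for k x
    by (auto simp: b_def h_def J_def)
  have const_int: "integrable M f" if "f \<in> borel_measurable (F (u k))" "k \<le> N" "\<And>x. \<bar>f x\<bar> \<le> 1" for f :: "'a \<Rightarrow> real" and k
    using that toM by (intro integrable_const_bound[of _ 1]) auto
  have V_le: "(\<integral>x. (X (u k) x)\<^sup>2 \<partial>M) \<le> V" if "k \<le> N" for k
    using weighted_sq_mono[of "u k" "u N" "\<lambda>_. 1" 1, OF _ _ _ borel_measurable_const] that uT[of k] uT[of N] mono[of k N]
    by (simp add: V_def)
  have V0: "0 \<le> V" by (simp add: V_def)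
  have step: "(\<integral>x. (if p k x then (D k x)\<^sup>2 else 0) \<partial>M)
     \<le> \<Lambda> * (u (Suc k) - u k) * (prob E + V / K\<^sup>2) + 2 * (\<integral>x. J k x * (X (u N) x)\<^sup>2 \<partial>M) + 2 * K\<^sup>2 * (\<integral>x. J k x \<partial>M)"
    if k: "k < N" for k
  proof -
    have D: "D k x = X (u (Suc k)) x - X (u k) x" for x by (simp add: D_def)
    have uk: "0 \<le> u k" "u k \<le> u (Suc k)" "u (Suc k) \<le> T" "u (Suc k) \<le> u N" "0 \<le> u (Suc k)"
      using uT[of k] uT[of "Suc k"] mono[of k "Suc k"] mono[of "Suc k" N] k by auto
    note kN = less_imp_le[OF k]
    have i1: "integrable M (\<lambda>x. b k x * (D k x)\<^sup>2)"
      unfolding D by (rule weighted_int[of _ _ _ 1]) (use uk bF kN bdd in auto)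
    have i2: "integrable M (\<lambda>x. h k x * (D k x)\<^sup>2)"
      unfolding D by (rule weighted_int[of _ _ _ 1]) (use uk hF kN bdd in auto)
    have i3: "integrable M (J k)" by (rule const_int[of _ "Suc k"]) (use JF k bdd in auto)
    have JM: "J k \<in> borel_measurable M" by (rule toM[of _ "Suc k"]) (use JF k in auto)
    have i4: "integrable M (\<lambda>x. J k x * (X (u (Suc k)) x)\<^sup>2)"
      by (rule integrable_bounded_mult[OF _ JM, of _ 1]) (use X_sq_int[of "u (Suc k)"] uk bdd in auto)
    have "(\<integral>x. (if p k x then (D k x)\<^sup>2 else 0) \<partial>M)
       \<le> (\<integral>x. b k x * (D k x)\<^sup>2 + h k x * (D k x)\<^sup>2 + 2 * (J k x * (X (u (Suc k)) x)\<^sup>2) + 2 * K\<^sup>2 * J k x \<partial>M)"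
    proof (rule integral_mono_AE)
      show "integrable M (\<lambda>x. b k x * (D k x)\<^sup>2 + h k x * (D k x)\<^sup>2 + 2 * (J k x * (X (u (Suc k)) x)\<^sup>2) + 2 * K\<^sup>2 * J k x)"
        using i1 i2 i3 i4 by auto
      have [measurable]: "X (u (Suc k)) \<in> borel_measurable M" "X (u k) \<in> borel_measurable M" "Measurable.pred M (p k)"
        using XM k pM by auto
      show "integrable M (\<lambda>x. if p k x then (D k x)\<^sup>2 else 0)"
      proof (rule Bochner_Integration.integrable_bound)
        show "integrable M (\<lambda>x. (D k x)\<^sup>2)"
          unfolding D by (rule incr_sq_int) (use uk in auto)
        show "(\<lambda>x. if p k x then (D k x)\<^sup>2 else 0) \<in> borel_measurable M"
          unfolding D by measurable
      qed auto
      show "AE x in M. (if p k x then (D k x)\<^sup>2 else 0)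
        \<le> b k x * (D k x)\<^sup>2 + h k x * (D k x)\<^sup>2 + 2 * (J k x * (X (u (Suc k)) x)\<^sup>2) + 2 * K\<^sup>2 * J k x"
      proof (intro AE_I2)
        fix x
        show "(if p k x then (D k x)\<^sup>2 else 0)
          \<le> b k x * (D k x)\<^sup>2 + h k x * (D k x)\<^sup>2 + 2 * (J k x * (X (u (Suc k)) x)\<^sup>2) + 2 * K\<^sup>2 * J k x"
        proof (cases "p k x \<and> b k x = 0 \<and> h k x = 0")
          case True
          then have J: "J k x = 1" and "\<bar>X (u k) x\<bar> \<le> K"
            by (auto simp: J_def b_def h_def split: if_splits)
          then have X: "(X (u k) x)\<^sup>2 \<le> K\<^sup>2"
            using power_mono[of "\<bar>X (u k) x\<bar>" K 2] by simp
          have "0 \<le> (X (u (Suc k)) x + X (u k) x)\<^sup>2" by simp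
          then have "(D k x)\<^sup>2 \<le> 2 * (X (u (Suc k)) x)\<^sup>2 + 2 * (X (u k) x)\<^sup>2"
            unfolding D by (simp add: power2_eq_square algebra_simps)
          then show ?thesis
            using True J X by simp
        next
          case False
          have nn: "0 \<le> b k x * (D k x)\<^sup>2" "0 \<le> h k x * (D k x)\<^sup>2" "0 \<le> J k x * (X (u (Suc k)) x)\<^sup>2" "0 \<le> K\<^sup>2 * J k x"
            using bdd[of k x] by simp_all
          show ?thesis
          proof (cases "p k x")
            case True
            with False have "b k x = 1 \<or> h k x = 1"
              by (auto simp: b_def h_def split: if_splits)
            then show ?thesis
              using nn True by auto
          qed (use nn in auto)
        qed
      qed
    qed
    also have "\<dots> = (\<integral>x. b k x * (D k x)\<^sup>2 \<partial>M) + (\<integral>x. h k x * (D k x)\<^sup>2 \<partial>M)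
        + 2 * (\<integral>x. J k x * (X (u (Suc k)) x)\<^sup>2 \<partial>M) + 2 * K\<^sup>2 * (\<integral>x. J k x \<partial>M)"
      using i1 i2 i3 i4 by simp
    also have "(\<integral>x. b k x * (D k x)\<^sup>2 \<partial>M) \<le> \<Lambda> * (u (Suc k) - u k) * (\<integral>x. b k x \<partial>M)"
      unfolding D by (rule weighted_incr_sq_le[of _ _ _ 1]) (use uk bF kN bdd in auto)
    also have "\<dots> \<le> \<Lambda> * (u (Suc k) - u k) * prob E"
    proof (rule mult_left_mono)
      have "(\<integral>x. b k x \<partial>M) \<le> (\<integral>x. indicator E x \<partial>M)"
      proof (rule integral_mono_AE)
        show "integrable M (b k)" by (rule const_int[of _ k]) (use bF kN bdd in auto)
        show "AE x in M. b k x \<le> indicator E x"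
          using k by (intro AE_I2) (force simp: b_def E_eq split: if_splits split_indicator)
      qed (rule integrable_real_indicator[OF Em], simp add: less_top[symmetric])
      then show "(\<integral>x. b k x \<partial>M) \<le> prob E" by (simp add: E_sp)
    qed (use uk Lam_nonneg in simp)
    also have "(\<integral>x. h k x * (D k x)\<^sup>2 \<partial>M) \<le> \<Lambda> * (u (Suc k) - u k) * (\<integral>x. h k x \<partial>M)"
      unfolding D by (rule weighted_incr_sq_le[of _ _ _ 1]) (use uk hF kN bdd in auto)
    also have "\<dots> \<le> \<Lambda> * (u (Suc k) - u k) * (V / K\<^sup>2)"
    proof (rule mult_left_mono)
      have "(\<integral>x. h k x \<partial>M) \<le> (\<integral>x. (X (u k) x)\<^sup>2 / K\<^sup>2 \<partial>M)"
      proof (rule integral_mono_AE)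
        show "integrable M (h k)" by (rule const_int[of _ k]) (use hF kN bdd in auto)
        show "integrable M (\<lambda>x. (X (u k) x)\<^sup>2 / K\<^sup>2)"
          using X_sq_int[of "u k"] uT[of k] kN by auto
        show "AE x in M. h k x \<le> (X (u k) x)\<^sup>2 / K\<^sup>2"
        proof (intro AE_I2)
          fix x
          have "K\<^sup>2 \<le> (X (u k) x)\<^sup>2" if "K < \<bar>X (u k) x\<bar>"
            using power_mono[of K "\<bar>X (u k) x\<bar>" 2] that K by simp
          then show "h k x \<le> (X (u k) x)\<^sup>2 / K\<^sup>2"
            using K by (auto simp: h_def)
        qed
      qed
      also have "\<dots> \<le> V / K\<^sup>2"
        using V_le[OF kN] K by (simp add: divide_right_mono)
      finally show "(\<integral>x. h k x \<partial>M) \<le> V / K\<^sup>2" .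
    qed (use uk Lam_nonneg in simp)
    also have "(\<integral>x. J k x * (X (u (Suc k)) x)\<^sup>2 \<partial>M) \<le> (\<integral>x. J k x * (X (u N) x)\<^sup>2 \<partial>M)"
      by (rule weighted_sq_mono[of _ _ _ 1]) (use uk uN JF k bdd in auto)
    finally show ?thesis by (simp add: distrib_left)
  qed
  \<comment> \<open>At most one increment is the first large one, so the \<open>J k\<close> add up
    to the indicator of \<open>E\<close> and the sum over \<open>k\<close> costs no factor
    \<open>N\<close>.\<close>
  have sumJ: "(\<Sum>k<N. J k x) = indicator E x" if "x \<in> space M" for x
  proof -
    have "(\<Sum>k<n. J k x) = (if \<exists>j\<in>{..<n}. p j x then 1 else 0)" for n
    proof (induction n)
      case (Suc n)
      then show ?case by (auto simp: J_def lessThan_Suc)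
    qed simp
    then show ?thesis
      using that by (simp add: E_eq split: split_indicator)
  qed
  have JM: "J k \<in> borel_measurable M" "integrable M (J k)" "integrable M (\<lambda>x. J k x * (X (u N) x)\<^sup>2)" if "k < N" for k
  proof -
    show JM: "J k \<in> borel_measurable M" by (rule toM[of _ "Suc k"]) (use JF that in auto)
    show "integrable M (J k)" by (rule const_int[of _ "Suc k"]) (use JF that bdd in auto)
    show "integrable M (\<lambda>x. J k x * (X (u N) x)\<^sup>2)"
      by (rule integrable_bounded_mult[OF _ JM, of _ 1]) (use X_sq_int[of "u N"] uT[of N] bdd in auto)
  qed
  have "(\<Sum>k<N. \<integral>x. (if p k x then (D k x)\<^sup>2 else 0) \<partial>M)
    \<le> (\<Sum>k<N. \<Lambda> * (u (Suc k) - u k) * (prob E + V / K\<^sup>2) + 2 * (\<integral>x. J k x * (X (u N) x)\<^sup>2 \<partial>M) + 2 * K\<^sup>2 * (\<integral>x. J k x \<partial>M))"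
    by (rule sum_mono) (use step in auto)
  also have "\<dots> = \<Lambda> * (u N - u 0) * (prob E + V / K\<^sup>2) + 2 * (\<Sum>k<N. \<integral>x. J k x * (X (u N) x)\<^sup>2 \<partial>M) + 2 * K\<^sup>2 * (\<Sum>k<N. \<integral>x. J k x \<partial>M)"
  proof -
    have "(\<Sum>k<N. u (Suc k) - u k) = u N - u 0" by (rule sum_lessThan_telescope)
    then show ?thesis by (simp add: sum.distrib flip: sum_distrib_left sum_distrib_right)
  qed
  also have "(\<Sum>k<N. \<integral>x. J k x \<partial>M) = prob E"
  proof -
    have "(\<Sum>k<N. \<integral>x. J k x \<partial>M) = (\<integral>x. (\<Sum>k<N. J k x) \<partial>M)"
      using JM by (subst Bochner_Integration.integral_sum) auto
    also have "\<dots> = (\<integral>x. indicator E x \<partial>M)"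
      by (intro Bochner_Integration.integral_cong sumJ) auto
    finally show ?thesis by (simp add: E_sp)
  qed
  also have "(\<Sum>k<N. \<integral>x. J k x * (X (u N) x)\<^sup>2 \<partial>M) = (\<integral>x. indicator E x * (X (u N) x)\<^sup>2 \<partial>M)"
  proof -
    have "(\<Sum>k<N. \<integral>x. J k x * (X (u N) x)\<^sup>2 \<partial>M) = (\<integral>x. (\<Sum>k<N. J k x * (X (u N) x)\<^sup>2) \<partial>M)"
      using JM by (subst Bochner_Integration.integral_sum) auto
    also have "\<dots> = (\<integral>x. indicator E x * (X (u N) x)\<^sup>2 \<partial>M)"
      by (intro Bochner_Integration.integral_cong) (auto simp: sumJ simp flip: sum_distrib_right)
    finally show ?thesis .
  qed
  also have "\<Lambda> * (u N - u 0) * (prob E + V / K\<^sup>2) \<le> \<Lambda> * T * (prob E + V / K\<^sup>2)"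
    using u0 uN Lam_nonneg V0 by (intro mult_right_mono mult_left_mono) auto
  finally show ?thesis
    unfolding p_def V_def by (simp add: algebra_simps)
qed

text \<open>\<open>K\<close> is fixed first, so large that the Chebyshev term of
  \<open>lindeberg_bound\<close> is small; then the mesh tends to 0. Since paths are uniformly
  continuous, the indicators of the exceptional events vanish eventually at every point, and
  dominated convergence, with dominating functions 1 and \<open>(X t x)^2\<close>, removes the two
  other terms.\<close>

lemma lindeberg:
  fixes s t \<delta> :: real
  defines "u \<equiv> \<lambda>(N::nat) (k::nat). s + real k * ((t - s) / real N)"
  assumes st: "0 \<le> s" "s \<le> t" "t \<le> T" and \<delta>: "0 < \<delta>"
  shows "(\<lambda>N. \<Sum>k<N. \<integral>x. (if \<delta> < \<bar>X (u N (Suc k)) x - X (u N k) x\<bar> then (X (u N (Suc k)) x - X (u N k) x)\<^sup>2 else 0) \<partial>M) \<longlonglongrightarrow> 0"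
    (is "?f \<longlonglongrightarrow> 0")
proof -
  define E where "E = (\<lambda>N. {x \<in> space M. \<exists>k\<in>{..<N}. \<delta> < \<bar>X (u N (Suc k)) x - X (u N k) x\<bar>})"
  define V where "V = (\<integral>x. (X t x)\<^sup>2 \<partial>M)"
  define q where "q = (\<lambda>N. \<integral>x. indicator (E N) x * (X t x)\<^sup>2 \<partial>M)"
  have uN: "u N N = t" if "0 < N" for N
    using that by (simp add: u_def)
  have u0: "u N 0 = s" for N by (simp add: u_def)
  have uS: "u N (Suc k) - u N k = (t - s) / real N" for N k
    unfolding u_def by (cases "N = 0") (simp_all add: field_simps)
  have u_mono: "u N j \<le> u N k" if "j \<le> k" for N j k
    using that st by (auto simp: u_def intro!: mult_right_mono divide_right_mono)
  have uT: "0 \<le> u N k \<and> u N k \<le> T" if "k \<le> N" "0 < N" for N k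
    using u_mono[of 0 k N] u_mono[of k N N] that st u0[of N] uN[of N] by auto
  have T: "t \<in> {0..T}"
    using st by auto
  have Em[measurable]: "E N \<in> sets M" for N
  proof (cases "N = 0")
    case False
    then show ?thesis
      unfolding E_def
    proof (intro predE pred_intros_finite)
      fix k assume "k \<in> {..<N}"
      then have [measurable]: "X (u N (Suc k)) \<in> borel_measurable M" "X (u N k) \<in> borel_measurable M"
        using uT[of k N] uT[of "Suc k" N] False by (auto intro!: X_M)
      show "Measurable.pred M (\<lambda>x. \<delta> < \<bar>X (u N (Suc k)) x - X (u N k) x\<bar>)"
        by measurable
    qed simp
  qed (simp add: E_def)
  have E_lim: "(\<lambda>N. indicator (E N) x :: real) \<longlonglongrightarrow> 0" if x: "x \<in> space M" for x
  proof -
    have "uniformly_continuous_on {0..T} (\<lambda>t. X t x)"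
      using X_cont[OF x] by (rule compact_uniformly_continuous) simp
    then obtain d where d: "0 < d" "\<And>v w. v \<in> {0..T} \<Longrightarrow> w \<in> {0..T} \<Longrightarrow> dist w v < d \<Longrightarrow> dist (X w x) (X v x) < \<delta>"
      using \<delta> unfolding uniformly_continuous_on_def by metis
    have "(\<lambda>N. (t - s) / real N) \<longlonglongrightarrow> 0" by (rule lim_const_over_n)
    then have "\<forall>\<^sub>F N in sequentially. (t - s) / real N < d"
      using d(1) by (rule order_tendstoD)
    then have "\<forall>\<^sub>F N in sequentially. indicator (E N) x = (0 :: real)"
      using eventually_gt_at_top[of 0]
    proof eventually_elim
      case (elim N)
      have "\<bar>X (u N (Suc k)) x - X (u N k) x\<bar> < \<delta>" if "k < N" for k
        using d(2)[of "u N k" "u N (Suc k)"] uT[of k N] uT[of "Suc k" N] uS[of N k] elim that st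
        by (auto simp: dist_real_def)
      then have "x \<notin> E N" by (force simp: E_def)
      then show ?case by simp
    qed
    then show ?thesis by (rule tendsto_eventually)
  qed
  have "(\<lambda>N. \<integral>x. indicator (E N) x \<partial>M) \<longlonglongrightarrow> (\<integral>x. (0::real) \<partial>M)"
  proof (rule integral_dominated_convergence[where w="\<lambda>_. 1"])
    show "(indicator (E N) :: 'a \<Rightarrow> real) \<in> borel_measurable M" for N
      by (rule borel_measurable_indicator[OF Em])
    show "AE x in M. (\<lambda>N. indicator (E N) x :: real) \<longlonglongrightarrow> 0"
      by (intro AE_I2 E_lim)
  qed (rule borel_measurable_const, auto simp: indicator_def)
  moreover have "E N \<inter> space M = E N" for N by (auto simp: E_def)
  ultimately have p_lim: "(\<lambda>N. prob (E N)) \<longlonglongrightarrow> 0" by simp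
  have "(\<lambda>N. q N) \<longlonglongrightarrow> (\<integral>x. 0 \<partial>M)"
    unfolding q_def
  proof (rule integral_dominated_convergence[where w="\<lambda>x. (X t x)\<^sup>2"])
    note [measurable] = X_M[OF T]
    show "(\<lambda>x. indicator (E N) x * (X t x)\<^sup>2) \<in> borel_measurable M" for N
      by measurable
    show "AE x in M. (\<lambda>N. indicator (E N) x * (X t x)\<^sup>2) \<longlonglongrightarrow> 0"
      by (intro AE_I2 tendsto_mult_left_zero E_lim)
  qed (rule borel_measurable_const, auto intro!: AE_I2 X_sq_int T simp: indicator_def)
  then have q_lim: "q \<longlonglongrightarrow> 0" by simp
  have bound: "?f N \<le> (\<Lambda> * T + 2 * K\<^sup>2) * prob (E N) + \<Lambda> * T * (V / K\<^sup>2) + 2 * q N" if "0 < N" "0 < K" for N K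
    using lindeberg_bound[of "u N" N K \<delta>] that u0[of N] uN[of N] st u_mono
    by (simp add: E_def V_def q_def)
  have pos: "0 \<le> ?f N" for N by (intro sum_nonneg integral_nonneg_AE) auto
  show ?thesis
  proof (rule order_tendstoI)
    fix a :: real assume "a < 0"
    then show "\<forall>\<^sub>F N in sequentially. a < ?f N"
      by (intro always_eventually allI) (rule less_le_trans[OF _ pos])
  next
    fix a :: real assume a: "0 < a"
    have "((\<lambda>K::real. \<Lambda> * T * (V / K\<^sup>2)) \<longlongrightarrow> 0) at_top"
      by real_asymp
    then have "\<forall>\<^sub>F K in at_top. \<Lambda> * T * (V / K\<^sup>2) < a / 2"
      using a by (intro order_tendstoD) auto
    then have "\<forall>\<^sub>F K in at_top. \<Lambda> * T * (V / K\<^sup>2) < a / 2 \<and> 0 < K"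
      using eventually_gt_at_top[of 0] by (rule eventually_conj)
    then obtain K :: real where K: "\<Lambda> * T * (V / K\<^sup>2) < a / 2" "0 < K"
      by (auto simp: eventually_at_top_linorder)
    have "(\<lambda>N. (\<Lambda> * T + 2 * K\<^sup>2) * prob (E N) + 2 * q N) \<longlonglongrightarrow> (\<Lambda> * T + 2 * K\<^sup>2) * 0 + 2 * 0"
      by (intro tendsto_intros p_lim q_lim)
    then have "\<forall>\<^sub>F N in sequentially. (\<Lambda> * T + 2 * K\<^sup>2) * prob (E N) + 2 * q N < a / 2"
      using a by (intro order_tendstoD) auto
    then show "\<forall>\<^sub>F N in sequentially. ?f N < a"
      using eventually_gt_at_top[of 0]
    proof eventually_elim
      case (elim N)
      then show ?case
        using bound[of N K] K by linarith
    qed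
  qed
qed

end

section \<open>Moments of increments\<close>

lemma continuous_has_antiderivative:
  fixes g :: "real \<Rightarrow> real"
  assumes "continuous_on UNIV g"
  shows "\<exists>f. (\<forall>y. (f has_real_derivative g y) (at y)) \<and> f 0 = 0"
proof -
  have "\<exists>f. \<forall>y::real. -\<infinity> < ereal y \<longrightarrow> ereal y < \<infinity> \<longrightarrow> (f has_vector_derivative g y) (at y)"
    by (rule einterval_antiderivative) (use assms in \<open>auto simp: continuous_on_eq_continuous_at\<close>)
  then obtain f where f: "\<And>y. (f has_real_derivative g y) (at y)"
    by (auto simp: has_real_derivative_iff_has_vector_derivative)
  have "((\<lambda>y. f y - f 0) has_real_derivative g y) (at y)" for y
    using DERIV_diff[OF f[of y] DERIV_const[of "f 0"]] by simp
  then show ?thesis by (intro exI[of _ "\<lambda>y. f y - f 0"]) auto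
qed

text \<open>Integrating the truncated power twice gives a test function with bounded, uniformly
  continuous second derivative that is still a multiple of \<open>y ^ (p + 2)\<close> on
  \<open>[-K, K]\<close>. Agreement there holds because the differences have derivative 0 on the
  interval and vanish at 0; evenness of \<open>p\<close> turns \<open>\<bar>y\<bar> ^ p\<close> into
  \<open>y ^ p\<close>.\<close>

lemma truncated_power_antiderivative:
  fixes K :: real and p :: nat
  assumes K: "0 \<le> K" and p: "even p"
  obtains f f' where "\<And>y. (f has_real_derivative f' y) (at y)"
    "\<And>y. (f' has_real_derivative (min \<bar>y\<bar> K) ^ p) (at y)" "f 0 = 0" "f' 0 = 0"
    "\<And>y. \<bar>y\<bar> \<le> K \<Longrightarrow> f y = y ^ (p + 2) / (real (p + 1) * real (p + 2))"
proof -
  have "continuous_on UNIV (\<lambda>y::real. (min \<bar>y\<bar> K) ^ p)"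
    by (intro continuous_intros)
  from continuous_has_antiderivative[OF this]
  obtain f' where "(\<forall>y. (f' has_real_derivative (min \<bar>y\<bar> K) ^ p) (at y)) \<and> f' 0 = 0" ..
  then have f': "\<And>y. (f' has_real_derivative (min \<bar>y\<bar> K) ^ p) (at y)" "f' 0 = 0"
    by simp_all
  have "continuous_on UNIV f'"
    using f'(1) by (intro continuous_at_imp_continuous_on ballI DERIV_isCont)
  from continuous_has_antiderivative[OF this]
  obtain f where "(\<forall>y. (f has_real_derivative f' y) (at y)) \<and> f 0 = 0" ..
  then have f: "\<And>y. (f has_real_derivative f' y) (at y)" "f 0 = 0"
    by (rule conjunct1[THEN spec], elim conjunct2)
  have zero: "h y = 0" if h: "\<And>y. \<bar>y\<bar> \<le> K \<Longrightarrow> (h has_real_derivative 0) (at y)" "h 0 = 0" "\<bar>y\<bar> \<le> K"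
    for h :: "real \<Rightarrow> real" and y
  proof -
    have "\<exists>c. \<forall>y\<in>{-K..K}. h y = c"
    proof (rule has_field_derivative_zero_constant)
      show "(h has_field_derivative 0) (at y within {-K..K})" if "y \<in> {-K..K}" for y
        by (rule has_field_derivative_at_within, rule h(1)) (use that in auto)
    qed simp
    then obtain c where c: "\<And>y. y \<in> {-K..K} \<Longrightarrow> h y = c" by blast
    then have "h y = h 0"
      using c[of y] c[of 0] h(3) K by (auto simp: abs_le_iff)
    then show ?thesis
      using h(2) by simp
  qed
  have f'_eq: "f' y = y ^ (p + 1) / real (p + 1)" if "\<bar>y\<bar> \<le> K" for y
  proof -
    have "(\<lambda>y. f' y - y ^ (p + 1) / real (p + 1)) y = 0"
    proof (rule zero[of "\<lambda>y. f' y - y ^ (p + 1) / real (p + 1)"])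
      fix y :: real assume y: "\<bar>y\<bar> \<le> K"
      have "((\<lambda>y. f' y - y ^ (p + 1) / real (p + 1)) has_real_derivative
         (min \<bar>y\<bar> K) ^ p - real (p + 1) * y ^ p / real (p + 1)) (at y)"
        by (rule derivative_eq_intros f'(1) refl | simp)+
      moreover have "\<bar>y\<bar> ^ p = y ^ p" by (rule power_even_abs[OF p])
      ultimately show "((\<lambda>y. f' y - y ^ (p + 1) / real (p + 1)) has_real_derivative 0) (at y)"
        using y by (simp add: min_def)
    qed (use f' that in auto)
    then show ?thesis by simp
  qed
  have f_eq: "f y = y ^ (p + 2) / (real (p + 1) * real (p + 2))" if "\<bar>y\<bar> \<le> K" for y
  proof -
    have "(\<lambda>y. f y - y ^ (p + 2) / (real (p + 1) * real (p + 2))) y = 0"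
    proof (rule zero[of "\<lambda>y. f y - y ^ (p + 2) / (real (p + 1) * real (p + 2))"])
      fix y :: real assume y: "\<bar>y\<bar> \<le> K"
      have "((\<lambda>y. f y - y ^ (p + 2) / (real (p + 1) * real (p + 2))) has_real_derivative
         f' y - real (p + 2) * y ^ (p + 1) / (real (p + 1) * real (p + 2))) (at y)"
        by (rule derivative_eq_intros f(1) refl | simp)+
      moreover have "real (p + 2) * y ^ (p + 1) / (real (p + 1) * real (p + 2)) = y ^ (p + 1) / real (p + 1)"
        by simp
      ultimately show "((\<lambda>y. f y - y ^ (p + 2) / (real (p + 1) * real (p + 2))) has_real_derivative 0) (at y)"
        using f'_eq[OF y] by simp
    qed (use f that in auto)
    then show ?thesis by simp
  qed
  show ?thesis
    using that[OF f(1) f'(1) f(2) f'(2) f_eq] by blast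
qed

lemma taylor_second_order:
  fixes f f' g :: "real \<Rightarrow> real"
  assumes f: "\<And>y. (f has_real_derivative f' y) (at y)" and f': "\<And>y. (f' has_real_derivative g y) (at y)"
  obtains \<zeta> where "\<bar>\<zeta> - y\<bar> \<le> \<bar>h\<bar>" "f (y + h) = f y + f' y * h + g \<zeta> / 2 * h\<^sup>2"
proof -
  define diff where "diff = (\<lambda>m::nat. \<lambda>u. if m = 0 then f (y + u) else if m = 1 then f' (y + u) else g (y + u))"
  have "\<exists>t. \<bar>t\<bar> \<le> \<bar>h\<bar> \<and> f (y + h) = (\<Sum>m<2. diff m 0 / (fact m) * h ^ m) + diff 2 t / (fact 2) * h ^ 2"
  proof (rule Maclaurin_bi_le)
    show "\<forall>m t. m < 2 \<and> \<bar>t\<bar> \<le> \<bar>h\<bar> \<longrightarrow> (diff m has_real_derivative diff (Suc m) t) (at t)"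
    proof (intro allI impI)
      fix m :: nat and t assume "m < 2 \<and> \<bar>t\<bar> \<le> \<bar>h\<bar>"
      then consider "m = 0" | "m = 1" by force
      then show "(diff m has_real_derivative diff (Suc m) t) (at t)"
        by cases (use DERIV_shift[of f "f' (y + t)" t y] DERIV_shift[of f' "g (y + t)" t y] f f' in
          \<open>auto simp: diff_def add.commute\<close>)
    qed
  qed (simp add: diff_def)
  then obtain t where "\<bar>t\<bar> \<le> \<bar>h\<bar>" "f (y + h) = f y + f' y * h + g (y + t) / 2 * h\<^sup>2"
    by (auto simp: diff_def numeral_2_eq_2)
  then show ?thesis by (intro that[of "y + t"]) auto
qed

lemma uniformly_continuous_truncated_power:
  fixes K :: real
  assumes "0 \<le> K"
  shows "uniformly_continuous_on UNIV (\<lambda>y. (min \<bar>y\<bar> K) ^ p)"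
proof -
  have uc: "uniformly_continuous_on {0..K} (\<lambda>v. v ^ p)"
    by (intro compact_uniformly_continuous continuous_intros) simp
  show ?thesis
    unfolding uniformly_continuous_on_def
  proof (intro allI impI)
    fix e :: real assume "0 < e"
    then obtain d where d: "0 < d" "\<And>v w. v \<in> {0..K} \<Longrightarrow> w \<in> {0..K} \<Longrightarrow> dist w v < d \<Longrightarrow> dist (w ^ p) (v ^ p) < e"
      using uc unfolding uniformly_continuous_on_def by metis
    have "dist ((min \<bar>w\<bar> K) ^ p) ((min \<bar>v\<bar> K) ^ p) < e" if "dist w v < d" for v w
    proof (rule d(2))
      have "dist (min \<bar>w\<bar> K) (min \<bar>v\<bar> K) \<le> dist w v"
        by (simp add: dist_real_def min_def abs_if)
      then show "dist (min \<bar>w\<bar> K) (min \<bar>v\<bar> K) < d"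
        using that by simp
    qed (use assms in auto)
    then show "\<exists>d>0. \<forall>v\<in>UNIV. \<forall>w\<in>UNIV. dist w v < d \<longrightarrow> dist ((min \<bar>w\<bar> K) ^ p) ((min \<bar>v\<bar> K) ^ p) < e"
      using d(1) by blast
  qed
qed

text \<open>Used whenever a truncation is removed: integrability of the limit is a conclusion here,
  not a hypothesis.\<close>

lemma integral_monotone_bounded:
  fixes h :: "nat \<Rightarrow> 'a \<Rightarrow> real"
  assumes int: "\<And>i. integrable M (h i)" and mono: "\<And>x. x \<in> space M \<Longrightarrow> incseq (\<lambda>i. h i x)"
    and lim: "\<And>x. x \<in> space M \<Longrightarrow> (\<lambda>i. h i x) \<longlonglongrightarrow> f x"
    and meas: "f \<in> borel_measurable M" and bound: "\<And>i. (\<integral>x. h i x \<partial>M) \<le> c"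
  shows "integrable M f" "(\<integral>x. f x \<partial>M) \<le> c"
proof -
  have "incseq (\<lambda>i. \<integral>x. h i x \<partial>M)"
    using mono by (intro incseq_SucI integral_mono int) (auto dest: incseq_SucD)
  then obtain L where L: "(\<lambda>i. \<integral>x. h i x \<partial>M) \<longlonglongrightarrow> L"
    using bound incseq_convergent[of "\<lambda>i. \<integral>x. h i x \<partial>M" c] by blast
  have mono': "AE x in M. mono (\<lambda>i. h i x)" and lim': "AE x in M. (\<lambda>i. h i x) \<longlonglongrightarrow> f x"
    using mono lim by auto
  show "integrable M f" by (rule integrable_monotone_convergence[OF int mono' lim' L meas])
  have "(\<integral>x. f x \<partial>M) = L"
    by (rule integral_monotone_convergence[OF int mono' lim' L meas])
  then show "(\<integral>x. f x \<partial>M) \<le> c"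
    using LIMSEQ_le_const2[OF L] bound by auto
qed

context bracket_process
begin

text \<open>An Ito formula in inequality form. With weight \<open>Z x * g (X v x - X s x)\<close>,
  \<open>weighted_incr_sq_le\<close> bounds the second order term on each short interval by its
  length times \<open>\<Lambda> * G / 2\<close>; the Taylor errors disappear in the limit by the
  Lindeberg condition.\<close>

lemma weighted_ito_bound:
  fixes f f' g Z :: "_ \<Rightarrow> real"
  assumes f: "\<And>y. (f has_real_derivative f' y) (at y)" "f 0 = 0"
    and f': "\<And>y. (f' has_real_derivative g y) (at y)" "f' 0 = 0"
    and g: "uniformly_continuous_on UNIV g" "\<And>y. 0 \<le> g y" "\<And>y. g y \<le> B"
    and st: "0 \<le> s" "s \<le> t" "t \<le> T"
    and Z: "Z \<in> borel_measurable (F s)" "\<And>x. 0 \<le> Z x" "\<And>x. Z x \<le> z"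
    and G: "\<And>v. s \<le> v \<Longrightarrow> v \<le> t \<Longrightarrow> (\<integral>x. Z x * g (X v x - X s x) \<partial>M) \<le> G"
  shows "integrable M (\<lambda>x. Z x * f (X t x - X s x))"
    and "(\<integral>x. Z x * f (X t x - X s x) \<partial>M) \<le> \<Lambda> * (t - s) * G / 2"
proof -
  have zB: "0 \<le> z" "0 \<le> B"
    using Z(2,3)[of undefined] g(2,3)[of 0] by linarith+
  \<comment> \<open>Since \<open>f\<close> and \<open>f'\<close> vanish at 0, the bounded second
    derivative gives \<open>f\<close> quadratic growth; second moments are enough to integrate
    it.\<close>
  have f_bound: "\<bar>f y\<bar> \<le> B * y\<^sup>2" for y
  proof -
    obtain \<zeta> where "f (0 + y) = f 0 + f' 0 * y + g \<zeta> / 2 * y\<^sup>2"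
      using taylor_second_order[OF f(1) f'(1), of 0 y] by blast
    then have "f y = g \<zeta> / 2 * y\<^sup>2"
      using f f' by simp
    moreover have "g \<zeta> / 2 * y\<^sup>2 \<le> B * y\<^sup>2"
      using g(3)[of \<zeta>] zB by (intro mult_right_mono) auto
    moreover have "0 \<le> g \<zeta> / 2 * y\<^sup>2"
      using g(2)[of \<zeta>] by simp
    ultimately show ?thesis by simp
  qed
  have f'_bound: "\<bar>f' y\<bar> \<le> B * \<bar>y\<bar>" for y
  proof -
    have "norm (f' y - f' 0) \<le> B * norm (y - 0)"
      by (rule field_differentiable_bound[of UNIV f' g]) (use f' g in auto)
    then show ?thesis
      using f' by simp
  qed
  have cont: "continuous_on UNIV f" "continuous_on UNIV f'" "continuous_on UNIV g"
    using f(1) f'(1) uniformly_continuous_imp_continuous[OF g(1)]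
    by (auto intro!: continuous_at_imp_continuous_on DERIV_isCont)
  note fm[measurable] = cont[THEN borel_measurable_continuous_onI]
  have sT: "s \<in> {0..T}" and tT: "t \<in> {0..T}"
    using st by auto
  have Zabs: "\<bar>Z x\<bar> \<le> z" for x
    using Z(2,3)[of x] by simp
  have ZM[measurable]: "Z \<in> borel_measurable M"
    using measurable_F[OF sT Z(1)] .
  have Zi: "integrable M Z" by (rule integrable_const_bound[of _ z]) (use Zabs ZM in auto)
  have vT: "v \<in> {0..T}" if "s \<le> v" "v \<le> t" for v
    using that st by auto
  have f_int: "integrable M (\<lambda>x. Z x * f (X v x - X s x))" if v: "s \<le> v" "v \<le> t" for v
  proof (rule integrable_bounded_mult[OF _ ZM Zabs])
    note [measurable] = X_M[OF vT[OF v]] X_M[OF sT]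
    show "integrable M (\<lambda>x. f (X v x - X s x))"
    proof (rule Bochner_Integration.integrable_bound)
      show "integrable M (\<lambda>x. B * (X v x - X s x)\<^sup>2)"
        using incr_sq_int[OF sT vT[OF v]] by simp
      show "AE x in M. norm (f (X v x - X s x)) \<le> norm (B * (X v x - X s x)\<^sup>2)"
        using f_bound by (intro AE_I2) (simp add: order_trans[OF _ abs_ge_self])
    qed measurable
  qed
  show "integrable M (\<lambda>x. Z x * f (X t x - X s x))"
    using f_int st by simp
  have G0: "0 \<le> G"
  proof -
    have "0 \<le> (\<integral>x. Z x * g (X t x - X s x) \<partial>M)"
      using Z g by (intro integral_nonneg_AE) auto
    then show ?thesis
      using G[of t] st by simp
  qed
  define u where "u = (\<lambda>(N::nat) (k::nat). s + real k * ((t - s) / real N))"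
  define lb where "lb = (\<lambda>\<delta> N. \<Sum>k<N. \<integral>x. (if \<delta> < \<bar>X (u N (Suc k)) x - X (u N k) x\<bar> then (X (u N (Suc k)) x - X (u N k) x)\<^sup>2 else 0) \<partial>M)"
  have uN: "u N N = t" if "0 < N" for N
    using that by (simp add: u_def)
  have u0: "u N 0 = s" for N by (simp add: u_def)
  have u_mono: "u N j \<le> u N k" if "j \<le> k" for N j k
    using that st by (auto simp: u_def intro!: mult_right_mono divide_right_mono)
  have u_st: "s \<le> u N k \<and> u N k \<le> t" if "k \<le> N" "0 < N" for N k
    using u_mono[of 0 k N] u_mono[of k N N] that u0[of N] uN[of N] by auto
  \<comment> \<open>One partition interval. The first order term integrates to 0, its factor being
    known at time \<open>v\<close>. Replacing \<open>g \<zeta>\<close> by \<open>g (Y x)\<close>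
    costs \<open>\<eta>\<close> where the increment is at most \<open>\<delta>\<close>; elsewhere
    the whole second order term is bounded by \<open>B * z\<close> times the squared large
    increment.\<close>
  have step: "(\<integral>x. Z x * f (X w x - X s x) \<partial>M) - (\<integral>x. Z x * f (X v x - X s x) \<partial>M)
     \<le> \<Lambda> * (w - v) * (G / 2 + \<eta> * z) + B * z * (\<integral>x. (if \<delta> < \<bar>X w x - X v x\<bar> then (X w x - X v x)\<^sup>2 else 0) \<partial>M)"
    if v: "s \<le> v" "v \<le> w" "w \<le> t" and \<eta>: "0 < \<eta>" and \<delta>: "\<And>y y'. \<bar>y' - y\<bar> \<le> \<delta> \<Longrightarrow> \<bar>g y' - g y\<bar> \<le> \<eta>"
    for v w \<delta> \<eta>
  proof -
    have vT: "v \<in> {0..T}" and wT: "w \<in> {0..T}"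
      using v st by auto
    note [measurable] = X_M[OF sT] X_M[OF vT] X_M[OF wT]
    define Y where "Y = (\<lambda>x. X v x - X s x)"
    define D where "D = (\<lambda>x. X w x - X v x)"
    define c where "c = (\<lambda>x. if \<delta> < \<bar>D x\<bar> then (D x)\<^sup>2 else 0)"
    have XsF: "X s \<in> borel_measurable (F v)" and XvF: "X v \<in> borel_measurable (F v)"
      using v st by (auto intro!: X_F)
    have ZF: "Z \<in> borel_measurable (F v)"
      by (rule measurable_F_mono[OF Z(1)]) (use v st in auto)
    have YF: "Y \<in> borel_measurable (F v)"
      unfolding Y_def using XsF XvF by measurable
    have YM[measurable]: "Y \<in> borel_measurable M" and DM[measurable]: "D \<in> borel_measurable M"
      unfolding Y_def D_def by measurable
    have Y2: "integrable M (\<lambda>x. (Y x)\<^sup>2)" and D2: "integrable M (\<lambda>x. (D x)\<^sup>2)"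
      unfolding Y_def D_def using incr_sq_int vT sT wT by auto
    have ci: "integrable M c"
    proof (rule Bochner_Integration.integrable_bound[OF D2])
      show "c \<in> borel_measurable M"
        unfolding c_def by measurable
    qed (auto simp: c_def)
    have f'2: "integrable M (\<lambda>x. (f' (Y x))\<^sup>2)"
    proof (rule Bochner_Integration.integrable_bound)
      show "integrable M (\<lambda>x. B\<^sup>2 * (Y x)\<^sup>2)"
        using Y2 by simp
      show "AE x in M. norm ((f' (Y x))\<^sup>2) \<le> norm (B\<^sup>2 * (Y x)\<^sup>2)"
      proof (intro AE_I2)
        fix x
        have "\<bar>f' (Y x)\<bar>\<^sup>2 \<le> (B * \<bar>Y x\<bar>)\<^sup>2"
          using f'_bound[of "Y x"] by (intro power_mono) auto
        then show "norm ((f' (Y x))\<^sup>2) \<le> norm (B\<^sup>2 * (Y x)\<^sup>2)"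
          by (simp add: power_mult_distrib)
      qed
    qed measurable
    have f'X: "integrable M (\<lambda>x. (Z x * f' (Y x)) * X a x)" if a: "a \<in> {0..T}" for a
    proof -
      note [measurable] = X_M[OF a]
      have "integrable M (\<lambda>x. f' (Y x) * X a x)"
        by (rule integrable_mult_of_squares[OF _ _ f'2 X_sq_int[OF a]]) measurable
      from integrable_bounded_mult[OF this ZM Zabs] show ?thesis
        by (simp add: mult.assoc)
    qed
    have ZfF: "(\<lambda>x. Z x * f' (Y x)) \<in> borel_measurable (F v)"
      using ZF YF by measurable
    have mart: "(\<integral>x. (Z x * f' (Y x)) * X w x \<partial>M) = (\<integral>x. (Z x * f' (Y x)) * X v x \<partial>M)"
      by (rule martingale_weighted(2)[OF X_mart _ _ _ ZfF f'X[OF wT]]) (use v st in auto)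
    have f'D: "integrable M (\<lambda>x. Z x * f' (Y x) * D x)" "(\<integral>x. Z x * f' (Y x) * D x \<partial>M) = 0"
      unfolding D_def using mart f'X[OF vT] f'X[OF wT] by (auto simp: right_diff_distrib)
    have Zg: "(\<lambda>x. Z x * g (Y x)) \<in> borel_measurable (F v)"
      using ZF YF by measurable
    have Zg0: "0 \<le> Z x * g (Y x)" and Zg1: "\<bar>Z x * g (Y x)\<bar> \<le> z * B" for x
      using Z(2,3)[of x] g(2,3)[of "Y x"] zB by (auto simp: abs_mult intro!: mult_mono)
    have ZgD: "integrable M (\<lambda>x. Z x * g (Y x) * (D x)\<^sup>2)"
      unfolding D_def by (rule weighted_int[OF _ _ _ Zg Zg1]) (use v st in auto)
    have ZD: "integrable M (\<lambda>x. Z x * (D x)\<^sup>2)"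
      unfolding D_def by (rule weighted_int[OF _ _ _ ZF Zabs]) (use v st in auto)
    have fw: "integrable M (\<lambda>x. Z x * f (Y x + D x))" and fv: "integrable M (\<lambda>x. Z x * f (Y x))"
      using f_int[of w] f_int[of v] v by (auto simp: Y_def D_def)
    have "(\<integral>x. Z x * f (X w x - X s x) \<partial>M) - (\<integral>x. Z x * f (X v x - X s x) \<partial>M)
      = (\<integral>x. Z x * f (Y x + D x) - Z x * f (Y x) - Z x * f' (Y x) * D x \<partial>M)"
      using fw fv f'D by (simp add: Y_def D_def)
    also have "\<dots> \<le> (\<integral>x. Z x * g (Y x) * (D x)\<^sup>2 / 2 + \<eta> * (Z x * (D x)\<^sup>2) + B * z * c x \<partial>M)"
    proof (rule integral_mono)
      show "integrable M (\<lambda>x. Z x * f (Y x + D x) - Z x * f (Y x) - Z x * f' (Y x) * D x)"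
        using fw fv f'D by auto
      show "integrable M (\<lambda>x. Z x * g (Y x) * (D x)\<^sup>2 / 2 + \<eta> * (Z x * (D x)\<^sup>2) + B * z * c x)"
        using ZgD ZD ci by auto
      fix x
      obtain \<zeta> where \<zeta>: "\<bar>\<zeta> - Y x\<bar> \<le> \<bar>D x\<bar>" "f (Y x + D x) = f (Y x) + f' (Y x) * D x + g \<zeta> / 2 * (D x)\<^sup>2"
        using taylor_second_order[OF f(1) f'(1), of "Y x" "D x"] by blast
      have eq: "Z x * f (Y x + D x) - Z x * f (Y x) - Z x * f' (Y x) * D x = Z x * (g \<zeta> / 2 * (D x)\<^sup>2)"
        unfolding \<zeta>(2) by (simp add: algebra_simps)
      have c0: "0 \<le> B * z * c x"
        using zB by (simp add: c_def)
      show "Z x * f (Y x + D x) - Z x * f (Y x) - Z x * f' (Y x) * D x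
        \<le> Z x * g (Y x) * (D x)\<^sup>2 / 2 + \<eta> * (Z x * (D x)\<^sup>2) + B * z * c x"
      proof (cases "\<delta> < \<bar>D x\<bar>")
        case True
        have "Z x * (g \<zeta> / 2 * (D x)\<^sup>2) \<le> z * (B * (D x)\<^sup>2)"
          using Z(2,3)[of x] g(2,3)[of \<zeta>] zB by (intro mult_mono) (auto intro!: mult_right_mono)
        moreover have "0 \<le> Z x * g (Y x) * (D x)\<^sup>2 / 2" "0 \<le> \<eta> * (Z x * (D x)\<^sup>2)"
          using Zg0[of x] Z(2)[of x] \<eta> by auto
        ultimately show ?thesis
          unfolding eq using True by (simp add: c_def mult.assoc mult.left_commute)
      next
        case False
        then have "g \<zeta> / 2 \<le> g (Y x) / 2 + \<eta>"
          using \<delta>[of \<zeta> "Y x"] \<zeta>(1) \<eta> by (simp add: abs_le_iff)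
        then have "Z x * (g \<zeta> / 2 * (D x)\<^sup>2) \<le> Z x * ((g (Y x) / 2 + \<eta>) * (D x)\<^sup>2)"
          using Z(2)[of x] by (intro mult_left_mono mult_right_mono) auto
        then show ?thesis
          unfolding eq using c0 by (simp add: algebra_simps)
      qed
    qed
    also have "\<dots> = (\<integral>x. Z x * g (Y x) * (D x)\<^sup>2 \<partial>M) / 2 + \<eta> * (\<integral>x. Z x * (D x)\<^sup>2 \<partial>M) + B * z * (\<integral>x. c x \<partial>M)"
      using ZgD ZD ci by simp
    also have "(\<integral>x. Z x * g (Y x) * (D x)\<^sup>2 \<partial>M) \<le> \<Lambda> * (w - v) * (\<integral>x. Z x * g (Y x) \<partial>M)"
      unfolding D_def by (rule weighted_incr_sq_le[OF _ _ _ Zg Zg1 Zg0]) (use v st in auto)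
    also have "\<dots> \<le> \<Lambda> * (w - v) * G"
      using G[of v] v Lam_nonneg by (intro mult_left_mono) (auto simp: Y_def)
    also have "(\<integral>x. Z x * (D x)\<^sup>2 \<partial>M) \<le> \<Lambda> * (w - v) * (\<integral>x. Z x \<partial>M)"
      unfolding D_def by (rule weighted_incr_sq_le[OF _ _ _ ZF Zabs Z(2)]) (use v st in auto)
    also have "\<dots> \<le> \<Lambda> * (w - v) * z"
    proof (rule mult_left_mono)
      have "(\<integral>x. Z x \<partial>M) \<le> (\<integral>x. z \<partial>M)"
        using Zi Z(3) by (intro integral_mono) auto
      then show "(\<integral>x. Z x \<partial>M) \<le> z" by (simp add: prob_space)
    qed (use v Lam_nonneg in simp)
    also have "(\<integral>x. c x \<partial>M) = (\<integral>x. (if \<delta> < \<bar>X w x - X v x\<bar> then (X w x - X v x)\<^sup>2 else 0) \<partial>M)"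
      unfolding c_def D_def ..
    finally show ?thesis
      using \<eta> by (simp add: algebra_simps diff_divide_distrib)
  qed
  \<comment> \<open>With \<open>\<eta>\<close> and \<open>\<delta>\<close> fixed, the number of
    intervals tends to infinity and the Lindeberg sum \<open>lb\<close> vanishes. Only afterwards
    does \<open>\<eta>\<close> tend to 0.\<close>
  have main: "(\<integral>x. Z x * f (X t x - X s x) \<partial>M) \<le> \<Lambda> * (t - s) * (G / 2 + \<eta> * z)" if \<eta>: "0 < \<eta>" for \<eta>
  proof -
    obtain d where d: "0 < d" "\<And>y y'. dist y' y < d \<Longrightarrow> dist (g y') (g y) < \<eta>"
      using g(1) \<eta> unfolding uniformly_continuous_on_def by (meson UNIV_I)
    define \<delta> where "\<delta> = d / 2"
    have \<delta>: "0 < \<delta>" "\<And>y y'. \<bar>y' - y\<bar> \<le> \<delta> \<Longrightarrow> \<bar>g y' - g y\<bar> \<le> \<eta>"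
    proof -
      show "0 < \<delta>"
        using d by (simp add: \<delta>_def)
      show "\<bar>g y' - g y\<bar> \<le> \<eta>" if "\<bar>y' - y\<bar> \<le> \<delta>" for y y'
        using d(1) d(2)[of y' y] that by (simp add: \<delta>_def dist_real_def)
    qed
    have "(\<integral>x. Z x * f (X t x - X s x) \<partial>M) \<le> \<Lambda> * (t - s) * (G / 2 + \<eta> * z) + B * z * lb \<delta> N"
      if N: "0 < N" for N
    proof -
      have "(\<integral>x. Z x * f (X t x - X s x) \<partial>M)
        = (\<Sum>k<N. (\<integral>x. Z x * f (X (u N (Suc k)) x - X s x) \<partial>M) - (\<integral>x. Z x * f (X (u N k) x - X s x) \<partial>M))"
        using uN[OF N] u0[of N] f(2) by (subst sum_lessThan_telescope) simp
      also have "\<dots> \<le> (\<Sum>k<N. \<Lambda> * (u N (Suc k) - u N k) * (G / 2 + \<eta> * z)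
         + B * z * (\<integral>x. (if \<delta> < \<bar>X (u N (Suc k)) x - X (u N k) x\<bar> then (X (u N (Suc k)) x - X (u N k) x)\<^sup>2 else 0) \<partial>M))"
      proof (intro sum_mono step)
        fix k assume "k \<in> {..<N}"
        then show "s \<le> u N k" "u N k \<le> u N (Suc k)" "u N (Suc k) \<le> t"
          using u_st[of k N] u_st[of "Suc k" N] N u_mono[of k "Suc k" N] by auto
      qed (use \<delta> \<eta> in auto)
      also have "\<dots> = \<Lambda> * (\<Sum>k<N. u N (Suc k) - u N k) * (G / 2 + \<eta> * z) + B * z * lb \<delta> N"
        unfolding lb_def by (simp only: sum.distrib sum_distrib_left sum_distrib_right)
      also have "(\<Sum>k<N. u N (Suc k) - u N k) = t - s"
        using uN[OF N] u0[of N] by (simp add: sum_lessThan_telescope)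
      finally show ?thesis .
    qed
    then have ev: "\<forall>\<^sub>F N in sequentially. (\<integral>x. Z x * f (X t x - X s x) \<partial>M) \<le> \<Lambda> * (t - s) * (G / 2 + \<eta> * z) + B * z * lb \<delta> N"
      using eventually_gt_at_top[of 0] by (rule eventually_mono[rotated])
    have "(\<lambda>N. \<Lambda> * (t - s) * (G / 2 + \<eta> * z) + B * z * lb \<delta> N) \<longlonglongrightarrow> \<Lambda> * (t - s) * (G / 2 + \<eta> * z) + B * z * 0"
      using lindeberg[OF st \<delta>(1)] unfolding lb_def u_def by (intro tendsto_intros)
    from tendsto_lowerbound[OF this ev] show ?thesis
      by simp
  qed
  have lim: "((\<lambda>\<eta>. \<Lambda> * (t - s) * (G / 2 + \<eta> * z)) \<longlongrightarrow> \<Lambda> * (t - s) * (G / 2 + 0 * z)) (at_right 0)"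
    by (intro tendsto_intros)
  have "\<forall>\<^sub>F \<eta> in at_right 0. (\<integral>x. Z x * f (X t x - X s x) \<partial>M) \<le> \<Lambda> * (t - s) * (G / 2 + \<eta> * z)"
    by (rule eventually_mono[OF eventually_at_right_less]) (rule main)
  from tendsto_lowerbound[OF lim this] show "(\<integral>x. Z x * f (X t x - X s x) \<partial>M) \<le> \<Lambda> * (t - s) * G / 2"
    by simp
qed

end

text \<open>Equals (2m)! / 2^m, which is m! times the standard Gaussian moment of order 2m. The
  factor m! is lost because each induction step bounds the previous moment by its value at the final
  time instead of integrating it over time.\<close>

fun gauss_moment :: "nat \<Rightarrow> real" where
  "gauss_moment 0 = 1"
| "gauss_moment (Suc m) = real (m + 1) * real (2 * m + 1) * gauss_moment m"

lemma gauss_moment_nonneg: "0 \<le> gauss_moment m" by (induction m) auto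

context bracket_process
begin

text \<open>Induction on \<open>m\<close>: the second derivative of the test function is the
  truncated power of order \<open>2 * m\<close>, whose weighted mean the induction hypothesis bounds
  at every intermediate time, which is why \<open>t\<close> is generalized.\<close>

lemma weighted_moment:
  fixes Z :: "'a \<Rightarrow> real"
  assumes st: "0 \<le> s" "s \<le> t" "t \<le> T"
    and Z: "Z \<in> borel_measurable (F s)" "\<And>x. 0 \<le> Z x" "\<And>x. Z x \<le> z"
  shows "integrable M (\<lambda>x. Z x * (X t x - X s x) ^ (2 * m))"
    and "(\<integral>x. Z x * (X t x - X s x) ^ (2 * m) \<partial>M) \<le> gauss_moment m * (\<Lambda> * (t - s)) ^ m * (\<integral>x. Z x \<partial>M)"
proof -
  have sT: "s \<in> {0..T}"
    using st by auto
  have ZM[measurable]: "Z \<in> borel_measurable M"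
    using measurable_F[OF sT Z(1)] .
  have Zabs: "\<bar>Z x\<bar> \<le> z" for x
    using Z(2,3)[of x] by simp
  have Zi: "integrable M Z" by (rule integrable_const_bound[of _ z]) (use Zabs ZM in auto)
  have Z0: "0 \<le> (\<integral>x. Z x \<partial>M)"
    using Z(2) by (intro integral_nonneg_AE) auto
  have "integrable M (\<lambda>x. Z x * (X t x - X s x) ^ (2 * m)) \<and>
    (\<integral>x. Z x * (X t x - X s x) ^ (2 * m) \<partial>M) \<le> gauss_moment m * (\<Lambda> * (t - s)) ^ m * (\<integral>x. Z x \<partial>M)"
    using st(2,3)
  proof (induction m arbitrary: t)
    case 0
    then show ?case using Zi by simp
  next
    case (Suc m)
    have tT: "t \<in> {0..T}"
      using st Suc.prems by auto
    note [measurable] = X_M[OF sT] X_M[OF tT]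
    define G where "G = gauss_moment m * (\<Lambda> * (t - s)) ^ m * (\<integral>x. Z x \<partial>M)"
    define Y where "Y = (\<lambda>x. X t x - X s x)"
    have Ym[measurable]: "Y \<in> borel_measurable M"
      unfolding Y_def by measurable
    \<comment> \<open>The cut-off powers visibly increase with \<open>i\<close> and lie below
      \<open>q\<close> times the test function, so monotone convergence needs no comparison between
      test functions of different levels.\<close>
    define h where "h = (\<lambda>(i::nat) x. Z x * (if \<bar>Y x\<bar> \<le> real i then (Y x) ^ (2 * Suc m) else 0))"
    define q where "q = real (2 * m + 1) * real (2 * m + 2)"
    have bound: "integrable M (h i) \<and> (\<integral>x. h i x \<partial>M) \<le> q * (\<Lambda> * (t - s) * G / 2)" for i
    proof -
      obtain f f' where f: "\<And>y. (f has_real_derivative f' y) (at y)"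
        "\<And>y. (f' has_real_derivative (min \<bar>y\<bar> (real i)) ^ (2 * m)) (at y)" "f 0 = 0" "f' 0 = 0"
        "\<And>y. \<bar>y\<bar> \<le> real i \<Longrightarrow> f y = y ^ (2 * m + 2) / (real (2 * m + 1) * real (2 * m + 2))"
        using truncated_power_antiderivative[of "real i" "2 * m"] by auto
      have "(\<integral>x. Z x * (min \<bar>X v x - X s x\<bar> (real i)) ^ (2 * m) \<partial>M) \<le> G" if v: "s \<le> v" "v \<le> t" for v
      proof -
        have vT: "v \<in> {0..T}"
          using v st Suc.prems by auto
        note [measurable] = X_M[OF vT]
        have IH: "integrable M (\<lambda>x. Z x * (X v x - X s x) ^ (2 * m))"
          "(\<integral>x. Z x * (X v x - X s x) ^ (2 * m) \<partial>M) \<le> gauss_moment m * (\<Lambda> * (v - s)) ^ m * (\<integral>x. Z x \<partial>M)"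
          using Suc.IH[of v] v Suc.prems by auto
        have le: "(min \<bar>y\<bar> (real i)) ^ (2 * m) \<le> y ^ (2 * m)" for y
          using power_mono[of "min \<bar>y\<bar> (real i)" "\<bar>y\<bar>" "2 * m"] by (simp add: power_even_abs)
        have "(\<integral>x. Z x * (min \<bar>X v x - X s x\<bar> (real i)) ^ (2 * m) \<partial>M) \<le> (\<integral>x. Z x * (X v x - X s x) ^ (2 * m) \<partial>M)"
        proof (rule integral_mono[OF _ IH(1)])
          show "integrable M (\<lambda>x. Z x * (min \<bar>X v x - X s x\<bar> (real i)) ^ (2 * m))"
          proof (rule Bochner_Integration.integrable_bound[OF IH(1)])
            show "(\<lambda>x. Z x * (min \<bar>X v x - X s x\<bar> (real i)) ^ (2 * m)) \<in> borel_measurable M"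
              by measurable
          qed (use Z(2) le in \<open>auto simp: abs_mult intro!: mult_left_mono\<close>)
        qed (use Z(2) le in \<open>auto intro!: mult_left_mono\<close>)
        also note IH(2)
        also have "gauss_moment m * (\<Lambda> * (v - s)) ^ m * (\<integral>x. Z x \<partial>M) \<le> G"
          unfolding G_def using v Lam_nonneg Z0 gauss_moment_nonneg
          by (intro mult_right_mono mult_left_mono power_mono) auto
        finally show ?thesis .
      qed
      note ito = weighted_ito_bound[where B="real i ^ (2 * m)", OF f(1,3,2,4)
        uniformly_continuous_truncated_power _ _ st(1) Suc.prems Z this]
      have min0: "0 \<le> (min \<bar>y\<bar> (real i)) ^ (2 * m)" and min1: "(min \<bar>y\<bar> (real i)) ^ (2 * m) \<le> real i ^ (2 * m)" for y
        by (auto intro!: power_mono)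
      have int_f: "integrable M (\<lambda>x. Z x * f (Y x))" and int_f_le: "(\<integral>x. Z x * f (Y x) \<partial>M) \<le> \<Lambda> * (t - s) * G / 2"
        using ito min0 min1 by (auto simp: Y_def)
      have f0: "0 \<le> f y" for y
      proof -
        obtain \<zeta> where "f (0 + y) = f 0 + f' 0 * y + (min \<bar>\<zeta>\<bar> (real i)) ^ (2 * m) / 2 * y\<^sup>2"
          using taylor_second_order[OF f(1,2), of 0 y] by blast
        then have "f y = (min \<bar>\<zeta>\<bar> (real i)) ^ (2 * m) / 2 * y\<^sup>2"
          using f(3,4) by simp
        also have "0 \<le> \<dots>"
          using min0[of \<zeta>] by simp
        finally show ?thesis .
      qed
      have h_le: "h i x \<le> q * (Z x * f (Y x))" "0 \<le> h i x" for x
      proof -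
        have "q * f (Y x) = (Y x) ^ (2 * Suc m)" if "\<bar>Y x\<bar> \<le> real i"
          using f(5)[OF that] by (simp add: q_def)
        then have "(if \<bar>Y x\<bar> \<le> real i then (Y x) ^ (2 * Suc m) else 0) \<le> q * f (Y x)"
          using f0[of "Y x"] by (auto simp: q_def)
        from mult_left_mono[OF this Z(2)[of x]] show "h i x \<le> q * (Z x * f (Y x))"
          by (simp add: h_def mult.left_commute)
        show "0 \<le> h i x"
          unfolding h_def using Z(2)[of x] zero_le_even_power[of "2 * Suc m" "Y x"]
          by (intro mult_nonneg_nonneg) (simp_all split: if_split del: power_Suc mult_Suc_right)
      qed
      have int_h: "integrable M (h i)"
      proof (rule Bochner_Integration.integrable_bound)
        show "integrable M (\<lambda>x. q * (Z x * f (Y x)))"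
          using int_f by simp
        show "h i \<in> borel_measurable M"
          unfolding h_def by measurable
        show "AE x in M. norm (h i x) \<le> norm (q * (Z x * f (Y x)))"
          using h_le by (intro AE_I2) (smt (verit) real_norm_def)
      qed
      moreover have "(\<integral>x. h i x \<partial>M) \<le> q * (\<integral>x. Z x * f (Y x) \<partial>M)"
        using integral_mono[OF int_h, of "\<lambda>x. q * (Z x * f (Y x))"] int_f h_le by simp
      moreover have "q * (\<integral>x. Z x * f (Y x) \<partial>M) \<le> q * (\<Lambda> * (t - s) * G / 2)"
        using int_f_le by (intro mult_left_mono) (auto simp: q_def)
      ultimately show ?thesis by linarith
    qed
    have incr: "incseq (\<lambda>i. h i x)" for x
      unfolding h_def using Z(2)[of x] zero_le_even_power[of "2 * Suc m" "Y x"]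
      by (intro incseq_SucI mult_left_mono) (auto simp del: power_Suc mult_Suc_right)
    have lim: "(\<lambda>i. h i x) \<longlonglongrightarrow> Z x * (Y x) ^ (2 * Suc m)" for x
    proof (rule tendsto_eventually)
      obtain n where "\<bar>Y x\<bar> \<le> real n"
        using real_arch_simple by blast
      then show "\<forall>\<^sub>F i in sequentially. h i x = Z x * (Y x) ^ (2 * Suc m)"
        by (intro eventually_sequentiallyI[of n]) (auto simp: h_def)
    qed
    have meas: "(\<lambda>x. Z x * (Y x) ^ (2 * Suc m)) \<in> borel_measurable M" by measurable
    note integral_monotone_bounded[OF conjunct1[OF bound] incr lim meas conjunct2[OF bound]]
    moreover have "q * (\<Lambda> * (t - s) * G / 2) = gauss_moment (Suc m) * (\<Lambda> * (t - s)) ^ Suc m * (\<integral>x. Z x \<partial>M)"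
      by (simp add: q_def G_def)
    ultimately show ?case by (simp only: Y_def)
  qed
  then show "integrable M (\<lambda>x. Z x * (X t x - X s x) ^ (2 * m))"
    and "(\<integral>x. Z x * (X t x - X s x) ^ (2 * m) \<partial>M) \<le> gauss_moment m * (\<Lambda> * (t - s)) ^ m * (\<integral>x. Z x \<partial>M)"
    by auto
qed

end

section \<open>Compensated dyadic squares\<close>

text \<open>A class closed under sums, products, powers and maxima: integrability of all polynomial
  expressions in compensated sums then follows from closure rules instead of separate
  estimates.\<close>

definition all_moments :: "'a measure \<Rightarrow> ('a \<Rightarrow> real) \<Rightarrow> bool" where
  "all_moments M f \<longleftrightarrow> f \<in> borel_measurable M \<and> (\<forall>p::nat. integrable M (\<lambda>x. \<bar>f x\<bar> ^ p))"

lemma abs_add_power_le: "\<bar>a + b :: real\<bar> ^ p \<le> 2 ^ p * (\<bar>a\<bar> ^ p + \<bar>b\<bar> ^ p)"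
proof -
  have "\<bar>a + b\<bar> ^ p \<le> (2 * max \<bar>a\<bar> \<bar>b\<bar>) ^ p"
    by (intro power_mono) auto
  also have "\<dots> \<le> 2 ^ p * (\<bar>a\<bar> ^ p + \<bar>b\<bar> ^ p)"
    by (auto simp: power_mult_distrib max_def)
  finally show ?thesis .
qed

lemma all_moments_I:
  "f \<in> borel_measurable M \<Longrightarrow> (\<And>p::nat. integrable M (\<lambda>x. \<bar>f x\<bar> ^ p)) \<Longrightarrow> all_moments M f"
  by (simp add: all_moments_def)

lemma all_moments_measurable: "all_moments M f \<Longrightarrow> f \<in> borel_measurable M"
  by (simp add: all_moments_def)

lemma all_moments_integrable:
  assumes "all_moments M f" shows "integrable M f"
proof (rule integrable_abs_cancel[OF _ all_moments_measurable[OF assms]])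
  have "integrable M (\<lambda>x. \<bar>f x\<bar> ^ 1)"
    using assms unfolding all_moments_def by blast
  then show "integrable M (\<lambda>x. \<bar>f x\<bar>)" by simp
qed

lemma all_moments_add:
  assumes "all_moments M f" "all_moments M g"
  shows "all_moments M (\<lambda>x. f x + g x)"
proof -
  note [measurable] = assms[THEN all_moments_measurable]
  have int: "integrable M (\<lambda>x. \<bar>f x + g x\<bar> ^ p)" for p
  proof (rule Bochner_Integration.integrable_bound)
    show "integrable M (\<lambda>x. 2 ^ p * (\<bar>f x\<bar> ^ p + \<bar>g x\<bar> ^ p))"
      using assms by (simp add: all_moments_def)
    show "AE x in M. norm (\<bar>f x + g x\<bar> ^ p) \<le> norm (2 ^ p * (\<bar>f x\<bar> ^ p + \<bar>g x\<bar> ^ p))"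
      using abs_add_power_le by (intro AE_I2) auto
  qed measurable
  show ?thesis by (rule all_moments_I[OF _ int]) measurable
qed

lemma all_moments_mult:
  assumes "all_moments M f" "all_moments M g"
  shows "all_moments M (\<lambda>x. f x * g x)"
proof -
  note [measurable] = assms[THEN all_moments_measurable]
  have int: "integrable M (\<lambda>x. \<bar>f x * g x\<bar> ^ p)" for p
  proof -
    have "integrable M (\<lambda>x. \<bar>f x\<bar> ^ p * \<bar>g x\<bar> ^ p)"
      using assms by (intro integrable_mult_of_squares) (auto simp: all_moments_def simp flip: power_mult)
    then show ?thesis by (simp add: abs_mult power_mult_distrib)
  qed
  show ?thesis by (rule all_moments_I[OF _ int]) measurable
qed

lemma all_moments_AE_bound:
  assumes [measurable]: "g \<in> borel_measurable M" and "all_moments M f" "AE x in M. \<bar>g x\<bar> \<le> \<bar>f x\<bar>"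
  shows "all_moments M g"
proof -
  have int: "integrable M (\<lambda>x. \<bar>g x\<bar> ^ p)" for p
  proof (rule Bochner_Integration.integrable_bound)
    show "integrable M (\<lambda>x. \<bar>f x\<bar> ^ p)"
      using assms by (simp add: all_moments_def)
    show "AE x in M. norm (\<bar>g x\<bar> ^ p) \<le> norm (\<bar>f x\<bar> ^ p)"
      using assms(3) by eventually_elim (auto intro!: power_mono)
  qed measurable
  show ?thesis by (rule all_moments_I[OF _ int]) measurable
qed

lemma all_moments_abs: "all_moments M f \<Longrightarrow> all_moments M (\<lambda>x. \<bar>f x\<bar>)"
  by (simp add: all_moments_def borel_measurable_abs)

lemma all_moments_max:
  assumes "all_moments M f" "all_moments M g"
  shows "all_moments M (\<lambda>x. max (f x) (g x))"
proof (rule all_moments_AE_bound)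
  note [measurable] = assms[THEN all_moments_measurable]
  show "(\<lambda>x. max (f x) (g x)) \<in> borel_measurable M" by measurable
  show "all_moments M (\<lambda>x. \<bar>f x\<bar> + \<bar>g x\<bar>)"
    by (intro all_moments_add all_moments_abs assms)
qed auto

context prob_space
begin

lemma all_moments_const: "all_moments M (\<lambda>x. c)"
  by (rule all_moments_I[OF borel_measurable_const]) simp

lemma all_moments_power: "all_moments M f \<Longrightarrow> all_moments M (\<lambda>x. f x ^ n)"
  by (induction n) (auto intro: all_moments_const all_moments_mult)

lemma all_moments_sum: "(\<And>i. i \<in> I \<Longrightarrow> all_moments M (f i)) \<Longrightarrow> all_moments M (\<lambda>x. \<Sum>i\<in>I. f i x)"
  by (induction I rule: infinite_finite_induct) (auto intro: all_moments_const all_moments_add)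

end

text \<open>Second order Taylor expansion with the intermediate point estimated through
  \<open>\<bar>y\<bar> + \<bar>h\<bar>\<close>; the factor \<open>4 ^ m\<close> is
  \<open>2 ^ (2 * m)\<close>. The upper bound drives the moment recursion, the lower one is
  convexity and gives the submartingale property.\<close>

lemma even_power_expansion_le:
  fixes y h :: real
  shows "(y + h) ^ (2 * Suc m) \<le> y ^ (2 * Suc m) + real (2 * Suc m) * y ^ (2 * m + 1) * h
    + real (m + 1) * real (2 * m + 1) * 4 ^ m * (y ^ (2 * m) * h\<^sup>2 + h ^ (2 * Suc m))"
    and "y ^ (2 * Suc m) + real (2 * Suc m) * y ^ (2 * m + 1) * h \<le> (y + h) ^ (2 * Suc m)"
proof -
  define f f' g :: "real \<Rightarrow> real" where "f = (\<lambda>y. y ^ (2 * Suc m))"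
    and "f' = (\<lambda>y. real (2 * Suc m) * y ^ (2 * m + 1))"
    and "g = (\<lambda>y. real (2 * Suc m) * (real (2 * m + 1) * y ^ (2 * m)))"
  have "(f has_real_derivative f' y) (at y)" "(f' has_real_derivative g y) (at y)" for y
    unfolding f_def f'_def g_def
    using DERIV_pow[of "2 * Suc m" y] DERIV_cmult[OF DERIV_pow[of "2 * m + 1" y], of "real (2 * Suc m)"] by simp_all
  then obtain \<zeta> where \<zeta>: "\<bar>\<zeta> - y\<bar> \<le> \<bar>h\<bar>" "f (y + h) = f y + f' y * h + g \<zeta> / 2 * h\<^sup>2"
    using taylor_second_order[of f f' g y h] by blast
  have "0 \<le> g \<zeta> / 2 * h\<^sup>2" by (simp add: g_def)
  then show "y ^ (2 * Suc m) + real (2 * Suc m) * y ^ (2 * m + 1) * h \<le> (y + h) ^ (2 * Suc m)"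
    using \<zeta>(2) unfolding f_def f'_def by linarith
  have "\<zeta> ^ (2 * m) = \<bar>\<zeta>\<bar> ^ (2 * m)" by (simp add: power_even_abs)
  also have "\<dots> \<le> \<bar>\<bar>y\<bar> + \<bar>h\<bar>\<bar> ^ (2 * m)"
    using \<zeta>(1) by (intro power_mono) auto
  also have "\<dots> \<le> 2 ^ (2 * m) * (\<bar>\<bar>y\<bar>\<bar> ^ (2 * m) + \<bar>\<bar>h\<bar>\<bar> ^ (2 * m))"
    by (rule abs_add_power_le)
  also have "\<dots> = 4 ^ m * (y ^ (2 * m) + h ^ (2 * m))" by (simp add: power_even_abs power_mult)
  finally have "real (m + 1) * real (2 * m + 1) * \<zeta> ^ (2 * m)
      \<le> real (m + 1) * real (2 * m + 1) * (4 ^ m * (y ^ (2 * m) + h ^ (2 * m)))"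
    by (rule mult_left_mono) simp
  moreover have "g \<zeta> / 2 = real (m + 1) * real (2 * m + 1) * \<zeta> ^ (2 * m)"
    by (simp add: g_def field_simps)
  ultimately have "g \<zeta> / 2 * h\<^sup>2 \<le> (real (m + 1) * real (2 * m + 1) * (4 ^ m * (y ^ (2 * m) + h ^ (2 * m)))) * h\<^sup>2"
    by (intro mult_right_mono) auto
  also have "\<dots> = real (m + 1) * real (2 * m + 1) * 4 ^ m * (y ^ (2 * m) * h\<^sup>2 + h ^ (2 * Suc m))"
    by (simp add: algebra_simps power2_eq_square)
  finally show "(y + h) ^ (2 * Suc m) \<le> y ^ (2 * Suc m) + real (2 * Suc m) * y ^ (2 * m + 1) * h
    + real (m + 1) * real (2 * m + 1) * 4 ^ m * (y ^ (2 * m) * h\<^sup>2 + h ^ (2 * Suc m))"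
    using \<zeta>(2) unfolding f_def f'_def by linarith
qed

text \<open>The product is at most the power \<open>2 * Suc m\<close> of the larger of
  \<open>\<bar>y\<bar>\<close> and \<open>\<bar>\<beta>\<bar>\<close>. It converts a lower moment
  into the moment being estimated plus a constant whose scale \<open>\<beta>\<close> is free to
  choose.\<close>

lemma even_power_young:
  fixes y \<beta> :: real
  shows "y ^ (2 * m) * \<beta>\<^sup>2 \<le> y ^ (2 * Suc m) + \<beta> ^ (2 * Suc m)"
proof -
  have "\<bar>y\<bar> ^ (2 * m) * \<bar>\<beta>\<bar> ^ 2 \<le> \<bar>y\<bar> ^ (2 * m + 2) + \<bar>\<beta>\<bar> ^ (2 * m + 2)"
  proof (cases "\<bar>y\<bar> \<le> \<bar>\<beta>\<bar>")
    case True
    have "\<bar>y\<bar> ^ (2 * m) * \<bar>\<beta>\<bar> ^ 2 \<le> \<bar>\<beta>\<bar> ^ (2 * m) * \<bar>\<beta>\<bar> ^ 2"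
      using True by (intro mult_right_mono power_mono) auto
    then show ?thesis by (simp only: power_add[symmetric]) (simp add: add_increasing)
  next
    case False
    have "\<bar>y\<bar> ^ (2 * m) * \<bar>\<beta>\<bar> ^ 2 \<le> \<bar>y\<bar> ^ (2 * m) * \<bar>y\<bar> ^ 2"
      using False by (intro mult_left_mono power_mono) auto
    then show ?thesis by (simp only: power_add[symmetric]) (simp add: add_increasing2)
  qed
  then show ?thesis by (simp add: power_even_abs)
qed

context bracket_process
begin

text \<open>The weights to come are powers of compensated sums and hence unbounded. Replacing
  \<open>Z\<close> by \<open>min (Z x) (real i)\<close> reduces to bounded weights, and the bound is
  linear in the weight, so it survives the monotone limit.\<close>

lemma weighted_moment_integrable:
  fixes Z :: "'a \<Rightarrow> real"
  assumes st: "0 \<le> s" "s \<le> t" "t \<le> T"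
    and Z: "Z \<in> borel_measurable (F s)" "\<And>x. 0 \<le> Z x" "integrable M Z"
  shows "integrable M (\<lambda>x. Z x * (X t x - X s x) ^ (2 * m))"
    and "(\<integral>x. Z x * (X t x - X s x) ^ (2 * m) \<partial>M) \<le> gauss_moment m * (\<Lambda> * (t - s)) ^ m * (\<integral>x. Z x \<partial>M)"
proof -
  define h where "h = (\<lambda>(i::nat) x. min (Z x) (real i) * (X t x - X s x) ^ (2 * m))"
  have T: "s \<in> {0..T}" "t \<in> {0..T}"
    using st by auto
  note [measurable] = X_M[OF T(1)] X_M[OF T(2)] measurable_F[OF T(1) Z(1)]
  have ev: "0 \<le> (X t x - X s x) ^ (2 * m)" for x by simp
  have ZF: "(\<lambda>x. min (Z x) (real i)) \<in> borel_measurable (F s)" for i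
    using Z(1) by measurable
  have Zi: "0 \<le> min (Z x) (real i)" "min (Z x) (real i) \<le> real i" for i x
    using Z(2)[of x] by auto
  have 1: "integrable M (h i)" for i
    unfolding h_def by (rule weighted_moment(1)[OF st ZF Zi])
  have 2: "incseq (\<lambda>i. h i x)" for x
    unfolding h_def using ev by (intro incseq_SucI mult_right_mono) auto
  have 3: "(\<lambda>i. h i x) \<longlonglongrightarrow> Z x * (X t x - X s x) ^ (2 * m)" for x
  proof (rule tendsto_eventually)
    obtain n where "Z x \<le> real n"
      using real_arch_simple by blast
    then show "\<forall>\<^sub>F i in sequentially. h i x = Z x * (X t x - X s x) ^ (2 * m)"
      by (intro eventually_sequentiallyI[of n]) (auto simp: h_def min_def)
  qed
  have 4: "(\<lambda>x. Z x * (X t x - X s x) ^ (2 * m)) \<in> borel_measurable M" by measurable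
  have 5: "(\<integral>x. h i x \<partial>M) \<le> gauss_moment m * (\<Lambda> * (t - s)) ^ m * (\<integral>x. Z x \<partial>M)" for i
  proof -
    have "(\<integral>x. h i x \<partial>M) \<le> gauss_moment m * (\<Lambda> * (t - s)) ^ m * (\<integral>x. min (Z x) (real i) \<partial>M)"
      unfolding h_def by (rule weighted_moment(2)[OF st ZF Zi])
    also have "(\<integral>x. min (Z x) (real i) \<partial>M) \<le> (\<integral>x. Z x \<partial>M)"
      using Z(3) by (intro integral_mono Bochner_Integration.integrable_min) auto
    finally show ?thesis
      using st Lam_nonneg gauss_moment_nonneg by (simp add: mult_left_mono)
  qed
  show "integrable M (\<lambda>x. Z x * (X t x - X s x) ^ (2 * m))"
    and "(\<integral>x. Z x * (X t x - X s x) ^ (2 * m) \<partial>M) \<le> gauss_moment m * (\<Lambda> * (t - s)) ^ m * (\<integral>x. Z x \<partial>M)"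
    by (rule integral_monotone_bounded[OF 1 2 3 4 5])+
qed

lemma incr_all_moments:
  assumes st: "0 \<le> s" "s \<le> t" "t \<le> T"
  shows "all_moments M (\<lambda>x. X t x - X s x)"
proof -
  have T: "s \<in> {0..T}" "t \<in> {0..T}"
    using st by auto
  note [measurable] = X_M[OF T(1)] X_M[OF T(2)]
  have "integrable M (\<lambda>x. \<bar>X t x - X s x\<bar> ^ p)" for p
  proof (rule Bochner_Integration.integrable_bound)
    show "integrable M (\<lambda>x. 1 + (X t x - X s x) ^ (2 * p))"
      using weighted_moment(1)[OF st borel_measurable_const, of 1 1 p] by simp
    have "\<bar>y\<bar> ^ p \<le> 1 + y ^ (2 * p)" for y :: real
    proof (cases "\<bar>y\<bar> \<le> 1")
      case True
      then show ?thesis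
        using power_le_one[of "\<bar>y\<bar>" p] by (simp add: add_increasing2)
    next
      case False
      then have "\<bar>y\<bar> ^ p \<le> \<bar>y\<bar> ^ (2 * p)" by (intro power_increasing) auto
      then show ?thesis by (simp add: power_even_abs)
    qed
    then have "norm (\<bar>y\<bar> ^ p) \<le> norm (1 + y ^ (2 * p))" for y :: real
      by (simp add: order_trans[OF _ abs_ge_self])
    then show "AE x in M. norm (\<bar>X t x - X s x\<bar> ^ p) \<le> norm (1 + (X t x - X s x) ^ (2 * p))"
      by (intro AE_I2)
  qed measurable
  moreover have "(\<lambda>x. X t x - X s x) \<in> borel_measurable M" by measurable
  ultimately show ?thesis by (simp add: all_moments_def)
qed

definition comp_incr :: "real \<Rightarrow> real \<Rightarrow> 'a \<Rightarrow> real" where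
  "comp_incr s t x = (X t x - X s x)\<^sup>2 - (A t x - A s x)"

context
  fixes s t :: real
  assumes st: "0 \<le> s" "s \<le> t" "t \<le> T"
begin

lemma A_incr_AE: "AE x in M. 0 \<le> A t x - A s x \<and> A t x - A s x \<le> \<Lambda> * (t - s)"
  using A_lip by eventually_elim (use st in blast)

lemma comp_incr_all_moments: "all_moments M (comp_incr s t)"
proof -
  have T: "s \<in> {0..T}" "t \<in> {0..T}"
    using st by auto
  note [measurable] = A_M[OF T(1)] A_M[OF T(2)]
  have "all_moments M (\<lambda>x. - 1 * (A t x - A s x))"
  proof (rule all_moments_AE_bound[OF _ all_moments_const[of "\<Lambda> * (t - s)"]])
    show "AE x in M. \<bar>- 1 * (A t x - A s x)\<bar> \<le> \<bar>\<Lambda> * (t - s)\<bar>"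
      using A_incr_AE by eventually_elim auto
  qed measurable
  from all_moments_add[OF all_moments_power[OF incr_all_moments[OF st], of 2] this]
  have "all_moments M (\<lambda>x. (X t x - X s x)\<^sup>2 + - 1 * (A t x - A s x))" .
  moreover have "comp_incr s t = (\<lambda>x. (X t x - X s x)\<^sup>2 + - 1 * (A t x - A s x))"
    by (simp add: comp_incr_def fun_eq_iff)
  ultimately show ?thesis by simp
qed

lemma comp_incr_F: "comp_incr s t \<in> borel_measurable (F t)"
proof -
  have [measurable]: "X s \<in> borel_measurable (F t)" "X t \<in> borel_measurable (F t)"
    "A s \<in> borel_measurable (F t)" "A t \<in> borel_measurable (F t)"
    using st by (auto intro!: X_F A_F)
  show ?thesis
    unfolding comp_incr_def by measurable
qed

text \<open>For the weight cut to \<open>[-i, i]\<close> the integral is 0 by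
  \<open>weighted_incr_sq\<close>. Both factors have all moments, so their product dominates the
  passage to the limit.\<close>

lemma comp_incr_mart:
  assumes W: "W \<in> borel_measurable (F s)" "all_moments M W"
  shows "(\<integral>x. W x * comp_incr s t x \<partial>M) = 0"
proof -
  have T: "s \<in> {0..T}" "t \<in> {0..T}"
    using st by auto
  note [measurable] = all_moments_measurable[OF comp_incr_all_moments] all_moments_measurable[OF W(2)]
    A_M[OF T(1)] A_M[OF T(2)]
  define w where "w = (\<lambda>(i::nat) x. max (- real i) (min (W x) (real i)))"
  have wF: "w i \<in> borel_measurable (F s)" for i
    unfolding w_def using W(1) by measurable
  have wM[measurable]: "w i \<in> borel_measurable M" for i by (rule measurable_F[OF T(1) wF])
  have wb: "\<bar>w i x\<bar> \<le> real i" "\<bar>w i x\<bar> \<le> \<bar>W x\<bar>" for i x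
    by (auto simp: w_def)
  have zero: "(\<integral>x. w i x * comp_incr s t x \<partial>M) = 0" for i
  proof -
    have "integrable M (\<lambda>x. A t x - A s x)"
      using A_int T by auto
    from integrable_bounded_mult[OF this wM wb(1)]
    have "integrable M (\<lambda>x. w i x * (A t x - A s x))" .
    then show ?thesis
      using weighted_incr_sq[OF st wF wb(1)] weighted_int[OF st wF wb(1)]
      by (simp add: comp_incr_def right_diff_distrib[of _ "_\<^sup>2"])
  qed
  have "(\<lambda>i. \<integral>x. w i x * comp_incr s t x \<partial>M) \<longlonglongrightarrow> (\<integral>x. W x * comp_incr s t x \<partial>M)"
  proof (rule integral_dominated_convergence)
    show "integrable M (\<lambda>x. \<bar>W x * comp_incr s t x\<bar>)"
      by (intro all_moments_integrable all_moments_abs all_moments_mult W comp_incr_all_moments)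
    show "AE x in M. (\<lambda>i. w i x * comp_incr s t x) \<longlonglongrightarrow> W x * comp_incr s t x"
    proof (intro AE_I2 tendsto_mult_right tendsto_eventually)
      fix x
      obtain n where "\<bar>W x\<bar> \<le> real n"
        using real_arch_simple by blast
      then show "\<forall>\<^sub>F i in sequentially. w i x = W x"
        by (intro eventually_sequentiallyI[of n]) (auto simp: w_def)
    qed
    show "AE x in M. norm (w i x * comp_incr s t x) \<le> \<bar>W x * comp_incr s t x\<bar>" for i
      using wb by (intro AE_I2) (auto simp: abs_mult intro!: mult_right_mono)
  qed measurable
  then have "(\<lambda>i. 0) \<longlonglongrightarrow> (\<integral>x. W x * comp_incr s t x \<partial>M)"
    by (simp only: zero)
  then show ?thesis
    using LIMSEQ_unique tendsto_const by blast
qed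

text \<open>With \<open>D\<close> the increment of \<open>X\<close> and \<open>a\<close> that of
  \<open>A\<close>, \<open>comp_incr\<close> is \<open>D^2 - a\<close>, where \<open>a\<close> lies
  between 0 and \<open>\<Lambda> * (t - s)\<close>. The power \<open>4 * l\<close> of
  \<open>D\<close> contributes \<open>gauss_moment (2 * l)\<close>, the power of \<open>a\<close>
  the summand 1, and \<open>abs_add_power_le\<close> the factor \<open>4 ^ l\<close>.\<close>

lemma comp_incr_moment:
  assumes W: "W \<in> borel_measurable (F s)" "all_moments M W" "\<And>x. 0 \<le> W x"
  shows "(\<integral>x. W x * comp_incr s t x ^ (2 * l) \<partial>M)
    \<le> 4 ^ l * (gauss_moment (2 * l) + 1) * (\<Lambda> * (t - s)) ^ (2 * l) * (\<integral>x. W x \<partial>M)"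
proof -
  define b where "b = \<Lambda> * (t - s)"
  note Wi = all_moments_integrable[OF W(2)]
  note wm = weighted_moment_integrable[OF st W(1,3) Wi, of "2 * l"]
  have "(\<integral>x. W x * comp_incr s t x ^ (2 * l) \<partial>M) \<le> (\<integral>x. 4 ^ l * (W x * (X t x - X s x) ^ (2 * (2 * l)) + b ^ (2 * l) * W x) \<partial>M)"
  proof (rule integral_mono_AE)
    show "integrable M (\<lambda>x. W x * comp_incr s t x ^ (2 * l))"
      by (intro all_moments_integrable all_moments_mult all_moments_power W comp_incr_all_moments)
    show "integrable M (\<lambda>x. 4 ^ l * (W x * (X t x - X s x) ^ (2 * (2 * l)) + b ^ (2 * l) * W x))"
      using wm(1) Wi by auto
    show "AE x in M. W x * comp_incr s t x ^ (2 * l) \<le> 4 ^ l * (W x * (X t x - X s x) ^ (2 * (2 * l)) + b ^ (2 * l) * W x)"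
      using A_incr_AE
    proof eventually_elim
      case (elim x)
      define D a where "D = X t x - X s x" and "a = A t x - A s x"
      have "comp_incr s t x = D\<^sup>2 + - a" by (simp add: comp_incr_def D_def a_def)
      then have "comp_incr s t x ^ (2 * l) = \<bar>D\<^sup>2 + - a\<bar> ^ (2 * l)"
        by (simp only: power_even_abs[OF dvd_triv_left])
      also have "\<dots> \<le> 2 ^ (2 * l) * (\<bar>D\<^sup>2\<bar> ^ (2 * l) + \<bar>- a\<bar> ^ (2 * l))"
        by (rule abs_add_power_le)
      also have "\<dots> \<le> 2 ^ (2 * l) * (\<bar>D\<^sup>2\<bar> ^ (2 * l) + b ^ (2 * l))"
        using elim by (intro mult_left_mono add_left_mono power_mono) (auto simp: a_def b_def)
      also have "\<dots> = 4 ^ l * (D ^ (2 * (2 * l)) + b ^ (2 * l))" by (simp add: power_mult)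
      finally have "W x * comp_incr s t x ^ (2 * l) \<le> W x * (4 ^ l * (D ^ (2 * (2 * l)) + b ^ (2 * l)))"
        by (rule mult_left_mono) (rule W)
      also have "\<dots> = 4 ^ l * (W x * D ^ (2 * (2 * l)) + b ^ (2 * l) * W x)"
        by (simp add: algebra_simps)
      finally show ?case
        unfolding D_def .
    qed
  qed
  also have "\<dots> = 4 ^ l * ((\<integral>x. W x * (X t x - X s x) ^ (2 * (2 * l)) \<partial>M) + b ^ (2 * l) * (\<integral>x. W x \<partial>M))"
    using wm(1) Wi by simp
  also have "\<dots> \<le> 4 ^ l * (gauss_moment (2 * l) * b ^ (2 * l) * (\<integral>x. W x \<partial>M) + b ^ (2 * l) * (\<integral>x. W x \<partial>M))"
    using wm(2) unfolding b_def by (intro mult_left_mono add_right_mono) auto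
  finally show ?thesis by (simp add: b_def algebra_simps)
qed

end

end

section \<open>Moments and maxima of compensated sums on a uniform grid\<close>

lemma exp_growth_bound:
  fixes e :: "nat \<Rightarrow> real" and C B :: real
  assumes N: "0 < N" and C: "0 \<le> C" and B: "0 \<le> B" and e0: "e 0 = 0"
    and step: "\<And>k. k < N \<Longrightarrow> e (Suc k) \<le> e k + C / real N * (e k + B)" and "k \<le> N"
  shows "e k \<le> exp C * B"
proof -
  \<comment> \<open>Shifting by \<open>B\<close> makes the recursion purely multiplicative; since
    \<open>k \<le> N\<close>, the accumulated factor is at most \<open>exp C\<close>, independently
    of \<open>N\<close>.\<close>
  have "e k + B \<le> (1 + C / real N) ^ k * B"
    using \<open>k \<le> N\<close>
  proof (induction k)
    case 0
    then show ?case using e0 by simp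
  next
    case (Suc k)
    have "e (Suc k) + B \<le> (1 + C / real N) * (e k + B)"
      using step[of k] Suc.prems by (simp add: algebra_simps)
    also have "\<dots> \<le> (1 + C / real N) * ((1 + C / real N) ^ k * B)"
      using Suc C by (intro mult_left_mono) auto
    finally show ?case by (simp add: mult.assoc)
  qed
  also have "(1 + C / real N) ^ k * B \<le> exp C * B"
  proof (rule mult_right_mono[OF _ B])
    have "(1 + C / real N) ^ k \<le> exp (C / real N) ^ k"
      using C exp_ge_add_one_self[of "C / real N"] by (intro power_mono) auto
    also have "\<dots> = exp (real k * (C / real N))" by (rule exp_of_nat_mult[symmetric])
    also have "\<dots> \<le> exp C"
    proof -
      have "real k * C \<le> real N * C"
        using \<open>k \<le> N\<close> C by (intro mult_right_mono) auto
      then show ?thesis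
        using N by (simp add: field_simps)
    qed
    finally show "(1 + C / real N) ^ k \<le> exp C" .
  qed
  finally show ?thesis
    using B by simp
qed

definition comp_const :: "nat \<Rightarrow> real" where
  "comp_const l = 4 ^ l * (gauss_moment (2 * l) + 1)"

text \<open>The Gronwall constant of \<open>comp_sum_moment\<close>. The first three factors come
  from the remainder in \<open>even_power_expansion_le\<close>; \<open>comp_const 1\<close> pays for
  its mixed quadratic term and \<open>comp_const (Suc m)\<close> for the pure power of the
  increment.\<close>

definition comp_sum_const :: "nat \<Rightarrow> real" where
  "comp_sum_const m = real (m + 1) * real (2 * m + 1) * 4 ^ m * (comp_const 1 + comp_const (Suc m))"

lemma comp_const_nonneg: "0 \<le> comp_const l"
  using gauss_moment_nonneg[of "2 * l"] by (simp add: comp_const_def)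

lemma comp_sum_const_nonneg: "0 \<le> comp_sum_const m"
  using comp_const_nonneg[of 1] comp_const_nonneg[of "Suc m"] by (simp add: comp_sum_const_def)

context bracket_process
begin

text \<open>Any number \<open>N\<close> of equal steps, since the Gronwall argument does not see the
  dyadic structure; \<open>N = 2 ^ n\<close> gives the dyadic times.\<close>

definition grid :: "nat \<Rightarrow> nat \<Rightarrow> real" where
  "grid N k = real k * T / real N"

definition comp_sum :: "nat \<Rightarrow> nat \<Rightarrow> 'a \<Rightarrow> real" where
  "comp_sum N k x = (\<Sum>j<k. comp_incr (grid N j) (grid N (Suc j)) x)"

text \<open>The running maximum of the submartingale of powers \<open>2 * Suc l\<close>. As a
  recursion it lets adaptedness, moments and the pathwise inequality be proved by induction; the
  start 0 is the value of the power at \<open>k = 0\<close>.\<close>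

primrec comp_max :: "nat \<Rightarrow> nat \<Rightarrow> nat \<Rightarrow> 'a \<Rightarrow> real" where
  "comp_max l N 0 x = 0"
| "comp_max l N (Suc k) x = max (comp_max l N k x) (comp_sum N (Suc k) x ^ (2 * Suc l))"

lemma comp_sum_0: "comp_sum N 0 x = 0"
  and comp_sum_Suc: "comp_sum N (Suc k) x = comp_sum N k x + comp_incr (grid N k) (grid N (Suc k)) x"
  by (simp_all add: comp_sum_def)

lemma comp_max_nonneg: "0 \<le> comp_max l N k x" by (induction k) (auto simp: le_max_iff_disj)

lemma comp_sum_le_max: "j \<le> k \<Longrightarrow> comp_sum N j x ^ (2 * Suc l) \<le> comp_max l N k x"
proof (induction k)
  case (Suc k)
  then show ?case
    by (cases "j = Suc k") (auto simp: le_max_iff_disj simp del: power_Suc mult_Suc_right)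
qed (simp add: comp_sum_0)

context
  fixes N :: nat
  assumes N: "0 < N" and T0: "0 \<le> T"
begin

lemma grid_bounds: "k < N \<Longrightarrow> 0 \<le> grid N k" "k < N \<Longrightarrow> grid N k \<le> grid N (Suc k)" "k < N \<Longrightarrow> grid N (Suc k) \<le> T"
proof -
  show "0 \<le> grid N k" "grid N k \<le> grid N (Suc k)"
    using N T0 by (auto simp: grid_def intro!: divide_right_mono mult_right_mono)
  assume "k < N"
  then have "real (Suc k) * T \<le> real N * T"
    using T0 by (intro mult_right_mono) auto
  then show "grid N (Suc k) \<le> T"
    using N by (simp add: grid_def field_simps)
qed

lemma grid_diff: "grid N (Suc k) - grid N k = T / real N"
  by (simp add: grid_def algebra_simps add_divide_distrib)

lemma comp_sum_all_moments: "k \<le> N \<Longrightarrow> all_moments M (comp_sum N k)"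
  unfolding comp_sum_def[abs_def] by (rule all_moments_sum, rule comp_incr_all_moments) (use grid_bounds in auto)

lemma comp_max_all_moments: "k \<le> N \<Longrightarrow> all_moments M (comp_max l N k)"
proof (induction k)
  case 0
  show ?case
    using all_moments_const[of 0] by (simp add: comp_max.simps(1)[abs_def])
next
  case (Suc k)
  then have "all_moments M (\<lambda>x. max (comp_max l N k x) (comp_sum N (Suc k) x ^ (2 * Suc l)))"
    by (intro all_moments_max all_moments_power comp_sum_all_moments) auto
  then show ?case by (simp add: comp_max.simps(2)[abs_def])
qed

lemma comp_sum_F: "k < N \<Longrightarrow> comp_sum N k \<in> borel_measurable (F (grid N k))"
proof (induction k)
  case 0
  show ?case
    using borel_measurable_const[of 0 "F (grid N 0)"] by (simp add: comp_sum_def[abs_def])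
next
  case (Suc k)
  have "(\<lambda>x. comp_sum N k x + comp_incr (grid N k) (grid N (Suc k)) x) \<in> borel_measurable (F (grid N (Suc k)))"
  proof (rule borel_measurable_add)
    show "comp_sum N k \<in> borel_measurable (F (grid N (Suc k)))"
      by (rule measurable_F_mono[OF Suc.IH]) (use grid_bounds[of k] Suc.prems in auto)
    show "comp_incr (grid N k) (grid N (Suc k)) \<in> borel_measurable (F (grid N (Suc k)))"
      by (rule comp_incr_F) (use grid_bounds[of k] Suc.prems in auto)
  qed
  then show ?case by (simp add: comp_sum_Suc[abs_def])
qed

lemma comp_max_F: "k < N \<Longrightarrow> comp_max l N k \<in> borel_measurable (F (grid N k))"
proof (induction k)
  case 0
  show ?case
    using borel_measurable_const[of 0 "F (grid N 0)"] by (simp add: comp_max.simps(1)[abs_def])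
next
  case (Suc k)
  have "(\<lambda>x. max (comp_max l N k x) (comp_sum N (Suc k) x ^ (2 * Suc l))) \<in> borel_measurable (F (grid N (Suc k)))"
  proof (rule borel_measurable_max)
    show "comp_max l N k \<in> borel_measurable (F (grid N (Suc k)))"
      by (rule measurable_F_mono[OF Suc.IH]) (use grid_bounds[of k] Suc.prems in auto)
    show "(\<lambda>x. comp_sum N (Suc k) x ^ (2 * Suc l)) \<in> borel_measurable (F (grid N (Suc k)))"
      by (rule borel_measurable_power, rule comp_sum_F) (rule Suc.prems)
  qed
  then show ?case by (simp add: comp_max.simps(2)[abs_def])
qed

text \<open>When one step is expanded, the linear term integrates to 0, and the rest is at most a
  constant over \<open>N\<close> times the current moment plus the target size
  \<open>((\<Lambda> * T)^2 / real N) ^ Suc m\<close>. This is the recursion solved by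
  \<open>exp_growth_bound\<close>.\<close>

lemma comp_sum_moment:
  assumes "k \<le> N"
  shows "(\<integral>x. comp_sum N k x ^ (2 * Suc m) \<partial>M) \<le> exp (comp_sum_const m) * ((\<Lambda> * T)\<^sup>2 / real N) ^ Suc m"
proof (rule exp_growth_bound[OF N comp_sum_const_nonneg _ _ _ assms])
  define B where "B = ((\<Lambda> * T)\<^sup>2 / real N) ^ Suc m"
  define c where "c = real (m + 1) * real (2 * m + 1) * 4 ^ m"
  define b where "b = \<Lambda> * (T / real N)"
  show "0 \<le> ((\<Lambda> * T)\<^sup>2 / real N) ^ Suc m"
    by (rule zero_le_power, rule divide_nonneg_nonneg) simp_all
  then have B0: "0 \<le> B" by (simp only: B_def)
  show "(\<integral>x. comp_sum N 0 x ^ (2 * Suc m) \<partial>M) = 0" by (simp add: comp_sum_0)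
  fix k assume k: "k < N"
  define y where "y = comp_sum N k"
  define h where "h = comp_incr (grid N k) (grid N (Suc k))"
  note g = grid_bounds[OF k]
  have ym: "all_moments M y" and hm: "all_moments M h"
    unfolding y_def h_def using comp_sum_all_moments[of k] k comp_incr_all_moments[OF g] by auto
  have yF: "y \<in> borel_measurable (F (grid N k))"
    unfolding y_def by (rule comp_sum_F[OF k])
  have yp: "(\<lambda>x. y x ^ p) \<in> borel_measurable (F (grid N k))" for p
    by (rule borel_measurable_power[OF yF])
  note int = all_moments_integrable[OF all_moments_power[OF ym]] all_moments_integrable[OF all_moments_power[OF hm]]
    all_moments_integrable[OF all_moments_mult[OF all_moments_power[OF ym] hm]]
    all_moments_integrable[OF all_moments_mult[OF all_moments_power[OF ym] all_moments_power[OF hm]]]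
  define e' where "e' = (\<integral>x. y x ^ (2 * Suc m) \<partial>M) + B"
  have "(\<integral>x. comp_sum N (Suc k) x ^ (2 * Suc m) \<partial>M)
    \<le> (\<integral>x. y x ^ (2 * Suc m) + real (2 * Suc m) * (y x ^ (2 * m + 1) * h x)
       + c * (y x ^ (2 * m) * h x ^ 2 + h x ^ (2 * Suc m)) \<partial>M)"
  proof (rule integral_mono)
    show "integrable M (\<lambda>x. comp_sum N (Suc k) x ^ (2 * Suc m))"
      by (rule all_moments_integrable, rule all_moments_power, rule comp_sum_all_moments) (use k in simp)
    show "integrable M (\<lambda>x. y x ^ (2 * Suc m) + real (2 * Suc m) * (y x ^ (2 * m + 1) * h x)
       + c * (y x ^ (2 * m) * h x ^ 2 + h x ^ (2 * Suc m)))"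
      by (intro Bochner_Integration.integrable_add integrable_mult_right int)
    show "comp_sum N (Suc k) x ^ (2 * Suc m) \<le> y x ^ (2 * Suc m) + real (2 * Suc m) * (y x ^ (2 * m + 1) * h x)
       + c * (y x ^ (2 * m) * h x ^ 2 + h x ^ (2 * Suc m))" for x
      unfolding comp_sum_Suc y_def h_def c_def using even_power_expansion_le(1) by (simp only: mult.assoc)
  qed
  also have "\<dots> = (\<integral>x. y x ^ (2 * Suc m) \<partial>M) + real (2 * Suc m) * (\<integral>x. y x ^ (2 * m + 1) * h x \<partial>M)
       + c * ((\<integral>x. y x ^ (2 * m) * h x ^ 2 \<partial>M) + (\<integral>x. h x ^ (2 * Suc m) \<partial>M))"
  proof -
    have "integrable M (\<lambda>x. y x ^ (2 * Suc m))" "integrable M (\<lambda>x. y x ^ (2 * m + 1) * h x)"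
      "integrable M (\<lambda>x. y x ^ (2 * m) * h x ^ 2)" "integrable M (\<lambda>x. h x ^ (2 * Suc m))"
      by (rule int)+
    then show ?thesis by (simp del: power_Suc mult_Suc_right power_add)
  qed
  also have "(\<integral>x. y x ^ (2 * m + 1) * h x \<partial>M) = 0"
    unfolding h_def by (rule comp_incr_mart[OF g yp all_moments_power[OF ym]])
  finally have expand: "(\<integral>x. comp_sum N (Suc k) x ^ (2 * Suc m) \<partial>M) \<le> (\<integral>x. y x ^ (2 * Suc m) \<partial>M)
       + c * ((\<integral>x. y x ^ (2 * m) * h x ^ 2 \<partial>M) + (\<integral>x. h x ^ (2 * Suc m) \<partial>M))"
    by (simp only: mult_zero_right add_0_right)
  have quadratic: "(\<integral>x. y x ^ (2 * m) * h x ^ 2 \<partial>M) \<le> comp_const 1 * (e' / real N)"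
  proof -
    have "(\<integral>x. y x ^ (2 * m) * h x ^ (2 * 1) \<partial>M) \<le> 4 ^ 1 * (gauss_moment (2 * 1) + 1) * (\<Lambda> * (grid N (Suc k) - grid N k)) ^ (2 * 1) * (\<integral>x. y x ^ (2 * m) \<partial>M)"
      unfolding h_def by (rule comp_incr_moment[OF g yp all_moments_power[OF ym]]) simp
    then have "(\<integral>x. y x ^ (2 * m) * h x ^ 2 \<partial>M) \<le> comp_const 1 * (b\<^sup>2 * (\<integral>x. y x ^ (2 * m) \<partial>M))"
      by (simp add: comp_const_def grid_diff b_def mult.assoc)
    also have "\<dots> \<le> comp_const 1 * (e' / real N)"
    proof (rule mult_left_mono[OF _ comp_const_nonneg])
      \<comment> \<open>The moment of order \<open>2 * m\<close> has to be exchanged for one of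
        order \<open>2 * Suc m\<close>. The scale
        \<open>\<beta>^2 = real N * b^2 = (\<Lambda> * T)^2 / real N\<close> is the one at which
        \<open>\<beta> ^ (2 * Suc m)\<close> is exactly \<open>B\<close> while a factor
        \<open>1 / real N\<close> is left over.\<close>
      define \<beta> where "\<beta> = b * sqrt (real N)"
      have \<beta>: "\<beta>\<^sup>2 = real N * b\<^sup>2"
        using N by (simp add: \<beta>_def power_mult_distrib)
      have \<beta>B: "\<beta> ^ (2 * Suc m) = B"
      proof -
        have "\<beta>\<^sup>2 = (\<Lambda> * T)\<^sup>2 / real N"
          unfolding \<beta> using N by (simp add: b_def power2_eq_square field_simps)
        then show ?thesis
          unfolding B_def power_mult by simp
      qed
      have "real N * (b\<^sup>2 * (\<integral>x. y x ^ (2 * m) \<partial>M)) = (\<integral>x. y x ^ (2 * m) * \<beta>\<^sup>2 \<partial>M)"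
        unfolding \<beta> by simp
      also have "\<dots> \<le> (\<integral>x. y x ^ (2 * Suc m) + B \<partial>M)"
        unfolding \<beta>B[symmetric] by (rule integral_mono)
          (intro integrable_mult_left int Bochner_Integration.integrable_add integrable_const even_power_young)+
      also have "\<dots> = e'"
        using int(1) by (simp add: e'_def prob_space del: power_Suc mult_Suc_right)
      finally show "b\<^sup>2 * (\<integral>x. y x ^ (2 * m) \<partial>M) \<le> e' / real N"
        using N by (simp add: field_simps)
    qed
    finally show ?thesis .
  qed
  have "(\<integral>x. h x ^ (2 * Suc m) \<partial>M) \<le> comp_const (Suc m) * (B / real N)"
  proof -
    have "(\<integral>x. 1 * h x ^ (2 * Suc m) \<partial>M) \<le> 4 ^ Suc m * (gauss_moment (2 * Suc m) + 1) * (\<Lambda> * (grid N (Suc k) - grid N k)) ^ (2 * Suc m) * (\<integral>x. 1 \<partial>M)"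
      unfolding h_def by (rule comp_incr_moment[OF g borel_measurable_const all_moments_const]) simp
    then have "(\<integral>x. h x ^ (2 * Suc m) \<partial>M) \<le> comp_const (Suc m) * b ^ (2 * Suc m)"
      by (simp only: comp_const_def grid_diff b_def mult_1 prob_space mult_1_right lebesgue_integral_const scaleR_one)
    also have "\<dots> \<le> comp_const (Suc m) * (B / real N)"
    proof (rule mult_left_mono[OF _ comp_const_nonneg])
      have "b\<^sup>2 = (\<Lambda> * T)\<^sup>2 / real N / real N"
        by (simp add: b_def power2_eq_square)
      then have "b ^ (2 * Suc m) = B / real N ^ Suc m"
        unfolding B_def power_mult by (simp only: power_divide)
      \<comment> \<open>A surplus factor \<open>real N ^ m\<close> is given away; a single
        \<open>1 / real N\<close> is all that the recursion asks for.\<close>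
      also have "\<dots> \<le> B / real N"
      proof (rule divide_left_mono[OF _ B0])
        show "real N \<le> real N ^ Suc m"
          using N power_increasing[of 1 "Suc m" "real N"] by simp
      qed (use N in simp)
      finally show "b ^ (2 * Suc m) \<le> B / real N" .
    qed
    finally show ?thesis .
  qed
  also have "\<dots> \<le> comp_const (Suc m) * (e' / real N)"
  proof (intro mult_left_mono divide_right_mono comp_const_nonneg)
    have "0 \<le> (\<integral>x. y x ^ (2 * Suc m) \<partial>M)"
      by (intro integral_nonneg_AE AE_I2) (rule zero_le_even_power, simp)
    then show "B \<le> e'"
      unfolding e'_def by linarith
  qed simp
  finally have "c * ((\<integral>x. y x ^ (2 * m) * h x ^ 2 \<partial>M) + (\<integral>x. h x ^ (2 * Suc m) \<partial>M))
      \<le> c * (comp_const 1 * (e' / real N) + comp_const (Suc m) * (e' / real N))"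
    using quadratic by (intro mult_left_mono add_mono) (auto simp: c_def)
  also have "\<dots> = comp_sum_const m / real N * e'"
    by (simp add: comp_sum_const_def c_def algebra_simps add_divide_distrib)
  finally show "(\<integral>x. comp_sum N (Suc k) x ^ (2 * Suc m) \<partial>M) \<le> (\<integral>x. comp_sum N k x ^ (2 * Suc m) \<partial>M)
      + comp_sum_const m / real N * ((\<integral>x. comp_sum N k x ^ (2 * Suc m) \<partial>M) + ((\<Lambda> * T)\<^sup>2 / real N) ^ Suc m)"
    using expand unfolding y_def B_def e'_def by linarith
qed

text \<open>The deterministic inequality behind Doob's \<open>L\<^sup>2\<close> maximal inequality.\<close>

lemma comp_max_pathwise:
  "(comp_max l N n x)\<^sup>2 + 2 * (\<Sum>k<n. comp_max l N k x * (comp_sum N (Suc k) x ^ (2 * Suc l) - comp_sum N k x ^ (2 * Suc l)))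
    \<le> 2 * comp_max l N n x * comp_sum N n x ^ (2 * Suc l)"
proof (induction n)
  case (Suc n)
  define S where "S = comp_max l N n x"
  define V where "V = comp_sum N (Suc n) x ^ (2 * Suc l)"
  \<comment> \<open>The maximum changes only if \<open>V\<close> exceeds \<open>S\<close>, and then
    the claim is \<open>0 \<le> (V - S)^2\<close>; otherwise both sides agree.\<close>
  have "(max S V)\<^sup>2 - S\<^sup>2 + 2 * S * V \<le> 2 * max S V * V"
  proof (cases "V \<le> S")
    case False
    have "0 \<le> (V - S)\<^sup>2" by simp
    then show ?thesis
      using False by (simp add: power2_eq_square algebra_simps max_def)
  qed (simp add: max_def)
  then show ?case
    using Suc.IH unfolding comp_max.simps sum.lessThan_Suc S_def V_def
    by (simp add: algebra_simps del: power_Suc mult_Suc_right)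
qed (simp add: comp_sum_0)

lemma comp_max_moment:
  "(\<integral>x. (comp_max l N N x)\<^sup>2 \<partial>M) \<le> 4 * (exp (comp_sum_const (2 * l + 1)) * ((\<Lambda> * T)\<^sup>2 / real N) ^ (2 * Suc l))"
proof -
  define S where "S = comp_max l N"
  define U where "U = (\<lambda>k x. comp_sum N k x ^ (2 * Suc l))"
  have Sm: "all_moments M (S k)" and Um: "all_moments M (U k)" if "k \<le> N" for k
    unfolding S_def U_def using that by (rule comp_max_all_moments, intro all_moments_power comp_sum_all_moments)
  have diff: "all_moments M (\<lambda>x. U (Suc k) x - U k x)" if "k < N" for k
    using all_moments_add[OF Um[of "Suc k"] all_moments_mult[OF all_moments_const[of "-1"] Um[of k]]] that by simp
  \<comment> \<open>By convexity the power lies above its tangent, and the tangent term is a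
    martingale difference with weight \<open>W\<close>, hence of mean 0. The weight
    \<open>S k\<close> is nonnegative and preserves the inequality.\<close>
  have sub: "0 \<le> (\<integral>x. S k x * (U (Suc k) x - U k x) \<partial>M)" if k: "k < N" for k
  proof -
    define h where "h = comp_incr (grid N k) (grid N (Suc k))"
    define W where "W = (\<lambda>x. S k x * (real (2 * Suc l) * comp_sum N k x ^ (2 * l + 1)))"
    note g = grid_bounds[OF k]
    have Wm: "all_moments M W"
      unfolding W_def using k
      by (intro all_moments_mult Sm all_moments_power all_moments_const comp_sum_all_moments) auto
    have WF: "W \<in> borel_measurable (F (grid N k))"
      unfolding W_def S_def
      by (intro borel_measurable_times borel_measurable_power borel_measurable_const comp_max_F comp_sum_F k)
    have "0 = (\<integral>x. W x * h x \<partial>M)"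
      unfolding h_def using comp_incr_mart[OF g WF Wm] by simp
    also have "\<dots> \<le> (\<integral>x. S k x * (U (Suc k) x - U k x) \<partial>M)"
    proof (rule integral_mono)
      show "integrable M (\<lambda>x. W x * h x)"
        unfolding h_def by (intro all_moments_integrable all_moments_mult Wm comp_incr_all_moments g)
      show "integrable M (\<lambda>x. S k x * (U (Suc k) x - U k x))"
        using k by (intro all_moments_integrable all_moments_mult Sm diff) auto
      fix x
      have "real (2 * Suc l) * comp_sum N k x ^ (2 * l + 1) * h x \<le> U (Suc k) x - U k x"
        using even_power_expansion_le(2)[of "comp_sum N k x" l "h x"] unfolding U_def comp_sum_Suc h_def by linarith
      from mult_left_mono[OF this comp_max_nonneg[of l N k x]]
      show "W x * h x \<le> S k x * (U (Suc k) x - U k x)"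
        unfolding W_def S_def by (simp only: mult.assoc)
    qed
    finally show ?thesis .
  qed
  define s u where "s = (\<integral>x. (S N x)\<^sup>2 \<partial>M)" and "u = (\<integral>x. (U N x)\<^sup>2 \<partial>M)"
  have S2: "integrable M (\<lambda>x. (S N x)\<^sup>2)" and U2: "integrable M (\<lambda>x. (U N x)\<^sup>2)"
    and SU: "integrable M (\<lambda>x. S N x * U N x)"
    by (intro all_moments_integrable all_moments_power all_moments_mult Sm Um order_refl)+
  have Sd: "integrable M (\<lambda>x. S k x * (U (Suc k) x - U k x))" if "k < N" for k
    by (intro all_moments_integrable all_moments_mult Sm diff that less_imp_le)
  have "s + 2 * (\<Sum>k<N. \<integral>x. S k x * (U (Suc k) x - U k x) \<partial>M)
    = (\<integral>x. (S N x)\<^sup>2 + 2 * (\<Sum>k<N. S k x * (U (Suc k) x - U k x)) \<partial>M)"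
  proof -
    have "integrable M (\<lambda>x. \<Sum>k<N. S k x * (U (Suc k) x - U k x))"
      "(\<integral>x. (\<Sum>k<N. S k x * (U (Suc k) x - U k x)) \<partial>M) = (\<Sum>k<N. \<integral>x. S k x * (U (Suc k) x - U k x) \<partial>M)"
      by (rule Bochner_Integration.integrable_sum, rule Sd, simp) (rule Bochner_Integration.integral_sum, rule Sd, simp)
    then show ?thesis
      using S2 by (simp add: s_def)
  qed
  also have "\<dots> \<le> (\<integral>x. (S N x)\<^sup>2 / 2 + 2 * (U N x)\<^sup>2 \<partial>M)"
  proof (rule integral_mono)
    show "integrable M (\<lambda>x. (S N x)\<^sup>2 + 2 * (\<Sum>k<N. S k x * (U (Suc k) x - U k x)))"
      by (rule Bochner_Integration.integrable_add[OF S2], rule integrable_mult_right,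
          rule Bochner_Integration.integrable_sum, rule Sd) simp
    show "integrable M (\<lambda>x. (S N x)\<^sup>2 / 2 + 2 * (U N x)\<^sup>2)"
      using S2 U2 by auto
    fix x
    have "(S N x)\<^sup>2 + 2 * (\<Sum>k<N. S k x * (U (Suc k) x - U k x)) \<le> 2 * S N x * U N x"
      unfolding S_def U_def by (rule comp_max_pathwise)
    \<comment> \<open>In other words \<open>2 * S * U \<le> S^2 / 2 + 2 * U^2\<close>. Half of
      \<open>S^2\<close> is absorbed on the left, which produces the factor 4.\<close>
    moreover have "0 \<le> (S N x - 2 * U N x)\<^sup>2" by simp
    ultimately show "(S N x)\<^sup>2 + 2 * (\<Sum>k<N. S k x * (U (Suc k) x - U k x)) \<le> (S N x)\<^sup>2 / 2 + 2 * (U N x)\<^sup>2"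
      by (simp add: power2_eq_square algebra_simps)
  qed
  also have "\<dots> = s / 2 + 2 * u"
    using S2 U2 by (simp add: s_def u_def)
  finally have "s \<le> 4 * u"
    using sum_nonneg[of "{..<N}" "\<lambda>k. \<integral>x. S k x * (U (Suc k) x - U k x) \<partial>M"] sub by simp
  moreover have "u \<le> exp (comp_sum_const (2 * l + 1)) * ((\<Lambda> * T)\<^sup>2 / real N) ^ (2 * Suc l)"
  proof -
    \<comment> \<open>The square of \<open>U\<close> is the power \<open>4 * Suc l\<close> of the
      compensated sum, that is \<open>2 * Suc m\<close> for \<open>m = 2 * l + 1\<close>.\<close>
    have e: "Suc (2 * l + 1) = 2 * Suc l" "2 * (2 * Suc l) = 2 * Suc l * 2" by simp_all
    have "(comp_sum N N x ^ (2 * Suc l))\<^sup>2 = comp_sum N N x ^ (2 * (2 * Suc l))" for x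
      unfolding e(2) power_mult[of _ "2 * Suc l" 2] ..
    then show ?thesis
      using comp_sum_moment[of N "2 * l + 1", OF order_refl] unfolding e(1) by (simp only: u_def U_def)
  qed
  ultimately show ?thesis by (simp add: s_def S_def)
qed

end

end

section \<open>Dyadic times and regularization\<close>

lemma tdyad_0: "tdyad T n 0 = 0"
  and tdyad_last: "tdyad T n (2 ^ n) = T"
  and tdyad_diff: "tdyad T n (Suc k) - tdyad T n k = T / 2 ^ n"
  by (simp_all add: tdyad_def algebra_simps add_divide_distrib)

lemma tdyad_mono: "0 \<le> T \<Longrightarrow> j \<le> k \<Longrightarrow> tdyad T n j \<le> tdyad T n k"
  by (auto simp: tdyad_def intro!: divide_right_mono mult_right_mono)

lemma tdyad_bounds: "0 \<le> T \<Longrightarrow> 0 \<le> tdyad T n k" "0 \<le> T \<Longrightarrow> k \<le> 2 ^ n \<Longrightarrow> tdyad T n k \<le> T"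
  using tdyad_mono[of T 0 k n] tdyad_mono[of T k "2 ^ n" n] by (auto simp: tdyad_0 tdyad_last)

definition dyad_floor :: "real \<Rightarrow> nat \<Rightarrow> real \<Rightarrow> nat" where
  "dyad_floor T n t = nat \<lfloor>t * 2 ^ n / T\<rfloor>"

text \<open>An adjunction between grid indices and times. Facts on \<open>dyad_floor\<close>, such
  as its range, its error and its behaviour under refinement, are read off from it without returning
  to the floor function.\<close>

lemma tdyad_le_iff:
  assumes "0 < T" "0 \<le> t"
  shows "tdyad T n k \<le> t \<longleftrightarrow> k \<le> dyad_floor T n t"
proof -
  have "tdyad T n k \<le> t \<longleftrightarrow> real k \<le> t * 2 ^ n / T"
    using assms by (simp add: tdyad_def pos_divide_le_eq pos_le_divide_eq)
  also have "\<dots> \<longleftrightarrow> int k \<le> \<lfloor>t * 2 ^ n / T\<rfloor>"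
    by (simp add: le_floor_iff)
  also have "\<dots> \<longleftrightarrow> k \<le> dyad_floor T n t"
    using assms unfolding dyad_floor_def by (subst le_nat_iff) auto
  finally show ?thesis .
qed

context
  fixes T t :: real
  assumes T: "0 < T" and t: "t \<in> {0..T}"
begin

lemma dyad_floor_le: "dyad_floor T n t \<le> 2 ^ n"
proof (rule ccontr)
  assume "\<not> ?thesis"
  then have "tdyad T n (Suc (2 ^ n)) \<le> t"
    using tdyad_le_iff[OF T, of t n "Suc (2 ^ n)"] t by auto
  moreover have "0 < T / 2 ^ n"
    using T by simp
  then have "T < tdyad T n (Suc (2 ^ n))"
    using tdyad_diff[of T n "2 ^ n"] unfolding tdyad_last by linarith
  ultimately show False
    using t by simp
qed

lemma tdyad_floor: "tdyad T n (dyad_floor T n t) \<le> t" "t < tdyad T n (dyad_floor T n t) + T / 2 ^ n"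
proof -
  show "tdyad T n (dyad_floor T n t) \<le> t"
    using tdyad_le_iff[OF T] t by auto
  show "t < tdyad T n (dyad_floor T n t) + T / 2 ^ n"
    using tdyad_le_iff[OF T, of t n "Suc (dyad_floor T n t)"] t tdyad_diff[of T n "dyad_floor T n t"] by auto
qed

lemma tdyad_floor_in: "tdyad T n (dyad_floor T n t) \<in> {0..T}"
  using T t tdyad_floor(1)[of n] tdyad_bounds(1)[of T n] by auto

lemma tdyad_floor_tendsto: "(\<lambda>n. tdyad T n (dyad_floor T n t)) \<longlonglongrightarrow> t"
proof (rule tendsto_sandwich)
  show "\<forall>\<^sub>F n in sequentially. t - T / 2 ^ n \<le> tdyad T n (dyad_floor T n t)"
    using tdyad_floor(2) by (intro always_eventually allI) (simp add: less_imp_le diff_le_eq)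
  show "\<forall>\<^sub>F n in sequentially. tdyad T n (dyad_floor T n t) \<le> t"
    using tdyad_floor(1) by simp
  show "(\<lambda>n. t - T / 2 ^ n) \<longlonglongrightarrow> t" by real_asymp
qed simp

text \<open>The intervals completed by time \<open>t\<close> form an initial segment, so the square
  sum is a partial sum of the kind compensated by \<open>comp_sum\<close>.\<close>

lemma dyad_sq_eq: "dyad_sq T n x t = (\<Sum>j<dyad_floor T n t. (x (tdyad T n (Suc j)) - x (tdyad T n j))\<^sup>2)"
proof -
  have "k < 2 ^ n \<and> tdyad T n (Suc k) \<le> t \<longleftrightarrow> k < dyad_floor T n t" for k
  proof -
    have "tdyad T n (Suc k) \<le> t \<longleftrightarrow> Suc k \<le> dyad_floor T n t"
      by (rule tdyad_le_iff[OF T]) (use t in simp)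
    then show ?thesis
      using less_le_trans[OF _ dyad_floor_le[of n], of k] by (auto simp: Suc_le_eq)
  qed
  then show ?thesis by (simp add: dyad_sq_def lessThan_def)
qed

end

lemma dyad_le_of_dyadics:
  fixes f g :: "real \<Rightarrow> real"
  assumes T: "0 < T" and f: "continuous_on {0..T} f" and g: "continuous_on {0..T} g"
    and le: "\<And>n k. k \<le> 2 ^ n \<Longrightarrow> f (tdyad T n k) \<le> g (tdyad T n k)" and t: "t \<in> {0..T}"
  shows "f t \<le> g t"
proof (rule LIMSEQ_le)
  have in_T: "\<forall>\<^sub>F n in sequentially. tdyad T n (dyad_floor T n t) \<in> {0..T}"
    using tdyad_floor_in[OF T t] by simp
  show "(\<lambda>n. f (tdyad T n (dyad_floor T n t))) \<longlonglongrightarrow> f t" "(\<lambda>n. g (tdyad T n (dyad_floor T n t))) \<longlonglongrightarrow> g t"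
    using continuous_on_tendsto_compose[OF f tdyad_floor_tendsto[OF T t] t in_T]
      continuous_on_tendsto_compose[OF g tdyad_floor_tendsto[OF T t] t in_T] .
  show "\<exists>N. \<forall>n\<ge>N. f (tdyad T n (dyad_floor T n t)) \<le> g (tdyad T n (dyad_floor T n t))"
    using le dyad_floor_le[OF T t] by blast
qed

lemma regularize_le:
  assumes "0 \<le> \<Lambda>" "\<And>v. v \<in> {0..t} \<Longrightarrow> 0 \<le> a v" "u \<in> {0..t}"
  shows "regularize \<Lambda> a t \<le> a u + \<Lambda> * (t - u)"
proof -
  have "bdd_below ((\<lambda>u. a u + \<Lambda> * (t - u)) ` {0..t})"
    using assms by (intro bdd_belowI2[of _ 0]) (auto intro!: add_nonneg_nonneg)
  then show ?thesis
    unfolding regularize_def using assms(3) by (rule cINF_lower)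
qed

lemma le_regularize:
  assumes "0 \<le> t" "\<And>u. u \<in> {0..t} \<Longrightarrow> c \<le> a u + \<Lambda> * (t - u)"
  shows "c \<le> regularize \<Lambda> a t"
  unfolding regularize_def using assms by (intro cINF_greatest) auto

lemma regularize_diff_le:
  assumes "0 \<le> \<Lambda>" "0 \<le> t" "\<And>v. v \<in> {0..t} \<Longrightarrow> 0 \<le> a v" "\<And>v. v \<in> {0..t} \<Longrightarrow> 0 \<le> b v"
    and diff: "\<And>v. v \<in> {0..t} \<Longrightarrow> \<bar>a v - b v\<bar> \<le> e"
  shows "\<bar>regularize \<Lambda> a t - regularize \<Lambda> b t\<bar> \<le> e"
proof -
  have "regularize \<Lambda> a t - e \<le> regularize \<Lambda> b t"
  proof (rule le_regularize[OF assms(2)])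
    fix u assume u: "u \<in> {0..t}"
    show "regularize \<Lambda> a t - e \<le> b u + \<Lambda> * (t - u)"
      using regularize_le[where a=a and u=u, OF assms(1) assms(3) u] diff[OF u] by auto
  qed
  moreover have "regularize \<Lambda> b t - e \<le> regularize \<Lambda> a t"
  proof (rule le_regularize[OF assms(2)])
    fix u assume u: "u \<in> {0..t}"
    show "regularize \<Lambda> b t - e \<le> a u + \<Lambda> * (t - u)"
      using regularize_le[where a=b and u=u, OF assms(1) assms(4) u] diff[OF u] by auto
  qed
  ultimately show ?thesis by simp
qed

lemma regularize_lipschitz_id:
  assumes "0 \<le> \<Lambda>" "0 \<le> t" "\<And>u. u \<in> {0..t} \<Longrightarrow> 0 \<le> q u" "\<And>u. u \<in> {0..t} \<Longrightarrow> q t - q u \<le> \<Lambda> * (t - u)"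
  shows "regularize \<Lambda> q t = q t"
proof (rule antisym)
  show "regularize \<Lambda> q t \<le> q t"
    using regularize_le[where a=q and u=t and t=t, OF assms(1,3)] assms(2) by simp
  show "q t \<le> regularize \<Lambda> q t"
    using assms(4) by (intro le_regularize[OF assms(2)]) (auto simp: algebra_simps)
qed

lemma dyad_sq_nonneg: "0 \<le> dyad_sq T n x t" by (simp add: dyad_sq_def sum_nonneg)

text \<open>Since regularization fixes \<open>q\<close> and does not increase distances, it is
  enough to compare the unregularized square sum with \<open>q\<close>. The hypothesis covers grid
  times; between them the square sum is constant and \<open>q\<close> grows by at most
  \<open>\<Lambda> * T / 2 ^ n\<close>, the second error term.\<close>

lemma qn_error:
  assumes T: "0 < T" and Lam: "0 \<le> \<Lambda>" and q0: "q 0 = 0"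
    and q: "\<And>s t. 0 \<le> s \<Longrightarrow> s \<le> t \<Longrightarrow> t \<le> T \<Longrightarrow> 0 \<le> q t - q s \<and> q t - q s \<le> \<Lambda> * (t - s)"
    and e: "\<And>k. k \<le> 2 ^ n \<Longrightarrow> \<bar>(\<Sum>j<k. (x (tdyad T n (Suc j)) - x (tdyad T n j))\<^sup>2) - q (tdyad T n k)\<bar> \<le> e"
    and t: "t \<in> {0..T}"
  shows "\<bar>qn T \<Lambda> n x t - q t\<bar> \<le> e + \<Lambda> * T / 2 ^ n"
proof -
  have q_nonneg: "0 \<le> q v" if "v \<in> {0..T}" for v
    using q[of 0 v] that q0 by simp
  have "regularize \<Lambda> q t = q t"
    using t q q_nonneg Lam by (intro regularize_lipschitz_id) auto
  moreover have "\<bar>regularize \<Lambda> (dyad_sq T n x) t - regularize \<Lambda> q t\<bar> \<le> e + \<Lambda> * T / 2 ^ n"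
  proof (rule regularize_diff_le[OF Lam _ dyad_sq_nonneg])
    show "0 \<le> q v" if "v \<in> {0..t}" for v
      using q_nonneg that t by auto
    fix v assume v: "v \<in> {0..t}"
    then have vT: "v \<in> {0..T}"
      using t by auto
    define w where "w = tdyad T n (dyad_floor T n v)"
    have w: "0 \<le> w" "w \<le> v" "v - w \<le> T / 2 ^ n"
      using tdyad_floor[OF T vT, of n] tdyad_floor_in[OF T vT, of n] by (auto simp: w_def)
    have "\<bar>dyad_sq T n x v - q w\<bar> \<le> e"
      unfolding dyad_sq_eq[OF T vT] w_def by (rule e[OF dyad_floor_le[OF T vT]])
    moreover have "0 \<le> q v - q w \<and> q v - q w \<le> \<Lambda> * (v - w)"
      using q[of w v] w vT by auto
    moreover have "\<Lambda> * (v - w) \<le> \<Lambda> * (T / 2 ^ n)"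
      using w Lam by (intro mult_left_mono) auto
    ultimately show "\<bar>dyad_sq T n x v - q v\<bar> \<le> e + \<Lambda> * T / 2 ^ n"
      by (simp add: abs_le_iff)
  qed (use t in auto)
  ultimately show ?thesis
    using t by (simp add: qn_def)
qed

text \<open>The bound involves finitely many coordinates and does not depend on \<open>t\<close>;
  this is what makes \<open>qn\<close> continuous in the uniform topology.\<close>

lemma qn_diff_le:
  assumes T: "0 < T" and Lam: "0 \<le> \<Lambda>" and t: "t \<in> {0..T}"
  shows "\<bar>qn T \<Lambda> n x t - qn T \<Lambda> n y t\<bar>
    \<le> (\<Sum>j<2 ^ n. \<bar>(x (tdyad T n (Suc j)) - x (tdyad T n j))\<^sup>2 - (y (tdyad T n (Suc j)) - y (tdyad T n j))\<^sup>2\<bar>)"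
    (is "_ \<le> ?e")
proof -
  have "\<bar>regularize \<Lambda> (dyad_sq T n x) t - regularize \<Lambda> (dyad_sq T n y) t\<bar> \<le> ?e"
  proof (rule regularize_diff_le[OF Lam _ dyad_sq_nonneg dyad_sq_nonneg])
    fix v assume "v \<in> {0..t}"
    then have vT: "v \<in> {0..T}"
      using t by auto
    have "\<bar>dyad_sq T n x v - dyad_sq T n y v\<bar>
      = \<bar>\<Sum>j<dyad_floor T n v. (x (tdyad T n (Suc j)) - x (tdyad T n j))\<^sup>2 - (y (tdyad T n (Suc j)) - y (tdyad T n j))\<^sup>2\<bar>"
      unfolding dyad_sq_eq[OF T vT] by (simp add: sum_subtractf)
    also have "\<dots> \<le> (\<Sum>j<dyad_floor T n v. \<bar>(x (tdyad T n (Suc j)) - x (tdyad T n j))\<^sup>2 - (y (tdyad T n (Suc j)) - y (tdyad T n j))\<^sup>2\<bar>)"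
      by (rule sum_abs)
    also have "\<dots> \<le> ?e"
      using dyad_floor_le[OF T vT] by (intro sum_mono2) auto
    finally show "\<bar>dyad_sq T n x v - dyad_sq T n y v\<bar> \<le> ?e" .
  qed (use t in auto)
  then show ?thesis
    using t by (simp add: qn_def)
qed

lemma mdist_cpaths_le_iff:
  assumes "0 \<le> T" "x \<in> mspace (cpaths T)" "y \<in> mspace (cpaths T)"
  shows "mdist (cpaths T) x y \<le> e \<longleftrightarrow> (\<forall>t\<in>{0..T}. \<bar>x t - y t\<bar> \<le> e)"
proof -
  have "topspace (top_of_set {0..T}) \<noteq> {}"
    using assms(1) by simp
  from cfunspace_mdist_le[OF _ _ this, of x euclidean_metric y e] assms(2,3)
  show ?thesis by (simp add: cpaths_def dist_real_def)
qed

lemma abs_diff_le_mdist: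
  assumes "0 \<le> T" "x \<in> mspace (cpaths T)" "y \<in> mspace (cpaths T)" "t \<in> {0..T}"
  shows "\<bar>x t - y t\<bar> \<le> mdist (cpaths T) x y"
  using mdist_cpaths_le_iff[OF assms(1-3), of "mdist (cpaths T) x y"] assms(4) by auto

lemma Abr_cpaths: "q \<in> Abr T \<Lambda> \<Longrightarrow> q \<in> mspace (cpaths T)"
  by (simp add: Abr_def)

lemma Abr_bounds: "q \<in> Abr T \<Lambda> \<Longrightarrow> t \<in> {0..T} \<Longrightarrow> 0 \<le> q t \<and> q t \<le> \<Lambda> * t"
  by (force simp: Abr_def)

lemma increasing_lipschitz_continuous:
  fixes q :: path
  assumes q: "\<And>s t. 0 \<le> s \<Longrightarrow> s \<le> t \<Longrightarrow> t \<le> T \<Longrightarrow> 0 \<le> q t - q s \<and> q t - q s \<le> \<Lambda> * (t - s)" and "0 \<le> \<Lambda>"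
  shows "continuous_on {0..T} q"
proof -
  have "\<Lambda>-lipschitz_on {0..T} q"
  proof (rule lipschitz_on_leI)
    fix s t assume "s \<in> {0..T}" "t \<in> {0..T}" "s \<le> t"
    then show "dist (q s) (q t) \<le> \<Lambda> * dist s t"
      using q[of s t] by (simp add: dist_real_def abs_if)
  qed fact
  then show ?thesis by (rule lipschitz_on_continuous_on)
qed

lemma increasing_lipschitz_in_Abr:
  assumes "q \<in> extensional {0..T}" "q 0 = 0"
    and q: "\<And>s t. 0 \<le> s \<Longrightarrow> s \<le> t \<Longrightarrow> t \<le> T \<Longrightarrow> 0 \<le> q t - q s \<and> q t - q s \<le> \<Lambda> * (t - s)" and "0 \<le> \<Lambda>"
  shows "q \<in> Abr T \<Lambda>"
proof -
  have "continuous_on {0..T} q"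
    by (rule increasing_lipschitz_continuous[OF q \<open>0 \<le> \<Lambda>\<close>])
  with assms show ?thesis
    by (simp add: Abr_def mspace_cpaths)
qed

text \<open>All \<open>qn\<close> share the same two-sided increment bounds, and both survive the
  limsup, which is monotone and commutes with adding a finite constant. Hence the limsup is a
  continuous path even where the sequence diverges.\<close>

lemma Qlim_in_Abr:
  assumes T: "0 < T" and Lam: "0 \<le> \<Lambda>"
  shows "Qlim T \<Lambda> x \<in> Abr T \<Lambda>"
proof (rule increasing_lipschitz_in_Abr[OF _ _ _ Lam])
  show "Qlim T \<Lambda> x \<in> extensional {0..T}" by (simp add: Qlim_def)
  have "qn T \<Lambda> n x 0 = 0" for n
    using qn_in_Abr[OF T Lam, of n x] by (simp add: Abr_def)
  then have "ereal (Qlim T \<Lambda> x 0) = 0"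
    using T by (subst ereal_Qlim[OF T Lam]) (auto simp: Limsup_const zero_ereal_def)
  then show "Qlim T \<Lambda> x 0 = 0" by simp
  fix s t assume st: "0 \<le> s" "s \<le> t" "t \<le> T"
  then have T_in: "s \<in> {0..T}" "t \<in> {0..T}" by auto
  have q: "qn T \<Lambda> n x s \<le> qn T \<Lambda> n x t \<and> qn T \<Lambda> n x t \<le> qn T \<Lambda> n x s + \<Lambda> * (t - s)" for n
    using qn_in_Abr[OF T Lam, of n x] st by (force simp: Abr_def)
  have "ereal (Qlim T \<Lambda> x s) \<le> ereal (Qlim T \<Lambda> x t)"
    unfolding ereal_Qlim[OF T Lam T_in(1)] ereal_Qlim[OF T Lam T_in(2)]
    using q by (intro Limsup_mono always_eventually) simp
  moreover have "ereal (Qlim T \<Lambda> x t) \<le> ereal (Qlim T \<Lambda> x s) + ereal (\<Lambda> * (t - s))"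
  proof -
    have "ereal (Qlim T \<Lambda> x t) \<le> limsup (\<lambda>n. ereal (qn T \<Lambda> n x s) + ereal (\<Lambda> * (t - s)))"
      unfolding ereal_Qlim[OF T Lam T_in(2)] using q by (intro Limsup_mono always_eventually) simp
    also have "\<dots> = limsup (\<lambda>n. ereal (qn T \<Lambda> n x s)) + ereal (\<Lambda> * (t - s))"
      by (rule Limsup_add_ereal_right) auto
    finally show ?thesis by (simp only: ereal_Qlim[OF T Lam T_in(1)])
  qed
  ultimately show "0 \<le> Qlim T \<Lambda> x t - Qlim T \<Lambda> x s \<and> Qlim T \<Lambda> x t - Qlim T \<Lambda> x s \<le> \<Lambda> * (t - s)"
    by simp
qed

lemma Qlim_eq_lim:
  assumes T: "0 < T" and Lam: "0 \<le> \<Lambda>" and t: "t \<in> {0..T}" and lim: "(\<lambda>n. qn T \<Lambda> n x t) \<longlonglongrightarrow> l"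
  shows "Qlim T \<Lambda> x t = l"
proof -
  have "limsup (\<lambda>n. ereal (qn T \<Lambda> n x t)) = ereal l"
    using lim by (intro lim_imp_Limsup) auto
  then show ?thesis
    using ereal_Qlim[OF T Lam t, of x] by simp
qed

text \<open>A square enters the sum only after its interval has ended, and the regularization takes
  the infimum over past times only.\<close>

lemma causal_Qlim: "0 < T \<Longrightarrow> causal T (Qlim T \<Lambda>)"
  unfolding causal_def
proof (intro ballI impI)
  fix t and x y :: path
  assume T: "0 < T" and t: "t \<in> {0..T}" and eq: "\<forall>s\<in>{0..t}. x s = y s"
  have "dyad_sq T n x u = dyad_sq T n y u" if u: "u \<in> {0..t}" for n u
    unfolding dyad_sq_def
  proof (intro sum.cong refl)
    fix k assume "k \<in> {k. k < 2 ^ n \<and> tdyad T n (Suc k) \<le> u}"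
    then have "tdyad T n (Suc k) \<in> {0..t}" "tdyad T n k \<in> {0..t}"
      using u T tdyad_bounds(1)[of T n k] tdyad_bounds(1)[of T n "Suc k"] tdyad_mono[of T k "Suc k" n] by auto
    then show "(x (tdyad T n (Suc k)) - x (tdyad T n k))\<^sup>2 = (y (tdyad T n (Suc k)) - y (tdyad T n k))\<^sup>2"
      using eq by simp
  qed
  then have "regularize \<Lambda> (dyad_sq T n x) t = regularize \<Lambda> (dyad_sq T n y) t" for n
    unfolding regularize_def by (intro INF_cong) auto
  then show "Qlim T \<Lambda> x t = Qlim T \<Lambda> y t" by (simp add: Qlim_def qn_def)
qed

section \<open>Uniqueness of the bracket\<close>

text \<open>Completing the square under the root gives the remainder \<open>h^2\<close>, and the
  root being 1-Lipschitz gives \<open>2 * \<bar>h\<bar>\<close>. The first makes remainder sums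
  vanish along fine partitions of a continuous path, the second lets its variation dominate
  them.\<close>

lemma sqrt_one_plus_square_le:
  fixes y h :: real
  shows "sqrt (1 + (y + h)\<^sup>2) \<le> sqrt (1 + y\<^sup>2) + y / sqrt (1 + y\<^sup>2) * h + min (h\<^sup>2) (2 * \<bar>h\<bar>)"
proof -
  define r where "r = sqrt (1 + y\<^sup>2)"
  have r2: "r\<^sup>2 = 1 + y\<^sup>2" by (simp add: r_def)
  have r1: "1 \<le> r" by (simp add: r_def)
  have yr: "\<bar>y\<bar> \<le> r"
    using real_sqrt_le_mono[of "y\<^sup>2" "1 + y\<^sup>2"] by (simp add: r_def)
  have 1: "sqrt (1 + (y + h)\<^sup>2) \<le> r + y / r * h + h\<^sup>2 / (2 * r)"
  proof (rule real_le_lsqrt)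
    have eq: "r + y / r * h + h\<^sup>2 / (2 * r) = (2 * r\<^sup>2 + 2 * y * h + h\<^sup>2) / (2 * r)"
      using r1 by (simp add: field_simps power2_eq_square)
    have "2 * r\<^sup>2 + 2 * y * h + h\<^sup>2 = 1 + r\<^sup>2 + (y + h)\<^sup>2"
      unfolding r2 by (simp add: power2_eq_square algebra_simps)
    moreover have "0 \<le> 1 + r\<^sup>2 + (y + h)\<^sup>2" by simp
    ultimately have "0 \<le> 2 * r\<^sup>2 + 2 * y * h + h\<^sup>2" by linarith
    then show "0 \<le> r + y / r * h + h\<^sup>2 / (2 * r)"
      unfolding eq by (rule divide_nonneg_nonneg) (use r1 in simp)
    have "1 + (y + h)\<^sup>2 = r\<^sup>2 + (2 * y * h + h\<^sup>2)"
      unfolding r2 by (simp add: power2_eq_square algebra_simps)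
    also have "\<dots> \<le> (r + (2 * y * h + h\<^sup>2) / (2 * r))\<^sup>2"
    proof -
      have "(r + (2 * y * h + h\<^sup>2) / (2 * r))\<^sup>2 = r\<^sup>2 + (2 * y * h + h\<^sup>2) + ((2 * y * h + h\<^sup>2) / (2 * r))\<^sup>2"
        unfolding power2_sum using r1 by simp
      then show ?thesis
        using zero_le_power2[of "(2 * y * h + h\<^sup>2) / (2 * r)"] by linarith
    qed
    also have "r + (2 * y * h + h\<^sup>2) / (2 * r) = r + y / r * h + h\<^sup>2 / (2 * r)"
      using r1 by (simp add: add_divide_distrib)
    finally show "1 + (y + h)\<^sup>2 \<le> (r + y / r * h + h\<^sup>2 / (2 * r))\<^sup>2" .
  qed
  have "h\<^sup>2 / (2 * r) \<le> h\<^sup>2 / 1"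
    using r1 by (intro divide_left_mono) auto
  with 1 have A: "sqrt (1 + (y + h)\<^sup>2) \<le> r + y / r * h + h\<^sup>2"
    by simp
  have "sqrt (1 + (y + h)\<^sup>2) \<le> r + \<bar>h\<bar>"
  proof (rule real_le_lsqrt)
    have "y * h \<le> r * \<bar>h\<bar>"
      using mult_right_mono[OF yr abs_ge_zero[of h]] abs_ge_self[of "y * h"] by (simp add: abs_mult)
    then have "1 + (y + h)\<^sup>2 \<le> r\<^sup>2 + 2 * (r * \<bar>h\<bar>) + h\<^sup>2"
      unfolding r2 by (simp add: power2_eq_square algebra_simps)
    also have "\<dots> = (r + \<bar>h\<bar>)\<^sup>2" by (simp add: power2_sum)
    finally show "1 + (y + h)\<^sup>2 \<le> (r + \<bar>h\<bar>)\<^sup>2" .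
  qed (use r1 in simp)
  moreover have "\<bar>y / r * h\<bar> \<le> \<bar>h\<bar>"
    using mult_right_mono[of "\<bar>y\<bar> / r" 1 "\<bar>h\<bar>"] yr r1 by (simp add: abs_mult)
  ultimately have B: "sqrt (1 + (y + h)\<^sup>2) \<le> r + y / r * h + 2 * \<bar>h\<bar>"
    by linarith
  show ?thesis
    using A B unfolding r_def by (simp add: min_def)
qed

context bracket_process
begin

context
  fixes B :: "real \<Rightarrow> 'a \<Rightarrow> real"
  assumes T_pos: "0 < T"
    and XB: "martingale T M F (\<lambda>t x. (X t x)\<^sup>2 - B t x)"
    and B_paths: "AE x in M. B 0 x = 0 \<and> continuous_on {0..T} (\<lambda>t. B t x) \<and> mono_on {0..T} (\<lambda>t. B t x)"
begin

text \<open>The difference of two brackets is a continuous martingale \<open>D\<close> of integrable variation. Expanding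
  \<open>sqrt (1 + D\<^sup>2)\<close>, whose first two derivatives are bounded, along a partition gives
  \<open>E sqrt (1 + D\<^sup>2) = 1\<close> without any localization.\<close>

lemma bracket_unique_at:
  assumes t: "t \<in> {0..T}"
  shows "AE x in M. B t x = A t x"
proof -
  define \<phi> where "\<phi> = (\<lambda>y::real. sqrt (1 + y\<^sup>2))"
  define f where "f = (\<lambda>y::real. y / sqrt (1 + y\<^sup>2))"
  define w where "w = (\<lambda>h::real. min (h\<^sup>2) (2 * \<bar>h\<bar>))"
  define D where "D = (\<lambda>s x. A s x - B s x)"
  have f_bound: "\<bar>f y\<bar> \<le> 1" for y
  proof -
    have "\<bar>y\<bar> \<le> sqrt (1 + y\<^sup>2)"
      using real_sqrt_le_mono[of "y\<^sup>2" "1 + y\<^sup>2"] by simp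
    moreover have "0 < sqrt (1 + y\<^sup>2)" by (simp add: add_pos_nonneg)
    ultimately show ?thesis by (simp add: f_def)
  qed
  have \<phi>_bounds: "1 \<le> \<phi> y" "\<phi> y \<le> 1 + \<bar>y\<bar>" for y
  proof -
    show "1 \<le> \<phi> y" by (simp add: \<phi>_def)
    show "\<phi> y \<le> 1 + \<bar>y\<bar>"
      unfolding \<phi>_def by (rule real_le_lsqrt) (auto simp: power2_sum)
  qed
  have contf: "continuous_on UNIV f"
    unfolding f_def by (intro continuous_intros) (simp add: add_nonneg_eq_0_iff)
  have cont\<phi>: "continuous_on UNIV \<phi>"
    unfolding \<phi>_def by (intro continuous_intros)
  have contw: "continuous_on UNIV w"
    unfolding w_def by (intro continuous_intros)
  note [measurable] = borel_measurable_continuous_onI[OF contf] borel_measurable_continuous_onI[OF cont\<phi>]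
    borel_measurable_continuous_onI[OF contw]
  have BF: "B s \<in> borel_measurable (F s)" if s: "s \<in> {0..T}" for s
  proof -
    have "(\<lambda>x. (X s x)\<^sup>2 - ((X s x)\<^sup>2 - B s x)) \<in> borel_measurable (F s)"
      by (rule borel_measurable_diff[OF borel_measurable_power[OF martingale_adapted[OF X_mart s]]
        martingale_adapted[OF XB s]])
    then show ?thesis by simp
  qed
  have Bint: "integrable M (B s)" if s: "s \<in> {0..T}" for s
  proof -
    have "integrable M (\<lambda>x. (X s x)\<^sup>2 - ((X s x)\<^sup>2 - B s x))"
      by (rule Bochner_Integration.integrable_diff[OF X_sq_int[OF s] martingale_integrable[OF XB s]])
    then show ?thesis by simp
  qed
  have DF: "D s \<in> borel_measurable (F s)" if "s \<in> {0..T}" for s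
    unfolding D_def by (rule borel_measurable_diff[OF A_F BF]) (use that in auto)
  have Dint: "integrable M (D s)" if "s \<in> {0..T}" for s
    unfolding D_def by (rule Bochner_Integration.integrable_diff[OF A_int Bint]) (use that in auto)
  have DM: "D s \<in> borel_measurable M" if "s \<in> {0..T}" for s
    by (rule measurable_F[OF that DF[OF that]])
  have mart: "(\<integral>x. f (D s x) * (D r x - D s x) \<partial>M) = 0" if sr: "0 \<le> s" "s \<le> r" "r \<le> T" for s r
  proof -
    have sT: "s \<in> {0..T}" and rT: "r \<in> {0..T}"
      using sr by auto
    have fF: "(\<lambda>x. f (D s x)) \<in> borel_measurable (F s)"
      by (rule measurable_compose[OF DF[OF sT]]) measurable
    have fM: "(\<lambda>x. f (D s x)) \<in> borel_measurable M" by (rule measurable_F[OF sT fF])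
    note int = integrable_bounded_mult[OF _ fM f_bound]
    note iA = int[OF martingale_integrable[OF XA_mart sT]] int[OF martingale_integrable[OF XA_mart rT]]
    note iB = int[OF martingale_integrable[OF XB sT]] int[OF martingale_integrable[OF XB rT]]
    have "(\<integral>x. f (D s x) * (D r x - D s x) \<partial>M)
      = (\<integral>x. f (D s x) * ((X r x)\<^sup>2 - B r x) - f (D s x) * ((X s x)\<^sup>2 - B s x)
          - (f (D s x) * ((X r x)\<^sup>2 - A r x) - f (D s x) * ((X s x)\<^sup>2 - A s x)) \<partial>M)"
      by (intro Bochner_Integration.integral_cong refl) (simp add: D_def algebra_simps)
    also have "\<dots> = 0"
      using iA iB martingale_weighted(2)[OF XA_mart sr fF iA(2)] martingale_weighted(2)[OF XB sr fF iB(2)]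
      by simp
    finally show ?thesis .
  qed
  have \<phi>int: "integrable M (\<lambda>x. \<phi> (D s x))" if s: "s \<in> {0..T}" for s
  proof (rule Bochner_Integration.integrable_bound)
    show "integrable M (\<lambda>x. 1 + \<bar>D s x\<bar>)"
      using Dint[OF s] by auto
    show "(\<lambda>x. \<phi> (D s x)) \<in> borel_measurable M"
      by (rule measurable_compose[OF DM[OF s]]) measurable
    show "AE x in M. norm (\<phi> (D s x)) \<le> norm (1 + \<bar>D s x\<bar>)"
    proof (intro AE_I2)
      fix x
      show "norm (\<phi> (D s x)) \<le> norm (1 + \<bar>D s x\<bar>)"
        using \<phi>_bounds[of "D s x"] by simp
    qed
  qed
  have wint: "integrable M (\<lambda>x. w (D r x - D s x))" if s: "s \<in> {0..T}" and r: "r \<in> {0..T}" for s r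
  proof (rule Bochner_Integration.integrable_bound)
    show "integrable M (\<lambda>x. 2 * (D r x - D s x))"
      using Dint[OF s] Dint[OF r] by simp
    show "(\<lambda>x. w (D r x - D s x)) \<in> borel_measurable M"
      by (rule measurable_compose[OF borel_measurable_diff[OF DM[OF r] DM[OF s]]]) measurable
    show "AE x in M. norm (w (D r x - D s x)) \<le> norm (2 * (D r x - D s x))"
    proof (rule AE_I2)
      fix x
      have "norm (w y) \<le> norm (2 * y)" for y by (simp add: w_def abs_mult)
      then show "norm (w (D r x - D s x)) \<le> norm (2 * (D r x - D s x))" .
    qed
  qed
  define u where "u = (\<lambda>(N::nat) (k::nat). real k * (t / real N))"
  define W where "W = (\<lambda>N x. \<Sum>k<N. w (D (u N (Suc k)) x - D (u N k) x))"
  have u_mono: "u N j \<le> u N k" if "j \<le> k" for N j k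
    using that t by (auto simp: u_def intro!: mult_right_mono divide_right_mono)
  have u0: "u N 0 = 0" and uN: "0 < N \<Longrightarrow> u N N = t" for N by (simp_all add: u_def)
  have uS: "u N (Suc k) - u N k = t / real N" for N k
    by (simp add: u_def algebra_simps add_divide_distrib)
  have uT: "u N k \<in> {0..T}" if "k \<le> N" "0 < N" for N k
    using u_mono[of 0 k N] u_mono[of k N N] that u0 uN t by auto
  have Wint: "integrable M (W N)" for N
  proof (cases "N = 0")
    case False
    then show ?thesis
      unfolding W_def by (intro Bochner_Integration.integrable_sum wint uT) auto
  qed (simp add: W_def)
  have step: "(\<integral>x. \<phi> (D t x) \<partial>M) \<le> 1 + (\<integral>x. W N x \<partial>M)" if N: "0 < N" for N
  proof -
    have incr: "(\<integral>x. \<phi> (D (u N (Suc k)) x) \<partial>M) - (\<integral>x. \<phi> (D (u N k) x) \<partial>M) \<le> (\<integral>x. w (D (u N (Suc k)) x - D (u N k) x) \<partial>M)"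
      if k: "k < N" for k
    proof -
      define s r where "s = u N k" and "r = u N (Suc k)"
      have sT: "s \<in> {0..T}" and rT: "r \<in> {0..T}" and sr: "s \<le> r"
        using uT[of k N] uT[of "Suc k" N] k N u_mono[of k "Suc k" N] by (auto simp: s_def r_def)
      have fM: "(\<lambda>x. f (D s x)) \<in> borel_measurable M"
        by (rule measurable_compose[OF DM[OF sT]]) measurable
      have fi: "integrable M (\<lambda>x. f (D s x) * (D r x - D s x))"
        by (rule integrable_bounded_mult[OF _ fM f_bound], rule Bochner_Integration.integrable_diff[OF Dint[OF rT] Dint[OF sT]])
      have "(\<integral>x. \<phi> (D r x) \<partial>M) \<le> (\<integral>x. \<phi> (D s x) + f (D s x) * (D r x - D s x) + w (D r x - D s x) \<partial>M)"
      proof (rule integral_mono[OF \<phi>int[OF rT]])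
        show "integrable M (\<lambda>x. \<phi> (D s x) + f (D s x) * (D r x - D s x) + w (D r x - D s x))"
          by (intro Bochner_Integration.integrable_add \<phi>int[OF sT] fi wint[OF sT rT])
        show "\<phi> (D r x) \<le> \<phi> (D s x) + f (D s x) * (D r x - D s x) + w (D r x - D s x)" for x
          using sqrt_one_plus_square_le[of "D s x" "D r x - D s x"] by (simp add: \<phi>_def f_def w_def)
      qed
      also have "\<dots> = (\<integral>x. \<phi> (D s x) \<partial>M) + (\<integral>x. w (D r x - D s x) \<partial>M)"
        using \<phi>int[OF sT] fi wint[OF sT rT] mart[of s r] sT rT sr by simp
      finally show ?thesis by (simp add: s_def r_def)
    qed
    have D0: "AE x in M. \<phi> (D 0 x) = 1"
      using A_0 B_paths by eventually_elim (simp add: D_def \<phi>_def)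
    have "(\<integral>x. \<phi> (D 0 x) \<partial>M) = (\<integral>x. 1 \<partial>M)"
      by (rule integral_cong_AE[OF _ _ D0]) (use \<phi>int[of 0] T_pos in \<open>auto intro: borel_measurable_integrable\<close>)
    then have "(\<integral>x. \<phi> (D (u N 0) x) \<partial>M) = 1" by (simp add: u0 prob_space)
    moreover have "(\<integral>x. \<phi> (D (u N N) x) \<partial>M) - (\<integral>x. \<phi> (D (u N 0) x) \<partial>M)
        = (\<Sum>k<N. (\<integral>x. \<phi> (D (u N (Suc k)) x) \<partial>M) - (\<integral>x. \<phi> (D (u N k) x) \<partial>M))"
      by (rule sum_lessThan_telescope[symmetric])
    moreover have "\<dots> \<le> (\<Sum>k<N. \<integral>x. w (D (u N (Suc k)) x - D (u N k) x) \<partial>M)"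
      by (rule sum_mono) (use incr in auto)
    moreover have "\<dots> = (\<integral>x. W N x \<partial>M)"
      unfolding W_def by (rule Bochner_Integration.integral_sum[symmetric]) (use wint uT N in auto)
    ultimately show ?thesis by (simp add: uN[OF N])
  qed
  \<comment> \<open>Both processes increase from 0, so the variation of \<open>D\<close> along any
    partition is at most \<open>A t x + B t x\<close>. This dominates the remainder sums, and
    uniform continuity of the path sends them to 0.\<close>
  have paths: "AE x in M. (\<forall>N. \<bar>W N x\<bar> \<le> 2 * (A t x + B t x)) \<and> (\<lambda>N. W N x) \<longlonglongrightarrow> 0"
    using A_0 A_lip B_paths
  proof eventually_elim
    case (elim x)
    have Acont: "continuous_on {0..T} (\<lambda>t. A t x)"
      by (rule increasing_lipschitz_continuous[OF _ Lam_nonneg]) (use elim in blast)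
    then have "continuous_on {0..T} (\<lambda>s. D s x)"
      unfolding D_def using elim by (intro continuous_on_diff) auto
    then have uc: "uniformly_continuous_on {0..T} (\<lambda>s. D s x)"
      by (rule compact_uniformly_continuous) simp
    define h where "h = (\<lambda>N k. D (u N (Suc k)) x - D (u N k) x)"
    define S where "S = A t x + B t x"
    have total: "(\<Sum>k<N. \<bar>h N k\<bar>) \<le> S" if N: "0 < N" for N
    proof -
      have "(\<Sum>k<N. \<bar>h N k\<bar>) \<le> (\<Sum>k<N. (A (u N (Suc k)) x + B (u N (Suc k)) x) - (A (u N k) x + B (u N k) x))"
      proof (rule sum_mono)
        fix k assume "k \<in> {..<N}"
        then have kk: "u N k \<in> {0..T}" "u N (Suc k) \<in> {0..T}" "u N k \<le> u N (Suc k)"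
          using uT[of k N] uT[of "Suc k" N] N u_mono[of k "Suc k" N] by auto
        have "B (u N k) x \<le> B (u N (Suc k)) x"
          using elim kk by (auto simp: mono_on_def)
        moreover have "A (u N k) x \<le> A (u N (Suc k)) x"
          using elim kk by auto
        ultimately show "\<bar>h N k\<bar> \<le> (A (u N (Suc k)) x + B (u N (Suc k)) x) - (A (u N k) x + B (u N k) x)"
          by (simp add: h_def D_def)
      qed
      also have "\<dots> = (A (u N N) x + B (u N N) x) - (A (u N 0) x + B (u N 0) x)"
        by (rule sum_lessThan_telescope)
      also have "\<dots> = S"
        using elim uN[OF N] by (simp add: u0 S_def)
      finally show ?thesis .
    qed
    \<comment> \<open>Used twice: with \<open>c = 2\<close> for domination, and with small
      \<open>c\<close> for convergence, because \<open>h^2 \<le> c * \<bar>h\<bar>\<close> once the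
      increments are at most \<open>c\<close>.\<close>
    have W_le: "W N x \<le> c * S" if N: "0 < N" and c: "\<And>k. k < N \<Longrightarrow> w (h N k) \<le> c * \<bar>h N k\<bar>" "0 \<le> c" for N c
    proof -
      have "W N x \<le> (\<Sum>k<N. c * \<bar>h N k\<bar>)"
        unfolding W_def using c(1) by (intro sum_mono) (auto simp: h_def)
      also have "\<dots> \<le> c * S"
        unfolding sum_distrib_left[symmetric] by (rule mult_left_mono[OF total[OF N] c(2)])
      finally show ?thesis .
    qed
    have W0: "0 \<le> W N x" for N
      unfolding W_def by (intro sum_nonneg) (simp add: w_def)
    have S0: "0 \<le> S"
    proof -
      have "0 \<le> (\<Sum>k<1. \<bar>h 1 k\<bar>)" by (rule sum_nonneg) simp
      then show ?thesis
        using total[of 1] by simp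
    qed
    have bound: "\<bar>W N x\<bar> \<le> 2 * S" for N
    proof (cases "N = 0")
      case False
      then show ?thesis
        using W_le[of N 2] W0[of N] by (simp add: w_def)
    qed (use S0 in \<open>simp add: W_def\<close>)
    have lim: "(\<lambda>N. W N x) \<longlonglongrightarrow> 0"
    proof (rule LIMSEQ_I)
      fix e :: real assume e: "0 < e"
      \<comment> \<open>Adding 1 keeps the quotient meaningful when the variation bound
        \<open>S\<close> is 0.\<close>
      define c where "c = e / (S + 1)"
      have c: "0 < c" "c * S < e"
        using e S0 by (auto simp: c_def field_simps)
      obtain d where d: "0 < d" "\<And>v r. v \<in> {0..T} \<Longrightarrow> r \<in> {0..T} \<Longrightarrow> dist r v < d \<Longrightarrow> dist (D r x) (D v x) < c"
        using uc c(1) unfolding uniformly_continuous_on_def by metis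
      have "(\<lambda>N. t / real N) \<longlonglongrightarrow> 0" by (rule lim_const_over_n)
      then have "\<forall>\<^sub>F N in sequentially. t / real N < d \<and> 0 < N"
        using d(1) by (intro eventually_conj order_tendstoD eventually_gt_at_top) auto
      then obtain n0 where n0: "\<And>N. n0 \<le> N \<Longrightarrow> t / real N < d \<and> 0 < N"
        by (auto simp: eventually_sequentially)
      have "norm (W N x - 0) < e" if N: "n0 \<le> N" for N
      proof -
        have "w (h N k) \<le> c * \<bar>h N k\<bar>" if k: "k < N" for k
        proof -
          have "\<bar>h N k\<bar> \<le> c"
            using d(2)[of "u N k" "u N (Suc k)"] uT[of k N] uT[of "Suc k" N] uS[of N k] n0[OF N] k t
            by (auto simp: h_def dist_real_def intro!: less_imp_le)
          then have "\<bar>h N k\<bar> * \<bar>h N k\<bar> \<le> c * \<bar>h N k\<bar>"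
            by (rule mult_right_mono) simp
          then show ?thesis by (simp add: w_def min_le_iff_disj power2_eq_square)
        qed
        then have "W N x \<le> c * S"
          using W_le[of N c] n0[OF N] c by auto
        then show ?thesis
          using W0[of N] c(2) by simp
      qed
      then show "\<exists>n0. \<forall>N\<ge>n0. norm (W N x - 0) < e" by blast
    qed
    show ?case
      using bound lim by (simp add: S_def)
  qed
  have "(\<lambda>N. \<integral>x. W N x \<partial>M) \<longlonglongrightarrow> (\<integral>x. 0 \<partial>M)"
  proof (rule integral_dominated_convergence)
    show "integrable M (\<lambda>x. 2 * (A t x + B t x))"
      using A_int[OF t] Bint[OF t] by simp
    show "AE x in M. (\<lambda>N. W N x) \<longlonglongrightarrow> 0"
      using paths by eventually_elim simp
    show "AE x in M. norm (W N x) \<le> 2 * (A t x + B t x)" for N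
      using paths by eventually_elim simp
  qed (use Wint in \<open>auto intro: borel_measurable_integrable borel_measurable_const\<close>)
  then have lim1: "(\<lambda>N. 1 + (\<integral>x. W N x \<partial>M)) \<longlonglongrightarrow> 1 + 0"
    by (intro tendsto_intros) simp
  have "(\<integral>x. \<phi> (D t x) \<partial>M) \<le> 1 + 0"
    by (rule tendsto_lowerbound[OF lim1 eventually_mono[OF eventually_gt_at_top[of 0]]]) (rule step, auto)
  \<comment> \<open>As \<open>\<phi>\<close> is at least 1 everywhere, mean at most 1 forces
    \<open>\<phi> (D t x) = 1\<close>, that is \<open>D t x = 0\<close>, almost surely.\<close>
  then have le0: "(\<integral>x. \<phi> (D t x) - 1 \<partial>M) \<le> 0"
    using \<phi>int[OF t] by (simp add: prob_space)
  moreover have "0 \<le> (\<integral>x. \<phi> (D t x) - 1 \<partial>M)"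
    using \<phi>_bounds(1) by (intro integral_nonneg_AE AE_I2) simp
  ultimately have "(\<integral>x. \<phi> (D t x) - 1 \<partial>M) = 0" by simp
  moreover have "integrable M (\<lambda>x. \<phi> (D t x) - 1)"
    using \<phi>int[OF t] by simp
  ultimately have "AE x in M. \<phi> (D t x) - 1 = 0"
    using integral_nonneg_eq_0_iff_AE[of M "\<lambda>x. \<phi> (D t x) - 1"] \<phi>_bounds(1) by simp
  then show ?thesis by eventually_elim (simp add: \<phi>_def D_def)
qed

lemma bracket_unique: "AE x in M. \<forall>t\<in>{0..T}. B t x = A t x"
proof -
  have "AE x in M. \<forall>n k. k \<le> 2 ^ n \<longrightarrow> B (tdyad T n k) x = A (tdyad T n k) x"
    unfolding AE_all_countable
  proof (intro allI)
    fix n k :: nat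
    show "AE x in M. k \<le> 2 ^ n \<longrightarrow> B (tdyad T n k) x = A (tdyad T n k) x"
    proof (cases "k \<le> 2 ^ n")
      case True
      then have "tdyad T n k \<in> {0..T}"
        using tdyad_bounds[of T] T_pos by auto
      from bracket_unique_at[OF this] show ?thesis
        by eventually_elim simp
    qed simp
  qed
  then show ?thesis
    using A_lip B_paths
  proof eventually_elim
    case (elim x)
    have Acont: "continuous_on {0..T} (\<lambda>t. A t x)"
      by (rule increasing_lipschitz_continuous[OF _ Lam_nonneg]) (use elim in blast)
    have Bcont: "continuous_on {0..T} (\<lambda>t. B t x)"
      using elim by blast
    show ?case
    proof
      fix t assume t: "t \<in> {0..T}"
      show "B t x = A t x"
      proof (rule antisym)
        show "B t x \<le> A t x"
          by (rule dyad_le_of_dyadics[OF T_pos Bcont Acont _ t]) (use elim in simp)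
        show "A t x \<le> B t x"
          by (rule dyad_le_of_dyadics[OF T_pos Acont Bcont _ t]) (use elim in simp)
      qed
    qed
  qed
qed

end

end

section \<open>Error of the regularized square sums against the bracket\<close>

definition err_const :: "real \<Rightarrow> real \<Rightarrow> nat \<Rightarrow> real" where
  "err_const T \<Lambda> l = 2 ^ (4 * Suc l) * (4 * exp (comp_sum_const (2 * l + 1)) + 1) * (\<Lambda> * T) ^ (4 * Suc l)"

context bracket_process
begin

text \<open>An integrable majorant for the error to the power \<open>4 * Suc l\<close>, uniform in
  \<open>t\<close>. Only values at grid times enter, so its measurability does not involve a
  supremum over the interval.\<close>

definition err_var :: "nat \<Rightarrow> nat \<Rightarrow> 'a \<Rightarrow> real" where
  "err_var l n x = 2 ^ (4 * Suc l) * ((comp_max l (2 ^ n) (2 ^ n) x)\<^sup>2 + (\<Lambda> * T / 2 ^ n) ^ (4 * Suc l))"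

context
  assumes T_pos: "0 < T"
begin

lemma err_var_nonneg: "0 \<le> err_var l n x"
proof -
  have d: "0 \<le> \<Lambda> * T / 2 ^ n"
    using Lam_nonneg T_pos by simp
  show ?thesis
    unfolding err_var_def
    by (intro mult_nonneg_nonneg add_nonneg_nonneg zero_le_power[OF d] zero_le_power2) simp
qed

lemma err_var_integrable: "integrable M (err_var l n)"
proof -
  have "integrable M (\<lambda>x. (comp_max l (2 ^ n) (2 ^ n) x)\<^sup>2)"
    by (intro all_moments_integrable all_moments_power comp_max_all_moments) (use T_pos in auto)
  then show ?thesis
    unfolding err_var_def[abs_def] by simp
qed

lemma err_var_integral: "(\<integral>x. err_var l n x \<partial>M) \<le> err_const T \<Lambda> l / (2 ^ n) ^ (2 * Suc l)"
proof -
  define p where "p = 2 * Suc l"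
  have p: "4 * Suc l = 2 * p" "2 * Suc l = p" by (simp_all add: p_def)
  define a where "a = \<Lambda> * T"
  define E where "E = exp (comp_sum_const (2 * l + 1))"
  have a0: "0 \<le> a"
    using Lam_nonneg T_pos by (simp add: a_def)
  have int: "integrable M (\<lambda>x. (comp_max l (2 ^ n) (2 ^ n) x)\<^sup>2)"
    by (intro all_moments_integrable all_moments_power comp_max_all_moments) (use T_pos in auto)
  have "(\<integral>x. err_var l n x \<partial>M) = 2 ^ (2 * p) * ((\<integral>x. (comp_max l (2 ^ n) (2 ^ n) x)\<^sup>2 \<partial>M) + (a / 2 ^ n) ^ (2 * p))"
    unfolding err_var_def p a_def using int by (simp add: prob_space)
  also have "\<dots> \<le> 2 ^ (2 * p) * (4 * (E * (a\<^sup>2 / 2 ^ n) ^ p) + a ^ (2 * p) / (2 ^ n) ^ p)"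
  proof (intro mult_left_mono add_mono)
    show "(\<integral>x. (comp_max l (2 ^ n) (2 ^ n) x)\<^sup>2 \<partial>M) \<le> 4 * (E * (a\<^sup>2 / 2 ^ n) ^ p)"
      using comp_max_moment[of "2 ^ n" l] T_pos unfolding p a_def E_def by simp
    show "(a / 2 ^ n) ^ (2 * p) \<le> a ^ (2 * p) / (2 ^ n) ^ p"
      unfolding power_divide using a0
      by (intro divide_left_mono power_increasing mult_pos_pos zero_less_power zero_le_power) auto
  qed simp
  \<comment> \<open>The power of two in \<open>err_const\<close> comes from splitting the power of a
    sum, \<open>4 * exp\<close> from the maximal inequality, and the summand 1 from the
    discretization error, which decays faster and is brought to the same rate.\<close>
  also have "\<dots> = err_const T \<Lambda> l / (2 ^ n) ^ (2 * Suc l)"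
    unfolding err_const_def p a_def[symmetric] E_def[symmetric]
    by (simp add: power_divide power_mult add_divide_distrib ring_distribs)
  finally show ?thesis .
qed

lemma qn_bracket_error:
  "AE x in M. \<forall>t\<in>{0..T}. \<bar>qn T \<Lambda> n (\<lambda>t. X t x) t - A t x\<bar> ^ (4 * Suc l) \<le> err_var l n x"
  using A_0 A_lip
proof eventually_elim
  case (elim x)
  define N :: nat where "N = 2 ^ n"
  \<comment> \<open>A maximum over finitely many indices is attained, so its power is the power of
    one compensated sum and lies below \<open>comp_max\<close>; no interchange of maximum and power
    is needed.\<close>
  define e where "e = Max ((\<lambda>k. \<bar>comp_sum N k x\<bar>) ` {..N})"
  have "e \<in> (\<lambda>k. \<bar>comp_sum N k x\<bar>) ` {..N}"
    unfolding e_def by (intro Max_in) auto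
  then obtain k0 where k0: "k0 \<le> N" "e = \<bar>comp_sum N k0 x\<bar>" by auto
  have e_ge: "\<bar>comp_sum N k x\<bar> \<le> e" if "k \<le> N" for k
    unfolding e_def using that by (intro Max_ge) auto
  have e_le: "e ^ (2 * Suc l) \<le> comp_max l N N x"
    unfolding k0(2) power_even_abs[OF dvd_triv_left] by (rule comp_sum_le_max[OF k0(1)])
  have e0: "0 \<le> e" by (simp add: k0(2))
  have grid: "grid N k = tdyad T n k" for k by (simp add: grid_def tdyad_def N_def)
  have sum: "comp_sum N k x = (\<Sum>j<k. (X (tdyad T n (Suc j)) x - X (tdyad T n j) x)\<^sup>2) - A (tdyad T n k) x" for k
  proof -
    have "(\<Sum>j<k. A (tdyad T n (Suc j)) x - A (tdyad T n j) x) = A (tdyad T n k) x - A (tdyad T n 0) x"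
      by (rule sum_lessThan_telescope)
    then show ?thesis
      using elim by (simp add: comp_sum_def comp_incr_def grid sum_subtractf tdyad_0)
  qed
  define d where "d = \<Lambda> * T / 2 ^ n"
  have d0: "0 \<le> d"
    using Lam_nonneg T_pos by (simp add: d_def)
  show ?case
  proof
    fix t assume t: "t \<in> {0..T}"
    have "\<bar>qn T \<Lambda> n (\<lambda>t. X t x) t - A t x\<bar> \<le> e + \<Lambda> * T / 2 ^ n"
    proof (rule qn_error[OF T_pos Lam_nonneg _ _ _ t])
      show "0 \<le> A r x - A s x \<and> A r x - A s x \<le> \<Lambda> * (r - s)" if "0 \<le> s" "s \<le> r" "r \<le> T" for s r
        using elim that by blast
      show "\<bar>(\<Sum>j<k. (X (tdyad T n (Suc j)) x - X (tdyad T n j) x)\<^sup>2) - A (tdyad T n k) x\<bar> \<le> e"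
        if "k \<le> 2 ^ n" for k
        using e_ge[of k] that unfolding sum by (simp add: N_def)
    qed (use elim in simp)
    then have "\<bar>qn T \<Lambda> n (\<lambda>t. X t x) t - A t x\<bar> ^ (4 * Suc l) \<le> \<bar>e + d\<bar> ^ (4 * Suc l)"
      unfolding d_def by (intro power_mono) auto
    also have "\<dots> \<le> 2 ^ (4 * Suc l) * (\<bar>e\<bar> ^ (4 * Suc l) + \<bar>d\<bar> ^ (4 * Suc l))"
      by (rule abs_add_power_le)
    also have "\<dots> \<le> err_var l n x"
      unfolding err_var_def N_def[symmetric] d_def[symmetric]
    proof (intro mult_left_mono add_mono)
      have "\<bar>e\<bar> ^ (4 * Suc l) = (e ^ (2 * Suc l))\<^sup>2"
      proof -
        have "4 * Suc l = 2 * Suc l * 2" by simp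
        then show ?thesis
          using e0 by (simp only: power_mult[of _ "2 * Suc l" 2] abs_of_nonneg)
      qed
      also have "\<dots> \<le> (comp_max l N N x)\<^sup>2"
        using e_le e0 by (intro power_mono zero_le_power) auto
      finally show "\<bar>e\<bar> ^ (4 * Suc l) \<le> (comp_max l N N x)\<^sup>2" .
      show "\<bar>d\<bar> ^ (4 * Suc l) \<le> d ^ (4 * Suc l)"
        using d0 by simp
    qed simp
    finally show "\<bar>qn T \<Lambda> n (\<lambda>t. X t x) t - A t x\<bar> ^ (4 * Suc l) \<le> err_var l n x" .
  qed
qed

text \<open>Borel-Cantelli in integrated form: for \<open>l = 0\<close> the expectations are
  O(4^-n), so the sum over \<open>n\<close> has finite expectation, is almost surely finite, and its
  terms tend to 0.\<close>

lemma err_var_tendsto_0: "AE x in M. (\<lambda>n. err_var 0 n x) \<longlonglongrightarrow> 0"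
proof -
  have meas[measurable]: "(\<lambda>x. ennreal (err_var 0 n x)) \<in> borel_measurable M" for n
    using borel_measurable_integrable[OF err_var_integrable] by (rule measurable_compose) measurable
  have "(\<integral>\<^sup>+x. (\<Sum>n. ennreal (err_var 0 n x)) \<partial>M) = (\<Sum>n. \<integral>\<^sup>+x. ennreal (err_var 0 n x) \<partial>M)"
    by (rule nn_integral_suminf) (rule meas)
  also have "\<dots> \<le> (\<Sum>n. ennreal (err_const T \<Lambda> 0 * (1 / 4) ^ n))"
  proof (intro suminf_le allI)
    fix n
    have "(\<integral>\<^sup>+x. ennreal (err_var 0 n x) \<partial>M) = ennreal (\<integral>x. err_var 0 n x \<partial>M)"
      by (rule nn_integral_eq_integral[OF err_var_integrable]) (simp add: err_var_nonneg)
    also have "\<dots> \<le> ennreal (err_const T \<Lambda> 0 * (1 / 4) ^ n)"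
    proof (rule ennreal_leI)
      have "((2::real) ^ n) ^ (2 * Suc 0) = 4 ^ n"
        by (simp add: power2_eq_square flip: power_mult_distrib)
      then show "(\<integral>x. err_var 0 n x \<partial>M) \<le> err_const T \<Lambda> 0 * (1 / 4) ^ n"
        using err_var_integral[of 0 n] by (simp add: power_divide del: power_Suc)
    qed
    finally show "(\<integral>\<^sup>+x. ennreal (err_var 0 n x) \<partial>M) \<le> ennreal (err_const T \<Lambda> 0 * (1 / 4) ^ n)" .
  qed auto
  also have "\<dots> = ennreal (\<Sum>n. err_const T \<Lambda> 0 * (1 / 4) ^ n)"
  proof (rule suminf_ennreal2)
    have "0 \<le> err_const T \<Lambda> 0"
      unfolding err_const_def using Lam_nonneg T_pos
      by (intro mult_nonneg_nonneg zero_le_power add_nonneg_nonneg) auto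
    then show "0 \<le> err_const T \<Lambda> 0 * (1 / 4) ^ n" for n by simp
    show "summable (\<lambda>n. err_const T \<Lambda> 0 * (1 / 4) ^ n)"
      by (intro summable_mult summable_geometric) simp
  qed
  also have "\<dots> < \<infinity>" by simp
  finally have fin: "(\<integral>\<^sup>+x. (\<Sum>n. ennreal (err_var 0 n x)) \<partial>M) \<noteq> \<infinity>"
    by simp
  have "AE x in M. (\<Sum>n. ennreal (err_var 0 n x)) \<noteq> \<infinity>"
    by (rule nn_integral_PInf_AE[OF _ fin]) measurable
  then show ?thesis
  proof eventually_elim
    case (elim x)
    then have "summable (\<lambda>n. err_var 0 n x)"
      by (intro summable_suminf_not_top err_var_nonneg) (simp add: infinity_ennreal_def)
    then show ?case by (rule summable_LIMSEQ_zero)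
  qed
qed

lemma Qlim_bracket: "AE x in M. \<forall>t\<in>{0..T}. Qlim T \<Lambda> (\<lambda>t. X t x) t = A t x"
proof -
  have "AE x in M. \<forall>n. \<forall>t\<in>{0..T}. \<bar>qn T \<Lambda> n (\<lambda>t. X t x) t - A t x\<bar> ^ (4 * Suc 0) \<le> err_var 0 n x"
    unfolding AE_all_countable using qn_bracket_error[of _ 0] by simp
  then show ?thesis
    using err_var_tendsto_0
  proof eventually_elim
    case (elim x)
    show ?case
    proof (intro ballI Qlim_eq_lim[OF T_pos Lam_nonneg])
      fix t assume t: "t \<in> {0..T}"
      have "(\<lambda>n. root 4 (err_var 0 n x)) \<longlonglongrightarrow> root 4 0"
        using elim(2) by (rule tendsto_real_root)
      then have lim: "(\<lambda>n. root 4 (err_var 0 n x)) \<longlonglongrightarrow> 0" by simp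
      have le: "norm (qn T \<Lambda> n (\<lambda>t. X t x) t - A t x) \<le> root 4 (err_var 0 n x)" for n
      proof -
        have "root 4 (\<bar>qn T \<Lambda> n (\<lambda>t. X t x) t - A t x\<bar> ^ 4) \<le> root 4 (err_var 0 n x)"
          using elim(1) t by (intro real_root_le_mono) auto
        then show ?thesis by (subst (asm) real_root_power_cancel) auto
      qed
      have "(\<lambda>n. qn T \<Lambda> n (\<lambda>t. X t x) t - A t x) \<longlonglongrightarrow> 0"
        by (rule Lim_null_comparison[OF always_eventually[OF allI[OF le]] lim])
      then show "(\<lambda>n. qn T \<Lambda> n (\<lambda>t. X t x) t) \<longlonglongrightarrow> A t x"
        by (rule LIM_zero_cancel)
    qed
  qed
qed

end

end

abbreviation qn_err :: "real \<Rightarrow> real \<Rightarrow> nat \<Rightarrow> path \<Rightarrow> real" where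
  "qn_err T \<Lambda> n x \<equiv> mdist (cpaths T) (qn T \<Lambda> n x) (Qlim T \<Lambda> x)"

lemma mdist_qn_Qlim_power_le:
  assumes T: "0 < T" and Lam: "0 \<le> \<Lambda>" and p: "0 < p"
    and le: "\<And>t. t \<in> {0..T} \<Longrightarrow> \<bar>qn T \<Lambda> n x t - Qlim T \<Lambda> x t\<bar> ^ p \<le> R"
  shows "qn_err T \<Lambda> n x ^ p \<le> R"
proof -
  have R: "0 \<le> R"
  proof -
    have "0 \<le> \<bar>qn T \<Lambda> n x 0 - Qlim T \<Lambda> x 0\<bar> ^ p" by simp
    also have "\<dots> \<le> R"
      using T by (intro le) simp
    finally show ?thesis .
  qed
  have "qn_err T \<Lambda> n x \<le> root p R"
  proof (subst mdist_cpaths_le_iff)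
    show "\<forall>t\<in>{0..T}. \<bar>qn T \<Lambda> n x t - Qlim T \<Lambda> x t\<bar> \<le> root p R"
    proof
      fix t assume "t \<in> {0..T}"
      then have "root p (\<bar>qn T \<Lambda> n x t - Qlim T \<Lambda> x t\<bar> ^ p) \<le> root p R"
        using le p by (intro real_root_le_mono) auto
      then show "\<bar>qn T \<Lambda> n x t - Qlim T \<Lambda> x t\<bar> \<le> root p R"
        using p by (simp add: real_root_power_cancel)
    qed
  qed (use T Abr_cpaths[OF qn_in_Abr[OF T Lam]] Abr_cpaths[OF Qlim_in_Abr[OF T Lam]] in auto)
  then have "qn_err T \<Lambda> n x ^ p \<le> root p R ^ p" by (intro power_mono) auto
  then show ?thesis
    using p R by simp
qed

section \<open>Topology and measurability on path space\<close>

lemma space_borel_of: "space (borel_of X) = topspace X"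
  unfolding borel_of_def by (rule space_measure_of) (auto dest: openin_subset)

lemma sets_borel_of: "sets (borel_of X) = sigma_sets (topspace X) {U. openin X U}"
  unfolding borel_of_def by (rule sets_measure_of) (auto dest: openin_subset)

lemma openin_sets_borel_of: "openin X U \<Longrightarrow> U \<in> sets (borel_of X)"
  by (auto simp: sets_borel_of)

lemma borel_measurable_continuous_map:
  fixes f :: "'a \<Rightarrow> real"
  assumes "continuous_map X euclidean f"
  shows "f \<in> borel_measurable (borel_of X)"
proof (rule borel_measurableI)
  fix S :: "real set" assume "open S"
  then have "openin X {x \<in> topspace X. f x \<in> S}"
    using assms by (intro openin_continuous_map_preimage) auto
  moreover have "{x \<in> topspace X. f x \<in> S} = f -` S \<inter> space (borel_of X)"
    by (auto simp: space_borel_of)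
  ultimately show "f -` S \<inter> space (borel_of X) \<in> sets (borel_of X)"
    using openin_sets_borel_of by metis
qed

lemma closedin_le:
  assumes "continuous_map X euclideanreal f" "continuous_map X euclideanreal g"
  shows "closedin X {x \<in> topspace X. f x \<le> g x}"
proof -
  have "continuous_map X euclideanreal (\<lambda>x. f x - g x)"
    using assms by (rule continuous_map_diff)
  from closedin_continuous_map_preimage[OF this, of "{..0}"] show ?thesis
    by simp
qed

context
  fixes T :: real
  assumes T: "0 < T"
begin

lemma continuous_map_eval:
  assumes t: "t \<in> {0..T}"
  shows "continuous_map (mtopology_of (cpaths T)) euclidean (\<lambda>x. x t :: real)"
proof -
  interpret C: Metric_space "mspace (cpaths T)" "mdist (cpaths T)"
    by (rule Metric_space_mspace_mdist)
  have "continuous_map C.mtopology (Met_TC.mtopology) (\<lambda>x. x t :: real)"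
    unfolding C.metric_continuous_map[OF Met_TC.Metric_space_axioms]
  proof (intro conjI ballI allI impI)
    fix x and e :: real assume x: "x \<in> mspace (cpaths T)" and e: "0 < e"
    show "\<exists>d>0. \<forall>y. y \<in> mspace (cpaths T) \<and> mdist (cpaths T) x y < d \<longrightarrow> dist (x t) (y t) < e"
      using abs_diff_le_mdist[of T x _ t] T t x e by (intro exI[of _ e]) (force simp: dist_real_def)
  qed simp
  then show ?thesis by (simp add: mtopology_of_def)
qed

text \<open>The bound of \<open>qn_diff_le\<close>, seen as a function \<open>G\<close> of the
  second path, is continuous because it is built from evaluations, and it vanishes at
  \<open>x\<close>. Its sublevel sets are the required neighbourhoods.\<close>

lemma continuous_map_qn:
  assumes Lam: "0 \<le> \<Lambda>"
  shows "continuous_map (mtopology_of (cpaths T)) (mtopology_of (cpaths T)) (qn T \<Lambda> n)"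
proof -
  interpret C: Metric_space "mspace (cpaths T)" "mdist (cpaths T)"
    by (rule Metric_space_mspace_mdist)
  have top: "mtopology_of (cpaths T) = C.mtopology" by (simp add: mtopology_of_def)
  have q: "qn T \<Lambda> n x \<in> mspace (cpaths T)" for x
    by (rule Abr_cpaths[OF qn_in_Abr[OF T Lam]])
  show ?thesis
    unfolding top C.continuous_map_to_metric
  proof (intro ballI allI impI)
    fix x and e :: real assume x: "x \<in> topspace C.mtopology" and e: "0 < e"
    define G where "G = (\<lambda>y. \<Sum>j<2 ^ n. \<bar>(x (tdyad T n (Suc j)) - x (tdyad T n j))\<^sup>2 - (y (tdyad T n (Suc j)) - y (tdyad T n j))\<^sup>2\<bar>)"
    define U where "U = {y \<in> topspace C.mtopology. G y \<in> {..<e}}"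
    have "continuous_map C.mtopology euclidean G"
      unfolding G_def top[symmetric]
    proof (intro continuous_map_sum continuous_map_real_abs continuous_map_diff continuous_map_real_pow continuous_map_eval)
      fix j :: nat assume "j \<in> {..<2 ^ n}"
      then show "tdyad T n (Suc j) \<in> {0..T}" "tdyad T n j \<in> {0..T}"
        using tdyad_bounds[of T] T by auto
    qed auto
    then have "openin C.mtopology U"
      unfolding U_def by (rule openin_continuous_map_preimage) simp
    moreover have "x \<in> U"
      using x e by (simp add: U_def G_def)
    moreover have "qn T \<Lambda> n y \<in> C.mball (qn T \<Lambda> n x) e" if y: "y \<in> U" for y
    proof -
      have "mdist (cpaths T) (qn T \<Lambda> n x) (qn T \<Lambda> n y) \<le> G y"
        using T qn_diff_le[OF T Lam, of _ n x y] by (subst mdist_cpaths_le_iff[OF _ q q]) (auto simp: G_def)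
      also have "\<dots> < e"
        using y by (simp add: U_def)
      finally show ?thesis
        using q by simp
    qed
    ultimately show "\<exists>U. openin C.mtopology U \<and> x \<in> U \<and> (\<forall>y\<in>U. qn T \<Lambda> n y \<in> C.mball (qn T \<Lambda> n x) e)"
      by blast
  qed
qed

text \<open>Arzela-Ascoli, combined with sequential compactness in metric spaces; closedness of
  \<open>S\<close> keeps the limit inside.\<close>

lemma compactin_cpathsI:
  assumes S: "closedin (mtopology_of (cpaths T)) S"
    and bound: "\<And>x t. x \<in> S \<Longrightarrow> t \<in> {0..T} \<Longrightarrow> \<bar>x t\<bar> \<le> B"
    and equicont: "\<And>e. 0 < e \<Longrightarrow> \<exists>d>0. \<forall>x\<in>S. \<forall>s\<in>{0..T}. \<forall>t\<in>{0..T}. \<bar>s - t\<bar> < d \<longrightarrow> \<bar>x s - x t\<bar> < e"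
  shows "compactin (mtopology_of (cpaths T)) S"
proof -
  interpret C: Metric_space "mspace (cpaths T)" "mdist (cpaths T)"
    by (rule Metric_space_mspace_mdist)
  have top: "mtopology_of (cpaths T) = C.mtopology" by (simp add: mtopology_of_def)
  have SM: "S \<subseteq> mspace (cpaths T)"
    using closedin_subset[OF S] by simp
  show ?thesis
    unfolding top C.compactin_sequentially
  proof (intro conjI allI impI)
    fix \<sigma> :: "nat \<Rightarrow> path" assume "range \<sigma> \<subseteq> S"
    then have \<sigma>: "\<sigma> n \<in> S" for n by auto
    obtain g and k :: "nat \<Rightarrow> nat" where gk: "continuous_on {0..T} g" "strict_mono k"
      "\<And>e. 0 < e \<Longrightarrow> \<exists>N. \<forall>n x. n \<ge> N \<and> x \<in> {0..T} \<longrightarrow> norm (\<sigma> (k n) x - g x) < e"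
    proof (rule Arzela_Ascoli[of "{0..T}" \<sigma> B])
      show "norm (\<sigma> n t) \<le> B" if "t \<in> {0..T}" for n t
        using bound[OF \<sigma> that] by simp
      fix s and e :: real assume s: "s \<in> {0..T}" and e: "0 < e"
      obtain d where d: "0 < d" "\<forall>x\<in>S. \<forall>s\<in>{0..T}. \<forall>t\<in>{0..T}. \<bar>s - t\<bar> < d \<longrightarrow> \<bar>x s - x t\<bar> < e"
        using equicont[OF e] by blast
      then show "\<exists>d>0. \<forall>n t. t \<in> {0..T} \<and> norm (s - t) < d \<longrightarrow> norm (\<sigma> n s - \<sigma> n t) < e"
        using \<sigma> s by (intro exI[of _ d]) auto
    qed auto
    \<comment> \<open>The limit \<open>g\<close> is controlled on the interval only, while points of
      the path space are extensional, so it has to be restricted first.\<close>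
    define l where "l = restrict g {0..T}"
    have l: "l \<in> mspace (cpaths T)"
      unfolding mspace_cpaths using continuous_on_eq[OF gk(1), of l] by (simp add: l_def)
    have lim: "limitin C.mtopology (\<sigma> \<circ> k) l sequentially"
      unfolding C.limit_metric_sequentially
    proof (intro conjI l allI impI)
      fix e :: real assume e: "0 < e"
      then obtain N where N: "\<And>n x. N \<le> n \<Longrightarrow> x \<in> {0..T} \<Longrightarrow> norm (\<sigma> (k n) x - g x) < e / 2"
        using gk(3)[of "e / 2"] by auto
      have "(\<sigma> \<circ> k) n \<in> mspace (cpaths T) \<and> mdist (cpaths T) ((\<sigma> \<circ> k) n) l < e" if n: "N \<le> n" for n
      proof
        show \<sigma>k: "(\<sigma> \<circ> k) n \<in> mspace (cpaths T)"
          using \<sigma> SM by auto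
        have "mdist (cpaths T) ((\<sigma> \<circ> k) n) l \<le> e / 2"
          using T N[OF n] by (subst mdist_cpaths_le_iff[OF _ \<sigma>k l]) (auto simp: l_def intro!: less_imp_le)
        then show "mdist (cpaths T) ((\<sigma> \<circ> k) n) l < e"
          using e by simp
      qed
      then show "\<exists>N. \<forall>n\<ge>N. (\<sigma> \<circ> k) n \<in> mspace (cpaths T) \<and> mdist (cpaths T) ((\<sigma> \<circ> k) n) l < e"
        by blast
    qed
    have "l \<in> S" by (rule limitin_closedin[OF lim S[unfolded top]]) (use \<sigma> in auto)
    then show "\<exists>l r. l \<in> S \<and> strict_mono r \<and> limitin C.mtopology (\<sigma> \<circ> r) l sequentially"
      using gk(2) lim by blast
  qed (rule SM)
qed

text \<open>Its purpose is the total boundedness from which \<open>measurable_into_Abr\<close> draws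
  finite nets.\<close>

lemma compactin_Abr:
  assumes Lam: "0 \<le> \<Lambda>"
  shows "compactin (mtopology_of (cpaths T)) (Abr T \<Lambda>)"
proof (rule compactin_cpathsI[of _ "\<Lambda> * T"])
  define X where "X = mtopology_of (cpaths T)"
  have ev: "continuous_map X euclideanreal (\<lambda>x. x t)" if "t \<in> {0..T}" for t
    unfolding X_def by (rule continuous_map_eval[OF that])
  define I where "I = {(s, t). 0 \<le> s \<and> s \<le> t \<and> t \<le> T}"
  have "Abr T \<Lambda> = {x \<in> topspace X. x 0 \<le> 0} \<inter> {x \<in> topspace X. 0 \<le> x 0}
     \<inter> (\<Inter>p\<in>I. {x \<in> topspace X. x (fst p) \<le> x (snd p)} \<inter> {x \<in> topspace X. x (snd p) - x (fst p) \<le> \<Lambda> * (snd p - fst p)})"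
    by (force simp: Abr_def X_def I_def)
  moreover have "closedin X \<dots>"
  proof (intro closedin_Int closedin_INT closedin_le continuous_map_diff ev continuous_map_canonical_const)
    show "I \<noteq> {}"
      using T by (auto simp: I_def intro!: exI[of _ 0])
  qed (use T in \<open>auto simp: I_def\<close>)
  ultimately show "closedin (mtopology_of (cpaths T)) (Abr T \<Lambda>)" by (simp add: X_def)
  show "\<bar>x t\<bar> \<le> \<Lambda> * T" if "x \<in> Abr T \<Lambda>" "t \<in> {0..T}" for x t
    using Abr_bounds[OF that] that(2) mult_left_mono[of t T \<Lambda>] Lam by auto
  fix e :: real assume e: "0 < e"
  define d where "d = e / (\<Lambda> + 1)"
  have d: "0 < d" "\<Lambda> * d < e"
    using e Lam by (auto simp: d_def field_simps)
  have "\<bar>x s - x t\<bar> \<le> \<Lambda> * \<bar>s - t\<bar>" if "x \<in> Abr T \<Lambda>" "s \<in> {0..T}" "t \<in> {0..T}" for x s t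
    using that by (cases "s \<le> t") (force simp: Abr_def)+
  moreover have "\<Lambda> * \<bar>s - t\<bar> < e" if "\<bar>s - t\<bar> < d" for s t
    using mult_left_mono[of "\<bar>s - t\<bar>" d \<Lambda>] that d Lam by auto
  ultimately show "\<exists>d>0. \<forall>x\<in>Abr T \<Lambda>. \<forall>s\<in>{0..T}. \<forall>t\<in>{0..T}. \<bar>s - t\<bar> < d \<longrightarrow> \<bar>x s - x t\<bar> < e"
    using d(1) le_less_trans by (intro exI[of _ d] conjI ballI impI) blast+
qed

text \<open>By continuity of both paths, a bound at all dyadic times is a bound everywhere, which
  leaves countably many measurable conditions.\<close>

lemma measurable_mdist_cpaths:
  assumes f: "\<And>w. w \<in> space N \<Longrightarrow> f w \<in> mspace (cpaths T)" and g: "\<And>w. w \<in> space N \<Longrightarrow> g w \<in> mspace (cpaths T)"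
    and fm: "\<And>t. t \<in> {0..T} \<Longrightarrow> (\<lambda>w. f w t) \<in> borel_measurable N"
    and gm: "\<And>t. t \<in> {0..T} \<Longrightarrow> (\<lambda>w. g w t) \<in> borel_measurable N"
  shows "(\<lambda>w. mdist (cpaths T) (f w) (g w)) \<in> borel_measurable N"
  unfolding borel_measurable_iff_le
proof
  fix a :: real
  define D where "D = (\<lambda>(n::nat) k. {w \<in> space N. \<bar>f w (tdyad T n k) - g w (tdyad T n k)\<bar> \<le> a})"
  have "{w \<in> space N. mdist (cpaths T) (f w) (g w) \<le> a} = space N \<inter> (\<Inter>n. \<Inter>k\<in>{..2 ^ n}. D n k)" (is "?L = ?R")
  proof (intro set_eqI iffI)
    fix w assume "w \<in> ?L"
    then show "w \<in> ?R"
      using mdist_cpaths_le_iff[of T "f w" "g w" a] f[of w] g[of w] T tdyad_bounds[of T] by (auto simp: D_def)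
  next
    fix w assume w: "w \<in> ?R"
    then have wN: "w \<in> space N" by blast
    have "\<forall>t\<in>{0..T}. \<bar>f w t - g w t\<bar> \<le> a"
    proof
      fix t assume t: "t \<in> {0..T}"
      have c: "continuous_on {0..T} (f w)" "continuous_on {0..T} (g w)"
        using f[OF wN] g[OF wN] by (auto simp: mspace_cpaths)
      show "\<bar>f w t - g w t\<bar> \<le> a"
        by (rule dyad_le_of_dyadics[OF T _ _ _ t, of "\<lambda>t. \<bar>f w t - g w t\<bar>" "\<lambda>_. a"])
          (use w c in \<open>auto simp: D_def intro!: continuous_intros\<close>)
    qed
    then show "w \<in> ?L"
      using mdist_cpaths_le_iff[of T "f w" "g w" a] f[OF wN] g[OF wN] T wN by auto
  qed
  moreover have "?R \<in> sets N"
  proof -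
    have Dm: "D n k \<in> sets N" if "k \<in> {..2 ^ n}" for n k
    proof -
      have "tdyad T n k \<in> {0..T}"
        using tdyad_bounds[of T] T that by auto
      note [measurable] = fm[OF this] gm[OF this]
      show ?thesis
        unfolding D_def by measurable
    qed
    have "(\<Inter>k\<in>{..2 ^ n}. D n k) \<in> sets N" for n
      by (rule sets.finite_INT) (use Dm in auto)
    then have "(\<Inter>n. \<Inter>k\<in>{..2 ^ n}. D n k) \<in> sets N"
      by (intro sets.countable_INT) auto
    then show ?thesis by (rule sets.Int[OF sets.top])
  qed
  ultimately show "{w \<in> space N. mdist (cpaths T) (f w) (g w) \<le> a} \<in> sets N" by simp
qed

text \<open>Coordinatewise measurability has to be lifted to arbitrary open sets. Finite nets at
  every scale write an open set as a countable union of balls, and preimages of balls are measurable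
  by \<open>measurable_mdist_cpaths\<close>.\<close>

lemma measurable_into_Abr:
  assumes Lam: "0 \<le> \<Lambda>" and f: "\<And>w. w \<in> space N \<Longrightarrow> f w \<in> Abr T \<Lambda>"
    and fm: "\<And>t. t \<in> {0..T} \<Longrightarrow> (\<lambda>w. f w t) \<in> borel_measurable N"
  shows "f \<in> N \<rightarrow>\<^sub>M borel_of (mtopology_of (submetric (cpaths T) (Abr T \<Lambda>)))"
  unfolding borel_of_def
proof (rule measurable_measure_of)
  let ?m = "submetric (cpaths T) (Abr T \<Lambda>)"
  have msp: "mspace ?m = Abr T \<Lambda>"
    using Abr_cpaths by auto
  interpret S: Metric_space "mspace ?m" "mdist ?m"
    by (rule Metric_space_mspace_mdist)
  have top: "mtopology_of ?m = S.mtopology" by (simp add: mtopology_of_def)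
  have "compactin S.mtopology (Abr T \<Lambda>)"
    using compactin_Abr[OF Lam] unfolding top[symmetric] mtopology_of_submetric compactin_subtopology by simp
  then have "S.mtotally_bounded (Abr T \<Lambda>)" by (rule S.compactin_imp_mtotally_bounded)
  then have "\<exists>K. finite K \<and> K \<subseteq> Abr T \<Lambda> \<and> Abr T \<Lambda> \<subseteq> (\<Union>x\<in>K. S.mball x (1 / real (Suc n)))" for n
    unfolding S.mtotally_bounded_def by (meson divide_pos_pos of_nat_0_less_iff zero_less_Suc zero_less_one)
  then obtain K where K: "\<And>n. finite (K n)" "\<And>n. K n \<subseteq> Abr T \<Lambda>" "\<And>n. Abr T \<Lambda> \<subseteq> (\<Union>x\<in>K n. S.mball x (1 / real (Suc n)))"
    by metis
  show "{U. openin (mtopology_of ?m) U} \<subseteq> Pow (topspace (mtopology_of ?m))"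
    using openin_subset by blast
  show "f \<in> space N \<rightarrow> topspace (mtopology_of ?m)"
    using f Abr_cpaths by auto
  fix U assume "U \<in> {U. openin (mtopology_of ?m) U}"
  then have oU: "openin S.mtopology U"
    unfolding mem_Collect_eq top .
  have U: "U \<subseteq> Abr T \<Lambda>" "\<And>q. q \<in> U \<Longrightarrow> \<exists>r>0. S.mball q r \<subseteq> U"
    using oU[unfolded S.openin_mtopology] msp by blast+
  define C where "C = (\<lambda>n. {c \<in> K n. S.mball c (1 / real (Suc n)) \<subseteq> U})"
  have U_eq: "U = (\<Union>n. \<Union>c\<in>C n. S.mball c (1 / real (Suc n)))"
  proof
    show "U \<subseteq> (\<Union>n. \<Union>c\<in>C n. S.mball c (1 / real (Suc n)))"
    proof
      fix q assume q: "q \<in> U"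
      obtain r where r: "0 < r" "S.mball q r \<subseteq> U"
        using U(2)[OF q] by blast
      \<comment> \<open>Half the radius: a ball of radius \<open>1 / real (Suc n)\<close> that
        contains \<open>q\<close> then stays within distance \<open>r\<close> of
        \<open>q\<close>.\<close>
      obtain n where n: "1 / real (Suc n) < r / 2"
        using nat_approx_posE[of "r / 2"] r(1) by auto
      obtain c where c: "c \<in> K n" "q \<in> S.mball c (1 / real (Suc n))"
        using K(3)[of n] q U(1) by blast
      have "S.mball c (1 / real (Suc n)) \<subseteq> S.mball q r"
      proof
        fix y assume y: "y \<in> S.mball c (1 / real (Suc n))"
        have y': "y \<in> mspace ?m" "mdist ?m c y < 1 / real (Suc n)"
          and q': "c \<in> mspace ?m" "q \<in> mspace ?m" "mdist ?m c q < 1 / real (Suc n)"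
          using y c(2) unfolding S.in_mball by blast+
        have "mdist ?m q y \<le> mdist ?m q c + mdist ?m c y" by (rule S.triangle[OF q'(2,1) y'(1)])
        also have "\<dots> < r"
          using y'(2) q'(3) n S.commute[of q c] by linarith
        finally show "y \<in> S.mball q r"
          unfolding S.in_mball using y'(1) q'(2) by blast
      qed
      then have "c \<in> C n"
        using r(2) c by (auto simp: C_def)
      then show "q \<in> (\<Union>n. \<Union>c\<in>C n. S.mball c (1 / real (Suc n)))"
        using c by blast
    qed
  qed (auto simp: C_def)
  have "f -` U \<inter> space N = (\<Union>n. \<Union>c\<in>C n. {w \<in> space N. mdist (cpaths T) c (f w) < 1 / real (Suc n)})"
    (is "?L = ?R")
  proof (intro set_eqI)
    fix w
    have "f w \<in> S.mball c (1 / real (Suc n)) \<longleftrightarrow> mdist (cpaths T) c (f w) < 1 / real (Suc n)"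
      if "w \<in> space N" "c \<in> C n" for c n
    proof -
      have "c \<in> mspace ?m" "f w \<in> mspace ?m"
        unfolding msp using that K(2) f by (auto simp: C_def)
      then have "f w \<in> S.mball c (1 / real (Suc n)) \<longleftrightarrow> mdist ?m c (f w) < 1 / real (Suc n)"
        unfolding S.in_mball by blast
      then show ?thesis by (simp only: mdist_submetric)
    qed
    then show "w \<in> ?L \<longleftrightarrow> w \<in> ?R"
      unfolding U_eq by blast
  qed
  also have "\<dots> \<in> sets N"
  proof (intro sets.countable_UN'' sets.finite_UN)
    fix n c assume "c \<in> C n"
    then have c: "c \<in> mspace (cpaths T)"
      using K(2)[of n] Abr_cpaths by (auto simp: C_def)
    have [measurable]: "(\<lambda>w. mdist (cpaths T) c (f w)) \<in> borel_measurable N"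
      by (rule measurable_mdist_cpaths) (use c f Abr_cpaths fm borel_measurable_const in auto)
    show "{w \<in> space N. mdist (cpaths T) c (f w) < 1 / real (Suc n)} \<in> sets N" by measurable
  next
    show "countable (C n)" for n
      by (rule countable_finite, rule finite_subset[OF _ K(1)[of n]]) (auto simp: C_def)
  qed simp
  finally show "f -` U \<inter> space N \<in> sets N" .
qed

lemma Omega_topology: "mtopology_of (Omega T) = subtopology (mtopology_of (cpaths T)) {x. x 0 = 0}"
  unfolding Omega_def by (rule mtopology_of_submetric)

lemma space_borel_Omega: "space (borel_of (mtopology_of (Omega T))) = mspace (Omega T)"
  by (simp add: space_borel_of)

lemma mspace_Omega: "mspace (Omega T) = {x \<in> mspace (cpaths T). x 0 = 0}"
  by (auto simp: Omega_def)

lemma measurable_eval: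
  "t \<in> {0..T} \<Longrightarrow> (\<lambda>x. x t) \<in> borel_measurable (borel_of (mtopology_of (Omega T)))"
  unfolding Omega_topology
  by (intro borel_measurable_continuous_map continuous_map_from_subtopology continuous_map_eval)

lemma measurable_qn_eval:
  assumes "0 \<le> \<Lambda>" "t \<in> {0..T}"
  shows "(\<lambda>x. qn T \<Lambda> n x t) \<in> borel_measurable (borel_of (mtopology_of (Omega T)))"
  unfolding Omega_topology
  using continuous_map_compose[OF continuous_map_qn[OF assms(1)] continuous_map_eval[OF assms(2)], of n]
  by (intro borel_measurable_continuous_map continuous_map_from_subtopology) (simp add: o_def)

lemma measurable_Qlim_eval:
  assumes "0 \<le> \<Lambda>" "t \<in> {0..T}"
  shows "(\<lambda>x. Qlim T \<Lambda> x t) \<in> borel_measurable (borel_of (mtopology_of (Omega T)))"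
proof -
  note [measurable] = measurable_qn_eval[OF assms]
  have "(\<lambda>x. real_of_ereal (limsup (\<lambda>n. ereal (qn T \<Lambda> n x t)))) \<in> borel_measurable (borel_of (mtopology_of (Omega T)))"
    by measurable
  then show ?thesis
    using assms(2) by (simp add: Qlim_def)
qed

lemma measurable_Qlim:
  assumes "0 \<le> \<Lambda>"
  shows "Qlim T \<Lambda> \<in> borel_of (mtopology_of (Omega T))
    \<rightarrow>\<^sub>M borel_of (mtopology_of (submetric (cpaths T) (Abr T \<Lambda>)))"
  by (rule measurable_into_Abr[OF assms Qlim_in_Abr[OF T assms] measurable_Qlim_eval[OF assms]])

end

section \<open>Laws in the class: transfer from the completion, moments and rates\<close>

context
  fixes T \<Lambda> :: real
  assumes T: "0 < T" and Lam: "0 \<le> \<Lambda>"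
begin

context
  fixes P :: "path measure"
  assumes P: "P \<in> MLam T \<Lambda>"
begin

lemma prob_space_MLam: "prob_space P"
  and sets_MLam: "sets P = sets (borel_of (mtopology_of (Omega T)))"
  using P by (auto simp: MLam_def)

lemma space_MLam: "space P = mspace (Omega T)"
  using sets_eq_imp_space_eq[OF sets_MLam] space_borel_Omega[OF T] by simp

lemma measurable_MLam: "f \<in> borel_measurable (borel_of (mtopology_of (Omega T))) \<Longrightarrow> f \<in> borel_measurable P"
  unfolding measurable_cong_sets[OF sets_MLam refl] .

lemma coord_gen_sets: assumes "u \<le> T" shows "coord_gen T u \<subseteq> sets P"
proof
  fix S assume "S \<in> coord_gen T u"
  then obtain v B where v: "v \<in> {0..u}" "B \<in> sets borel" and S: "S = {x \<in> mspace (Omega T). x v \<in> B}"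
    by (auto simp: coord_gen_def)
  have "(\<lambda>x. x v) \<in> borel_measurable P"
    by (rule measurable_MLam, rule measurable_eval[OF T]) (use v assms in auto)
  from measurable_sets[OF this v(2)] have "(\<lambda>x. x v) -` B \<inter> space P \<in> sets P" .
  also have "(\<lambda>x. x v) -` B \<inter> space P = S"
    unfolding S space_MLam by blast
  finally show "S \<in> sets P" .
qed

lemma aug_generators_sets:
  "sigma_sets (mspace (Omega T)) (coord_gen T (min s T) \<union> null_sets (completion P)) \<subseteq> sets (completion P)"
proof -
  have "coord_gen T (min s T) \<subseteq> sets P" by (rule coord_gen_sets) simp
  then have "coord_gen T (min s T) \<subseteq> sets (completion P)"
    using sets_completionI_sets by blast
  moreover have "null_sets (completion P) \<subseteq> sets (completion P)"
    using null_setsD2 by blast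
  ultimately have "coord_gen T (min s T) \<union> null_sets (completion P) \<subseteq> sets (completion P)"
    by (rule Un_least)
  from sets.sigma_sets_subset[OF this] show ?thesis
    by (simp add: space_MLam)
qed

text \<open>Before the applied \<open>sigma\<close> can be evaluated, its generating family must be
  known to consist of subsets of the path space. One member of the intersection is enough for that;
  any time beyond \<open>t\<close> serves, and \<open>t + 1\<close> is taken.\<close>

lemma sets_aug_filt:
  "sets (aug_filt T P t) = sigma_sets (mspace (Omega T))
     (\<Inter>s\<in>{t<..}. sigma_sets (mspace (Omega T)) (coord_gen T (min s T) \<union> null_sets (completion P)))"
  and space_aug_filt: "space (aug_filt T P t) = mspace (Omega T)"
proof -
  let ?G = "\<Inter>s\<in>{t<..}. sigma_sets (mspace (Omega T)) (coord_gen T (min s T) \<union> null_sets (completion P))"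
  have "?G \<subseteq> sets (completion P)"
    by (rule INF_lower2[of "t + 1", OF _ aug_generators_sets]) simp
  then have "?G \<subseteq> Pow (mspace (Omega T))"
    using sets.space_closed[of "completion P"] by (auto simp: space_MLam)
  then show "sets (aug_filt T P t) = sigma_sets (mspace (Omega T)) ?G"
    and "space (aug_filt T P t) = mspace (Omega T)"
    unfolding aug_filt_def by (rule sets_measure_of, rule space_measure_of)
qed

lemma filtered_prob_MLam: "filtered_prob (completion P) (aug_filt T P) T"
proof -
  interpret prob_space "completion P"
    by (rule prob_space.prob_space_completion[OF prob_space_MLam])
  show ?thesis
  proof
    fix t assume "t \<in> {0..T}"
    have "(\<Inter>s\<in>{t<..}. sigma_sets (mspace (Omega T)) (coord_gen T (min s T) \<union> null_sets (completion P))) \<subseteq> sets (completion P)"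
      by (rule INF_lower2[of "t + 1", OF _ aug_generators_sets]) simp
    from sets.sigma_sets_subset[OF this]
    show "subalgebra (completion P) (aug_filt T P t)"
      by (simp add: subalgebra_def sets_aug_filt space_aug_filt space_MLam)
  next
    fix s t assume "s \<le> (t :: real)"
    then have "{t<..} \<subseteq> {s<..}" by auto
    then show "sets (aug_filt T P s) \<subseteq> sets (aug_filt T P t)"
      unfolding sets_aug_filt by (intro sigma_sets_mono' INF_superset_mono) auto
  qed
qed

lemma MLam_bracket_process:
  obtains A where "is_bracket T P A" "bracket_process (completion P) (aug_filt T P) T (\<lambda>t x. x t) A \<Lambda>"
proof -
  interpret filtered_prob "completion P" "aug_filt T P" T
    by (rule filtered_prob_MLam)
  obtain A where A: "is_bracket T P A" "AE x in P. \<forall>s t. 0 \<le> s \<and> s \<le> t \<and> t \<le> T \<longrightarrow> A t x - A s x \<le> \<Lambda> * (t - s)"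
    using P by (auto simp: MLam_def)
  have br: "AE x in P. A 0 x = 0 \<and> continuous_on {0..T} (\<lambda>t. A t x) \<and> mono_on {0..T} (\<lambda>t. A t x)"
    using A(1) by (simp add: is_bracket_def)
  have "bracket_process (completion P) (aug_filt T P) T (\<lambda>t x. x t) A \<Lambda>"
  proof
    show "0 \<le> \<Lambda>" by (rule Lam)
    show "martingale T (completion P) (aug_filt T P) (\<lambda>t x. x t)"
      using P by (simp add: MLam_def)
    show "martingale T (completion P) (aug_filt T P) (\<lambda>t x. (x t)\<^sup>2 - A t x)"
      using A(1) by (simp add: is_bracket_def)
    show "integrable (completion P) (\<lambda>x. (x t)\<^sup>2)" if t: "t \<in> {0..T}" for t
    proof -
      have "integrable P (\<lambda>x. (x t)\<^sup>2)"
        using P t by (simp add: MLam_def)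
      moreover have "(\<lambda>x. (x t)\<^sup>2) \<in> borel_measurable P"
        by (intro borel_measurable_power measurable_MLam measurable_eval[OF T t])
      ultimately show ?thesis by (simp add: integrable_completion)
    qed
    show "continuous_on {0..T} (\<lambda>t. x t)" if "x \<in> space (completion P)" for x
      using that by (simp add: space_MLam mspace_Omega[OF T] mspace_cpaths)
    show "AE x in completion P. A 0 x = 0" by (rule AE_completion, use br in eventually_elim) simp
    show "AE x in completion P. \<forall>s t. 0 \<le> s \<and> s \<le> t \<and> t \<le> T \<longrightarrow> 0 \<le> A t x - A s x \<and> A t x - A s x \<le> \<Lambda> * (t - s)"
      by (rule AE_completion, use br A(2) in eventually_elim) (auto simp: mono_on_def)
  qed
  with A(1) show ?thesis
    by (rule that)
qed

text \<open>The rate bound is granted for the bracket \<open>A\<close> of the class, not for a given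
  \<open>B\<close>. So \<open>Qlim\<close> is identified with \<open>A\<close>, and uniqueness
  carries the identity over to \<open>B\<close>.\<close>

lemma Qlim_eq_bracket:
  assumes B: "is_bracket T P B"
  shows "AE x in P. \<forall>t\<in>{0..T}. Qlim T \<Lambda> x t = B t x"
proof -
  obtain A where A: "bracket_process (completion P) (aug_filt T P) T (\<lambda>t x. x t) A \<Lambda>"
    using MLam_bracket_process by blast
  interpret bracket_process "completion P" "aug_filt T P" T "\<lambda>t x. x t" A \<Lambda>
    by (rule A)
  have "AE x in completion P. \<forall>t\<in>{0..T}. B t x = A t x"
    by (rule bracket_unique[OF T]) (use B in \<open>auto simp: is_bracket_def intro: AE_completion\<close>)
  moreover have "AE x in completion P. \<forall>t\<in>{0..T}. Qlim T \<Lambda> x t = A t x"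
    using Qlim_bracket[OF T] by simp
  ultimately have "AE x in completion P. \<forall>t\<in>{0..T}. Qlim T \<Lambda> x t = B t x"
    by eventually_elim simp
  then show ?thesis by (simp add: AE_completion_iff)
qed

lemma measurable_qn_Qlim_dist:
  "(\<lambda>x. qn_err T \<Lambda> n x) \<in> borel_measurable P"
  by (intro measurable_MLam measurable_mdist_cpaths[OF T] Abr_cpaths[OF qn_in_Abr[OF T Lam]]
      Abr_cpaths[OF Qlim_in_Abr[OF T Lam]] measurable_qn_eval[OF T Lam] measurable_Qlim_eval[OF T Lam])

text \<open>Both paths lie in \<open>Abr\<close>, hence between 0 and \<open>\<Lambda> * T\<close>.
  This gives integrability of every power of the distance without any moment estimate.\<close>

lemma qn_Qlim_dist_bounds:
  "0 \<le> qn_err T \<Lambda> n x" "qn_err T \<Lambda> n x \<le> \<Lambda> * T"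
proof -
  show "qn_err T \<Lambda> n x \<le> \<Lambda> * T"
  proof (subst mdist_cpaths_le_iff)
    show "\<forall>t\<in>{0..T}. \<bar>qn T \<Lambda> n x t - Qlim T \<Lambda> x t\<bar> \<le> \<Lambda> * T"
    proof
      fix t assume t: "t \<in> {0..T}"
      have "\<Lambda> * t \<le> \<Lambda> * T"
        using t Lam by (intro mult_left_mono) auto
      then show "\<bar>qn T \<Lambda> n x t - Qlim T \<Lambda> x t\<bar> \<le> \<Lambda> * T"
        using Abr_bounds[OF qn_in_Abr[OF T Lam, of n x] t] Abr_bounds[OF Qlim_in_Abr[OF T Lam, of x] t] by linarith
    qed
  qed (use T Abr_cpaths[OF qn_in_Abr[OF T Lam]] Abr_cpaths[OF Qlim_in_Abr[OF T Lam]] in auto)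
qed simp

lemma integrable_qn_Qlim_dist:
  "integrable P (\<lambda>x. qn_err T \<Lambda> n x ^ p)"
  "0 \<le> r \<Longrightarrow> integrable P (\<lambda>x. qn_err T \<Lambda> n x powr r)"
proof -
  interpret prob_space P
    by (rule prob_space_MLam)
  note [measurable] = measurable_qn_Qlim_dist
  note b = qn_Qlim_dist_bounds
  show "integrable P (\<lambda>x. qn_err T \<Lambda> n x ^ p)"
  proof (rule integrable_const_bound)
    show "AE x in P. norm (qn_err T \<Lambda> n x ^ p) \<le> (\<Lambda> * T) ^ p"
      using b by (intro AE_I2) (simp add: power_mono)
  qed measurable
  assume r: "0 \<le> r"
  show "integrable P (\<lambda>x. qn_err T \<Lambda> n x powr r)"
  proof (rule integrable_const_bound)
    show "AE x in P. norm (qn_err T \<Lambda> n x powr r) \<le> (\<Lambda> * T) powr r"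
      using b r by (intro AE_I2) (simp add: powr_mono2)
  qed measurable
qed

lemma qn_Qlim_moment:
  "(\<integral>x. qn_err T \<Lambda> n x ^ (4 * Suc l) \<partial>P) \<le> err_const T \<Lambda> l / (2 ^ n) ^ (2 * Suc l)"
proof -
  obtain A where A: "bracket_process (completion P) (aug_filt T P) T (\<lambda>t x. x t) A \<Lambda>"
    using MLam_bracket_process by blast
  interpret bracket_process "completion P" "aug_filt T P" T "\<lambda>t x. x t" A \<Lambda>
    by (rule A)
  have meas: "(\<lambda>x. qn_err T \<Lambda> n x ^ (4 * Suc l)) \<in> borel_measurable P"
    by (intro borel_measurable_power measurable_qn_Qlim_dist)
  have "(\<integral>x. qn_err T \<Lambda> n x ^ (4 * Suc l) \<partial>P)
      = (\<integral>x. qn_err T \<Lambda> n x ^ (4 * Suc l) \<partial>completion P)"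
    by (rule integral_completion[OF meas, symmetric])
  also have "\<dots> \<le> (\<integral>x. err_var l n x \<partial>completion P)"
  proof (rule integral_mono_AE)
    show "integrable (completion P) (\<lambda>x. qn_err T \<Lambda> n x ^ (4 * Suc l))"
      using integrable_qn_Qlim_dist(1) integrable_completion[OF meas] by blast
    show "integrable (completion P) (err_var l n)" by (rule err_var_integrable[OF T])
    show "AE x in completion P. qn_err T \<Lambda> n x ^ (4 * Suc l) \<le> err_var l n x"
      using Qlim_bracket[OF T] qn_bracket_error[OF T, of n l]
    proof eventually_elim
      case (elim x)
      show ?case by (rule mdist_qn_Qlim_power_le[OF T Lam]) (use elim in auto)
    qed
  qed
  also have "\<dots> \<le> err_const T \<Lambda> l / (2 ^ n) ^ (2 * Suc l)"
    by (rule err_var_integral[OF T])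
  finally show ?thesis .
qed

lemma increment_fourth_moment:
  assumes st: "0 \<le> s" "s \<le> t" "t \<le> T"
  shows "integrable P (\<lambda>x. (x t - x s) ^ 4)" "(\<integral>x. (x t - x s) ^ 4 \<partial>P) \<le> gauss_moment 2 * (\<Lambda> * (t - s))\<^sup>2"
proof -
  obtain A where A: "bracket_process (completion P) (aug_filt T P) T (\<lambda>t x. x t) A \<Lambda>"
    using MLam_bracket_process by blast
  interpret bracket_process "completion P" "aug_filt T P" T "\<lambda>t x. x t" A \<Lambda>
    by (rule A)
  have meas: "(\<lambda>x. (x t - x s) ^ 4) \<in> borel_measurable P"
    by (intro borel_measurable_power borel_measurable_diff measurable_MLam measurable_eval[OF T]) (use st in auto)
  have "integrable (completion P) (\<lambda>x. (x t - x s) ^ 4)"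
    "(\<integral>x. (x t - x s) ^ 4 \<partial>completion P) \<le> gauss_moment 2 * (\<Lambda> * (t - s))\<^sup>2"
    using weighted_moment[OF st borel_measurable_const, of 1 1 2]
    by (simp_all add: prob_space.prob_space[OF prob_space_MLam])
  then show "integrable P (\<lambda>x. (x t - x s) ^ 4)" "(\<integral>x. (x t - x s) ^ 4 \<partial>P) \<le> gauss_moment 2 * (\<Lambda> * (t - s))\<^sup>2"
    using integrable_completion[OF meas] integral_completion[OF meas] by simp_all
qed

text \<open>With \<open>b = 2 powr (- real n / 2)\<close> and \<open>u = d x / b\<close>, one has
  \<open>u powr r \<le> 1 + u ^ p\<close> because \<open>r \<le> p\<close>. The moment bound of
  order \<open>p\<close> is exactly \<open>err_const T \<Lambda> l * b ^ p\<close>, so after scaling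
  the constant is free of \<open>n\<close>.\<close>

lemma qn_Qlim_Lr:
  assumes r: "2 \<le> r" "r \<le> real (4 * Suc l)"
  shows "(\<integral>x. qn_err T \<Lambda> n x powr r \<partial>P) powr (1 / r)
    \<le> (1 + err_const T \<Lambda> l) powr (1 / r) * 2 powr (- real n / 2)"
proof -
  interpret prob_space P
    by (rule prob_space_MLam)
  define d where "d = (\<lambda>x. qn_err T \<Lambda> n x)"
  define b :: real where "b = 2 powr (- real n / 2)"
  define p where "p = 4 * Suc l"
  have b: "0 < b" by (simp add: b_def)
  have bp: "b ^ p = 1 / (2 ^ n) ^ (2 * Suc l)"
  proof -
    have "b ^ p = 2 powr (- real n / 2 * real p)" by (simp add: b_def powr_powr flip: powr_realpow)
    also have "- real n / 2 * real p = - real (n * (2 * Suc l))"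
      by (simp add: p_def algebra_simps add_divide_distrib)
    also have "2 powr (- real (n * (2 * Suc l))) = 1 / (2::real) ^ (n * (2 * Suc l))"
      by (subst powr_minus_divide, subst powr_realpow) simp_all
    finally show ?thesis by (simp only: power_mult[of _ n])
  qed
  have d0: "0 \<le> d x" for x
    unfolding d_def by simp
  have le: "d x powr r \<le> b powr r * (1 + d x ^ p / b ^ p)" for x
  proof -
    have "(d x / b) powr r \<le> 1 + (d x / b) ^ p"
    proof (cases "d x / b \<le> 1")
      case True
      then have "(d x / b) powr r \<le> 1 powr r"
        using d0[of x] b r by (intro powr_mono2) auto
      then show ?thesis
        using d0[of x] b by (simp add: add_increasing2)
    next
      case False
      then have "(d x / b) powr r \<le> (d x / b) powr (real p)"
        using r by (intro powr_mono) (auto simp: p_def)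
      also have "\<dots> = (d x / b) ^ p"
        using False by (intro powr_realpow) simp
      finally show ?thesis by simp
    qed
    then have "b powr r * (d x / b) powr r \<le> b powr r * (1 + (d x / b) ^ p)"
      by (intro mult_left_mono) auto
    moreover have "b powr r * (d x / b) powr r = d x powr r"
      using b d0[of x] by (simp flip: powr_mult)
    ultimately show ?thesis by (simp add: power_divide)
  qed
  have int: "integrable P (\<lambda>x. d x ^ p)"
    unfolding d_def by (rule integrable_qn_Qlim_dist(1))
  have "(\<integral>x. d x powr r \<partial>P) \<le> (\<integral>x. b powr r * (1 + d x ^ p / b ^ p) \<partial>P)"
    using int le r unfolding d_def by (intro integral_mono integrable_qn_Qlim_dist(2)) auto
  also have "\<dots> = b powr r * (1 + (\<integral>x. d x ^ p \<partial>P) / b ^ p)"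
    using int by (simp add: prob_space)
  also have "\<dots> \<le> b powr r * (1 + err_const T \<Lambda> l)"
  proof -
    have "(\<integral>x. d x ^ p \<partial>P) / b ^ p \<le> (err_const T \<Lambda> l / (2 ^ n) ^ (2 * Suc l)) / b ^ p"
      using qn_Qlim_moment[of n l] b unfolding d_def p_def by (intro divide_right_mono) auto
    also have "\<dots> = err_const T \<Lambda> l" by (simp add: bp)
    finally show ?thesis by (intro mult_left_mono add_left_mono) auto
  qed
  finally have "(\<integral>x. d x powr r \<partial>P) powr (1 / r) \<le> (b powr r * (1 + err_const T \<Lambda> l)) powr (1 / r)"
    using r by (intro powr_mono2 integral_nonneg_AE) auto
  also have "\<dots> = (b powr r) powr (1 / r) * (1 + err_const T \<Lambda> l) powr (1 / r)"
    by (rule powr_mult)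
  also have "(b powr r) powr (1 / r) = b"
    using b r by (simp add: powr_powr)
  finally show ?thesis by (simp add: d_def b_def mult.commute)
qed

end

end

section \<open>Compact sets of paths\<close>

text \<open>The factor 10 is 1 / (1 - 9/10). The induction carries the difference of two powers,
  which telescopes; the subtracted power is dropped at the end.\<close>

lemma geometric_increments_bound:
  fixes y :: "nat \<Rightarrow> real"
  assumes c: "0 \<le> c" and step: "\<And>m. \<bar>y (Suc m) - y m\<bar> \<le> c * (9/10) ^ m"
  shows "\<bar>y (m + n) - y n\<bar> \<le> 10 * c * (9/10) ^ n"
proof -
  have "\<bar>y (m + n) - y n\<bar> \<le> 10 * c * ((9/10) ^ n - (9/10) ^ (m + n))"
  proof (induction m)
    case (Suc m)
    have "\<bar>y (Suc m + n) - y n\<bar> \<le> \<bar>y (Suc (m + n)) - y (m + n)\<bar> + \<bar>y (m + n) - y n\<bar>"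
      by simp
    also have "\<dots> \<le> c * (9/10) ^ (m + n) + 10 * c * ((9/10) ^ n - (9/10) ^ (m + n))"
      by (intro add_mono step Suc.IH)
    also have "\<dots> = 10 * c * ((9/10) ^ n - (9/10) ^ (Suc m + n))" by (simp add: algebra_simps)
    finally show ?case .
  qed simp
  moreover have "0 \<le> 10 * c * (9/10) ^ (m + n)"
    using c by simp
  ultimately show ?thesis
    unfolding right_diff_distrib by linarith
qed

context
  fixes T :: real
  assumes T: "0 < T"
begin

lemma dyad_floor_Suc:
  assumes t: "t \<in> {0..T}"
  shows "dyad_floor T (Suc n) t = 2 * dyad_floor T n t \<or> dyad_floor T (Suc n) t = Suc (2 * dyad_floor T n t)"
proof -
  have dbl: "tdyad T (Suc n) (2 * k) = tdyad T n k" for k by (simp add: tdyad_def)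
  have iff: "tdyad T m k \<le> t \<longleftrightarrow> k \<le> dyad_floor T m t" for m k
    by (rule tdyad_le_iff[OF T]) (use t in simp)
  have "2 * dyad_floor T n t \<le> dyad_floor T (Suc n) t"
    unfolding iff[symmetric] dbl unfolding iff by simp
  moreover have "\<not> 2 * Suc (dyad_floor T n t) \<le> dyad_floor T (Suc n) t"
    unfolding iff[symmetric] dbl unfolding iff by simp
  ultimately show ?thesis by arith
qed

text \<open>From one level to the next the left dyadic neighbour of \<open>t\<close> stays or moves
  by one interval of the finer level, so each level costs one increment; continuity identifies the
  limit of the chain.\<close>

lemma dyadic_chaining:
  fixes x :: path
  assumes x: "continuous_on {0..T} x" and c: "0 \<le> c"
    and incr: "\<And>n k. k < 2 ^ n \<Longrightarrow> \<bar>x (tdyad T n (Suc k)) - x (tdyad T n k)\<bar> \<le> c * (9/10) ^ n"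
    and t: "t \<in> {0..T}"
  shows "\<bar>x t - x (tdyad T n (dyad_floor T n t))\<bar> \<le> 10 * c * (9/10) ^ n"
proof -
  define y where "y = (\<lambda>n. x (tdyad T n (dyad_floor T n t)))"
  have step: "\<bar>y (Suc m) - y m\<bar> \<le> (c * (9/10)) * (9/10) ^ m" for m
  proof -
    have dbl: "tdyad T (Suc m) (2 * k) = tdyad T m k" for k by (simp add: tdyad_def)
    show ?thesis
    proof (cases "dyad_floor T (Suc m) t = 2 * dyad_floor T m t")
      case True
      then show ?thesis
        using c by (simp add: y_def dbl)
    next
      case False
      then have eq: "dyad_floor T (Suc m) t = Suc (2 * dyad_floor T m t)"
        using dyad_floor_Suc[OF t, of m] by simp
      then have "2 * dyad_floor T m t < 2 ^ Suc m"
        using dyad_floor_le[OF T t, of "Suc m"] by simp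
      from incr[OF this] show ?thesis
        unfolding y_def eq dbl by (simp add: mult.assoc)
    qed
  qed
  have far: "\<bar>y (m + n) - y n\<bar> \<le> 10 * c * (9/10) ^ n" for m
  proof -
    have "\<bar>y (m + n) - y n\<bar> \<le> 10 * (c * (9/10)) * (9/10) ^ n"
      by (rule geometric_increments_bound[OF _ step]) (use c in simp)
    also have "\<dots> \<le> 10 * c * (9/10) ^ n"
      using c by (intro mult_right_mono) auto
    finally show ?thesis .
  qed
  have in_T: "\<forall>\<^sub>F n in sequentially. tdyad T n (dyad_floor T n t) \<in> {0..T}"
    using tdyad_floor_in[OF T t] by simp
  have "y \<longlonglongrightarrow> x t"
    unfolding y_def by (rule continuous_on_tendsto_compose[OF x tdyad_floor_tendsto[OF T t] t in_T])
  from LIMSEQ_ignore_initial_segment[OF this, of n]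
  have "(\<lambda>m. \<bar>y (m + n) - y n\<bar>) \<longlonglongrightarrow> \<bar>x t - y n\<bar>"
    by (intro tendsto_intros)
  then have "\<bar>x t - y n\<bar> \<le> 10 * c * (9/10) ^ n"
    by (rule LIMSEQ_le_const2) (use far in auto)
  then show ?thesis by (simp only: y_def)
qed

text \<open>Points closer than one mesh width have equal or adjacent left neighbours at level
  \<open>n\<close>. Two chains cost 10 each and the step between the neighbours costs 1, hence
  21.\<close>

lemma dyadic_modulus:
  fixes x :: path
  assumes x: "continuous_on {0..T} x" and c: "0 \<le> c"
    and incr: "\<And>n k. k < 2 ^ n \<Longrightarrow> \<bar>x (tdyad T n (Suc k)) - x (tdyad T n k)\<bar> \<le> c * (9/10) ^ n"
    and st: "s \<in> {0..T}" "t \<in> {0..T}" "\<bar>s - t\<bar> < T / 2 ^ n"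
  shows "\<bar>x s - x t\<bar> \<le> 21 * c * (9/10) ^ n"
proof -
  have *: "\<bar>x s - x t\<bar> \<le> 21 * c * (9/10) ^ n" if st: "s \<in> {0..T}" "t \<in> {0..T}" "s \<le> t" "t - s < T / 2 ^ n" for s t
  proof -
    define j k where "j = dyad_floor T n s" and "k = dyad_floor T n t"
    have iff: "tdyad T n i \<le> r \<longleftrightarrow> i \<le> dyad_floor T n r" if "r \<in> {0..T}" for r i
      by (rule tdyad_le_iff[OF T]) (use that in simp)
    have "tdyad T n j \<le> s"
      unfolding j_def by (rule tdyad_floor(1)[OF T st(1)])
    then have jk: "j \<le> k"
      using iff[OF st(2), of j] st(3) by (simp add: k_def)
    have "t < tdyad T n (Suc (Suc j))"
      using tdyad_floor(2)[OF T st(1), of n] st(4) tdyad_diff[of T n j] tdyad_diff[of T n "Suc j"]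
      unfolding j_def[symmetric] by linarith
    then have "k < Suc (Suc j)"
      using iff[OF st(2), of "Suc (Suc j)"] by (simp add: k_def not_le)
    then consider "k = j" | "k = Suc j"
      using jk by linarith
    then have "\<bar>x (tdyad T n k) - x (tdyad T n j)\<bar> \<le> c * (9/10) ^ n"
    proof cases
      case 2
      then have "j < 2 ^ n"
        using dyad_floor_le[OF T st(2), of n] by (simp add: k_def)
      from incr[OF this] show ?thesis
        unfolding 2 .
    qed (use c in simp)
    then show ?thesis
      using dyadic_chaining[OF x c incr st(1), of n] dyadic_chaining[OF x c incr st(2), of n]
      unfolding j_def[symmetric] k_def[symmetric] by linarith
  qed
  show ?thesis
    using *[of s t] *[of t s] st by (cases "s \<le> t") (auto simp: abs_minus_commute)
qed

end

text \<open>The rate \<open>9/10\<close> is any number below \<open>1\<close> whose fourth power exceeds \<open>1/2\<close>: the fourth moments then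
  make the exceptional probabilities summable over \<open>n\<close> and \<open>k < 2 ^ n\<close>.\<close>

definition good_paths :: "real \<Rightarrow> real \<Rightarrow> nat \<Rightarrow> path set" where
  "good_paths T \<Lambda> R = {x \<in> mspace (Omega T).
     (\<forall>n. \<forall>k<2 ^ n. \<bar>x (tdyad T n (Suc k)) - x (tdyad T n k)\<bar> \<le> real R * (9/10) ^ n) \<and>
     (\<forall>n. mdist (cpaths T) (qn T \<Lambda> n x) (qn T \<Lambda> (Suc n) x) \<le> real R * (9/10) ^ n)}"

lemma good_paths_mono:
  assumes "R \<le> R'"
  shows "good_paths T \<Lambda> R \<subseteq> good_paths T \<Lambda> R'"
proof -
  have "real R * (9/10) ^ n \<le> real R' * (9/10) ^ n" for n
    using assms by (intro mult_right_mono) auto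
  then show ?thesis
    unfolding good_paths_def by (blast intro: order_trans)
qed

context
  fixes T \<Lambda> :: real
  assumes T: "0 < T" and Lam: "0 \<le> \<Lambda>"
begin

text \<open>The defining conditions compare consecutive \<open>qn\<close> instead of
  \<open>qn\<close> with \<open>Qlim\<close>: the former are continuous on the whole path space,
  whereas continuity of \<open>Qlim\<close> is what these sets are meant to produce.\<close>

lemma good_paths_closedin: "closedin (mtopology_of (cpaths T)) (good_paths T \<Lambda> R)"
proof -
  define X where "X = mtopology_of (cpaths T)"
  have ev: "continuous_map X euclideanreal (\<lambda>x. x t)" if "t \<in> {0..T}" for t
    unfolding X_def by (rule continuous_map_eval[OF T that])
  have td: "tdyad T n k \<in> {0..T}" if "k \<le> 2 ^ n" for n k
    using tdyad_bounds[of T] T that by auto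
  define I where "I n k = {x \<in> topspace X. k < 2 ^ n \<longrightarrow> \<bar>x (tdyad T n (Suc k)) - x (tdyad T n k)\<bar> \<le> real R * (9/10) ^ n}" for n k
  define J where "J n = {x \<in> topspace X. mdist (cpaths T) (qn T \<Lambda> n x) (qn T \<Lambda> (Suc n) x) \<le> real R * (9/10) ^ n}" for n
  have I: "closedin X (I n k)" for n k
  proof (cases "k < 2 ^ n")
    case True
    have "closedin X {x \<in> topspace X. \<bar>x (tdyad T n (Suc k)) - x (tdyad T n k)\<bar> \<le> real R * (9/10) ^ n}"
      by (intro closedin_le continuous_map_real_abs continuous_map_diff ev td continuous_map_canonical_const)
        (use True in auto)
    then show ?thesis
      using True by (simp add: I_def)
  qed (simp add: I_def)
  have J: "closedin X (J n)" for n
    unfolding J_def X_def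
    by (intro closedin_le continuous_map_mdist continuous_map_qn[OF T Lam] continuous_map_canonical_const)
  have "good_paths T \<Lambda> R = {x \<in> topspace X. x 0 \<le> 0} \<inter> {x \<in> topspace X. 0 \<le> x 0} \<inter> (\<Inter>n. \<Inter>k. I n k) \<inter> (\<Inter>n. J n)"
    unfolding good_paths_def mspace_Omega[OF T] I_def J_def X_def by auto
  also have "closedin X \<dots>"
    by (intro closedin_Int closedin_INT closedin_le ev continuous_map_canonical_const I J) (use T in auto)
  finally show ?thesis by (simp add: X_def)
qed

lemma good_paths_cpaths: "x \<in> good_paths T \<Lambda> R \<Longrightarrow> continuous_on {0..T} x"
  by (simp add: good_paths_def mspace_Omega[OF T] mspace_cpaths)

lemma good_paths_modulus:
  assumes "x \<in> good_paths T \<Lambda> R" "s \<in> {0..T}" "t \<in> {0..T}" "\<bar>s - t\<bar> < T / 2 ^ n"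
  shows "\<bar>x s - x t\<bar> \<le> 21 * real R * (9/10) ^ n"
  by (rule dyadic_modulus[OF T good_paths_cpaths[OF assms(1)] _ _ assms(2-4)])
    (use assms(1) in \<open>auto simp: good_paths_def\<close>)

lemma good_paths_compact: "compactin (mtopology_of (Omega T)) (good_paths T \<Lambda> R)"
proof -
  have "compactin (mtopology_of (cpaths T)) (good_paths T \<Lambda> R)"
  proof (rule compactin_cpathsI[OF T good_paths_closedin])
    fix x t assume x: "x \<in> good_paths T \<Lambda> R" and t: "t \<in> {0..T}"
    have incr: "\<bar>x (tdyad T n (Suc k)) - x (tdyad T n k)\<bar> \<le> real R * (9/10) ^ n" if "k < 2 ^ n" for n k
      using x that by (simp add: good_paths_def)
    have x0: "x 0 = 0"
      using x by (simp add: good_paths_def mspace_Omega[OF T])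
    \<comment> \<open>At level 0 the left neighbour is 0, or \<open>T\<close> if
      \<open>t = T\<close>. As the path starts at 0, its value there is at most \<open>R\<close>;
      the chain adds \<open>10 * R\<close>, whence 11.\<close>
    have "dyad_floor T 0 t = 0 \<or> dyad_floor T 0 t = Suc 0"
      using dyad_floor_le[OF T t, of 0] by auto
    then have "\<bar>x (tdyad T 0 (dyad_floor T 0 t))\<bar> \<le> real R"
      using incr[of 0 0] x0 by (auto simp: tdyad_0)
    then show "\<bar>x t\<bar> \<le> 11 * real R"
      using dyadic_chaining[OF T good_paths_cpaths[OF x] _ incr t, of 0] by simp
  next
    fix e :: real assume e: "0 < e"
    have "(\<lambda>n. 21 * real R * (9/10) ^ n) \<longlonglongrightarrow> 21 * real R * 0"
      by (intro tendsto_intros LIMSEQ_realpow_zero) auto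
    then have "\<forall>\<^sub>F n in sequentially. 21 * real R * (9/10) ^ n < e"
      using e by (intro order_tendstoD) auto
    then obtain n where n: "21 * real R * (9/10) ^ n < e" by (auto simp: eventually_sequentially)
    show "\<exists>d>0. \<forall>x\<in>good_paths T \<Lambda> R. \<forall>s\<in>{0..T}. \<forall>t\<in>{0..T}. \<bar>s - t\<bar> < d \<longrightarrow> \<bar>x s - x t\<bar> < e"
    proof (intro exI[of _ "T / 2 ^ n"] conjI ballI impI)
      fix x s t assume "x \<in> good_paths T \<Lambda> R" "s \<in> {0..T}" "t \<in> {0..T}" "\<bar>s - t\<bar> < T / 2 ^ n"
      from good_paths_modulus[OF this] show "\<bar>x s - x t\<bar> < e"
        using n by simp
    qed (use T in simp)
  qed
  moreover have "good_paths T \<Lambda> R \<subseteq> {x. x 0 = 0}"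
    by (auto simp: good_paths_def mspace_Omega[OF T])
  ultimately show ?thesis by (simp add: Omega_topology[OF T] compactin_subtopology)
qed

lemma qn_cpaths: "qn T \<Lambda> n x \<in> mspace (cpaths T)" and Qlim_cpaths: "Qlim T \<Lambda> x \<in> mspace (cpaths T)"
  using Abr_cpaths[OF qn_in_Abr[OF T Lam]] Abr_cpaths[OF Qlim_in_Abr[OF T Lam]] by auto

text \<open>No probability enters: the geometric rate makes the differences of consecutive
  \<open>qn\<close> summable at every \<open>t\<close>, so on these paths the limsup is a limit and
  the tail of the series bounds the error.\<close>

lemma good_paths_uniform:
  assumes x: "x \<in> good_paths T \<Lambda> R"
  shows "qn_err T \<Lambda> n x \<le> 10 * real R * (9/10) ^ n"
proof (subst mdist_cpaths_le_iff[OF _ qn_cpaths Qlim_cpaths])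
  show "\<forall>t\<in>{0..T}. \<bar>qn T \<Lambda> n x t - Qlim T \<Lambda> x t\<bar> \<le> 10 * real R * (9/10) ^ n"
  proof
    fix t assume t: "t \<in> {0..T}"
    define y where "y = (\<lambda>n. qn T \<Lambda> n x t)"
    have step: "\<bar>y (Suc m) - y m\<bar> \<le> real R * (9/10) ^ m" for m
    proof -
      have "\<bar>y (Suc m) - y m\<bar> \<le> mdist (cpaths T) (qn T \<Lambda> m x) (qn T \<Lambda> (Suc m) x)"
        using abs_diff_le_mdist[OF _ qn_cpaths qn_cpaths t, of m x "Suc m" x] T by (simp add: y_def abs_minus_commute)
      also have "\<dots> \<le> real R * (9/10) ^ m"
        using x by (simp add: good_paths_def)
      finally show ?thesis .
    qed
    have "summable (\<lambda>m. y (Suc m) - y m)"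
    proof (rule summable_comparison_test)
      show "\<exists>N. \<forall>m\<ge>N. norm (y (Suc m) - y m) \<le> real R * (9/10) ^ m"
        using step by simp
      show "summable (\<lambda>m. real R * (9/10::real) ^ m)"
        by (intro summable_mult summable_geometric) simp
    qed
    then obtain l where "(\<lambda>m. \<Sum>i<m. y (Suc i) - y i) \<longlonglongrightarrow> l"
      by (auto simp: summable_def sums_def)
    then have "(\<lambda>m. (\<Sum>i<m. y (Suc i) - y i) + y 0) \<longlonglongrightarrow> l + y 0"
      by (intro tendsto_intros)
    then have lim: "y \<longlonglongrightarrow> l + y 0"
      unfolding sum_lessThan_telescope by simp
    then have Q: "Qlim T \<Lambda> x t = l + y 0"
      unfolding y_def by (rule Qlim_eq_lim[OF T Lam t])
    have far: "\<bar>y (m + n) - y n\<bar> \<le> 10 * real R * (9/10) ^ n" for m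
      by (rule geometric_increments_bound[OF _ step]) simp
    have "(\<lambda>m. \<bar>y (m + n) - y n\<bar>) \<longlonglongrightarrow> \<bar>(l + y 0) - y n\<bar>"
      by (intro tendsto_intros LIMSEQ_ignore_initial_segment lim)
    then have "\<bar>(l + y 0) - y n\<bar> \<le> 10 * real R * (9/10) ^ n"
      by (rule LIMSEQ_le_const2) (use far in auto)
    then show "\<bar>qn T \<Lambda> n x t - Qlim T \<Lambda> x t\<bar> \<le> 10 * real R * (9/10) ^ n"
      unfolding Q by (simp add: y_def abs_minus_commute)
  qed
qed (use T in simp)

lemma good_paths_eventually:
  assumes e: "0 < e"
  shows "\<forall>\<^sub>F n in sequentially. \<forall>x\<in>good_paths T \<Lambda> R. qn_err T \<Lambda> n x < e"
proof -
  have "(\<lambda>n. 10 * real R * (9/10) ^ n) \<longlonglongrightarrow> 10 * real R * 0"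
    by (intro tendsto_intros LIMSEQ_realpow_zero) auto
  then have "\<forall>\<^sub>F n in sequentially. 10 * real R * (9/10) ^ n < e"
    using e by (intro order_tendstoD) auto
  then show ?thesis
    by eventually_elim (use good_paths_uniform in \<open>blast intro: le_less_trans\<close>)
qed

lemma good_paths_continuous:
  "continuous_map (subtopology (mtopology_of (Omega T)) (good_paths T \<Lambda> R)) (mtopology_of (cpaths T)) (Qlim T \<Lambda>)"
proof -
  interpret C: Metric_space "mspace (cpaths T)" "mdist (cpaths T)"
    by (rule Metric_space_mspace_mdist)
  have top: "mtopology_of (cpaths T) = C.mtopology" by (simp add: mtopology_of_def)
  show ?thesis
    unfolding top
  proof (rule C.continuous_map_uniform_limit)
    show "\<forall>\<^sub>F n in sequentially. continuous_map (subtopology (mtopology_of (Omega T)) (good_paths T \<Lambda> R)) C.mtopology (qn T \<Lambda> n)"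
      unfolding Omega_topology[OF T] top[symmetric]
      by (intro always_eventually allI continuous_map_from_subtopology continuous_map_qn[OF T Lam])
    fix e :: real assume "0 < e"
    from good_paths_eventually[OF this, of R]
    show "\<forall>\<^sub>F n in sequentially. \<forall>x\<in>topspace (subtopology (mtopology_of (Omega T)) (good_paths T \<Lambda> R)).
        Qlim T \<Lambda> x \<in> mspace (cpaths T) \<and> qn_err T \<Lambda> n x < e"
      by eventually_elim (use Qlim_cpaths in auto)
  qed simp
qed

end

section \<open>Uniform tightness and the rate in the mean of order r\<close>

definition tight_const :: "real \<Rightarrow> real \<Rightarrow> real" where
  "tight_const T \<Lambda> = gauss_moment 2 * (\<Lambda> * T)\<^sup>2 + 32 * err_const T \<Lambda> 0"

context
  fixes T \<Lambda> :: real
  assumes T: "0 < T" and Lam: "0 \<le> \<Lambda>"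
begin

lemma err_const_nonneg: "0 \<le> err_const T \<Lambda> l"
  unfolding err_const_def using T Lam
  by (intro mult_nonneg_nonneg zero_le_power[of "\<Lambda> * T"] zero_le_power[of 2] add_nonneg_nonneg) auto

text \<open>Markov's inequality for fourth powers at every level. The \<open>2 ^ n\<close>
  increments have fourth moments O(4^-n) and the threshold is
  \<open>R ^ 4 * (6561 / 10000) ^ n\<close>, so level \<open>n\<close> contributes a term with ratio
  (2/4) / (6561/10000) = 5000/6561, which is below 1.\<close>

lemma emeasure_good_paths_compl:
  assumes P: "P \<in> MLam T \<Lambda>" and R: "1 \<le> R"
  shows "emeasure P (mspace (Omega T) - good_paths T \<Lambda> R) \<le> ennreal (6561 / 1561 * tight_const T \<Lambda> / real R ^ 4)"
proof -
  interpret prob_space P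
    by (rule prob_space_MLam[OF T Lam P])
  define c where "c = (\<lambda>n. (real R * (9/10) ^ n) ^ 4)"
  define B where "B = (\<lambda>n k. {x \<in> space P. c n \<le> (x (tdyad T n (Suc k)) - x (tdyad T n k)) ^ 4})"
  define d where "d = (\<lambda>n x. mdist (cpaths T) (qn T \<Lambda> n x) (qn T \<Lambda> (Suc n) x))"
  define D where "D = (\<lambda>n. {x \<in> space P. c n \<le> d n x ^ 4})"
  define E where "E = (\<lambda>n. (\<Union>k\<in>{..<2 ^ n}. B n k) \<union> D n)"
  have c: "0 < c n" for n
    using R by (simp add: c_def)
  have td: "0 \<le> tdyad T n k" "tdyad T n k \<le> tdyad T n (Suc k)" "tdyad T n (Suc k) \<le> T" if "k < 2 ^ n" for n k
    using tdyad_bounds(1)[of T n k] tdyad_bounds(2)[of T "Suc k" n] tdyad_mono[of T k "Suc k" n] T that by auto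
  note moment = increment_fourth_moment[OF T Lam P td]
  have Bm: "B n k \<in> sets P" if "k < 2 ^ n" for n k
  proof -
    have [measurable]: "(\<lambda>x. (x (tdyad T n (Suc k)) - x (tdyad T n k)) ^ 4) \<in> borel_measurable P"
      by (rule borel_measurable_integrable[OF moment(1)[OF that that that]])
    show ?thesis
      unfolding B_def by measurable
  qed
  have dm: "d n \<in> borel_measurable P" for n
    unfolding d_def
    by (intro measurable_MLam[OF T Lam P] measurable_mdist_cpaths[OF T] qn_cpaths[OF T Lam] measurable_qn_eval[OF T Lam])
  have d4: "(\<lambda>x. d n x ^ 4) \<in> borel_measurable P" for n
    by (rule borel_measurable_power[OF dm])
  have Dm: "D n \<in> sets P" for n
  proof -
    note [measurable] = d4[of n]
    show ?thesis
      unfolding D_def by measurable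
  qed
  have Em: "E n \<in> sets P" for n
    unfolding E_def by (intro sets.Un sets.finite_UN) (use Bm Dm in auto)
  have B_le: "emeasure P (B n k) \<le> ennreal (gauss_moment 2 * (\<Lambda> * T)\<^sup>2 / 4 ^ n / c n)" if k: "k < 2 ^ n" for n k
  proof -
    note m = moment[OF k k k]
    have "emeasure P (B n k) \<le> ennreal ((1 / c n) * (\<integral>x. (x (tdyad T n (Suc k)) - x (tdyad T n k)) ^ 4 \<partial>P))"
      unfolding B_def by (rule integral_Markov_inequality[OF m(1) _ c]) simp
    also have "\<dots> \<le> ennreal ((1 / c n) * (gauss_moment 2 * (\<Lambda> * T)\<^sup>2 / 4 ^ n))"
    proof (intro ennreal_leI mult_left_mono)
      have "(2::real) ^ n * 2 ^ n = 4 ^ n" by (simp flip: power_mult_distrib)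
      then have "(\<Lambda> * (T / 2 ^ n))\<^sup>2 = (\<Lambda> * T)\<^sup>2 / 4 ^ n"
        by (simp add: power2_eq_square)
      then show "(\<integral>x. (x (tdyad T n (Suc k)) - x (tdyad T n k)) ^ 4 \<partial>P) \<le> gauss_moment 2 * (\<Lambda> * T)\<^sup>2 / 4 ^ n"
        using m(2) by (simp add: tdyad_diff)
    qed (use c[of n] in simp)
    finally show ?thesis by (simp add: mult.commute)
  qed
  have D_le: "emeasure P (D n) \<le> ennreal (32 * err_const T \<Lambda> 0 / 4 ^ n / c n)" for n
  proof -
    define a where "a = (\<lambda>n x. qn_err T \<Lambda> n x)"
    have ai: "integrable P (\<lambda>x. a n x ^ 4)" for n
      unfolding a_def by (rule integrable_qn_Qlim_dist(1)[OF T Lam P])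
    have pow4: "((2::real) ^ n) ^ (2 * Suc 0) = 4 ^ n" for n
      by (simp add: power2_eq_square flip: power_mult_distrib)
    have am: "(\<integral>x. a n x ^ 4 \<partial>P) \<le> err_const T \<Lambda> 0 / 4 ^ n" for n
      using qn_Qlim_moment[OF T Lam P, of n 0] unfolding a_def pow4 by simp
    have d_le: "d n x ^ 4 \<le> 16 * (a n x ^ 4 + a (Suc n) x ^ 4)" for x
    proof -
      have "d n x \<le> a n x + a (Suc n) x"
        unfolding d_def a_def
        using Metric_space.triangle'[OF Metric_space_mspace_mdist, OF qn_cpaths[OF T Lam] Qlim_cpaths[OF T Lam] qn_cpaths[OF T Lam]]
        by (simp add: Metric_space.commute[OF Metric_space_mspace_mdist])
      then have "d n x ^ 4 \<le> \<bar>a n x + a (Suc n) x\<bar> ^ 4"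
        by (intro power_mono) (auto simp: d_def)
      also have "\<dots> \<le> 2 ^ 4 * (\<bar>a n x\<bar> ^ 4 + \<bar>a (Suc n) x\<bar> ^ 4)"
        by (rule abs_add_power_le)
      finally show ?thesis by simp
    qed
    have di: "integrable P (\<lambda>x. d n x ^ 4)"
    proof (rule Bochner_Integration.integrable_bound[OF _ d4])
      show "integrable P (\<lambda>x. 16 * (a n x ^ 4 + a (Suc n) x ^ 4))"
        using ai by auto
      show "AE x in P. norm (d n x ^ 4) \<le> norm (16 * (a n x ^ 4 + a (Suc n) x ^ 4))"
        using d_le by (intro AE_I2) simp
    qed
    have "(\<integral>x. d n x ^ 4 \<partial>P) \<le> (\<integral>x. 16 * (a n x ^ 4 + a (Suc n) x ^ 4) \<partial>P)"
      using di ai d_le by (intro integral_mono) auto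
    also have "\<dots> = 16 * ((\<integral>x. a n x ^ 4 \<partial>P) + (\<integral>x. a (Suc n) x ^ 4 \<partial>P))"
      using ai by simp
    \<comment> \<open>The error at level \<open>Suc n\<close> is bounded by that at level
      \<open>n\<close>; two errors times the 16 from the fourth power of a sum make the 32 in
      \<open>tight_const\<close>.\<close>
    also have "\<dots> \<le> 16 * (err_const T \<Lambda> 0 / 4 ^ n + err_const T \<Lambda> 0 / 4 ^ n)"
    proof (intro mult_left_mono add_mono am)
      have "err_const T \<Lambda> 0 / 4 ^ Suc n \<le> err_const T \<Lambda> 0 / 4 ^ n"
        using err_const_nonneg[of 0] by (intro divide_left_mono) auto
      then show "(\<integral>x. a (Suc n) x ^ 4 \<partial>P) \<le> err_const T \<Lambda> 0 / 4 ^ n"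
        using am[of "Suc n"] by simp
    qed simp
    finally have int_le: "(\<integral>x. d n x ^ 4 \<partial>P) \<le> 32 * err_const T \<Lambda> 0 / 4 ^ n"
      by simp
    have "emeasure P (D n) \<le> ennreal ((1 / c n) * (\<integral>x. d n x ^ 4 \<partial>P))"
      unfolding D_def by (rule integral_Markov_inequality[OF di _ c]) simp
    also have "\<dots> \<le> ennreal ((1 / c n) * (32 * err_const T \<Lambda> 0 / 4 ^ n))"
      using c[of n] int_le by (intro ennreal_leI mult_left_mono) auto
    finally show ?thesis by (simp add: mult.commute)
  qed
  have E_le: "emeasure P (E n) \<le> ennreal (tight_const T \<Lambda> / real R ^ 4 * (5000 / 6561) ^ n)" for n
  proof -
    define g e where "g = gauss_moment 2 * (\<Lambda> * T)\<^sup>2" and "e = 32 * err_const T \<Lambda> 0"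
    have g0: "0 \<le> g" and e0: "0 \<le> e"
      using gauss_moment_nonneg[of 2] err_const_nonneg[of 0] by (auto simp: g_def e_def)
    have "emeasure P (E n) \<le> emeasure P (\<Union>k\<in>{..<2 ^ n}. B n k) + emeasure P (D n)"
      unfolding E_def by (intro emeasure_subadditive Dm sets.finite_UN) (use Bm in auto)
    also have "\<dots> \<le> (\<Sum>k\<in>{..<2 ^ n}. emeasure P (B n k)) + emeasure P (D n)"
      by (intro add_right_mono emeasure_subadditive_finite) (use Bm in auto)
    also have "\<dots> \<le> (\<Sum>k\<in>{..<2 ^ n :: nat}. ennreal (g / 4 ^ n / c n)) + ennreal (e / 4 ^ n / c n)"
      using B_le D_le unfolding g_def e_def by (intro add_mono sum_mono) auto
    also have "\<dots> = ennreal (2 ^ n * (g / 4 ^ n / c n) + e / 4 ^ n / c n)"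
    proof -
      have y0: "0 \<le> g / 4 ^ n / c n" and w0: "0 \<le> e / 4 ^ n / c n"
        using g0 e0 c[of n] by simp_all
      have "(\<Sum>k\<in>{..<2 ^ n :: nat}. ennreal (g / 4 ^ n / c n)) = ennreal (\<Sum>k\<in>{..<2 ^ n :: nat}. g / 4 ^ n / c n)"
        by (rule sum_ennreal) (rule y0)
      also have "(\<Sum>k\<in>{..<2 ^ n :: nat}. g / 4 ^ n / c n) = 2 ^ n * (g / 4 ^ n / c n)"
        by simp
      finally show ?thesis
        using y0 w0 by (simp only: ennreal_plus[OF mult_nonneg_nonneg[OF zero_le_power[OF zero_le_numeral]]])
    qed
    \<comment> \<open>The factor \<open>2 ^ n\<close> is wasted on the second term so that both
      terms become geometric with the same ratio.\<close>
    also have "\<dots> \<le> ennreal (2 ^ n * (g / 4 ^ n / c n) + 2 ^ n * (e / 4 ^ n / c n))"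
      using e0 c[of n] by (intro ennreal_leI add_left_mono) (simp add: mult_right_mono[of 1 "2 ^ n" "e / 4 ^ n / c n", simplified])
    also have "2 ^ n * (g / 4 ^ n / c n) + 2 ^ n * (e / 4 ^ n / c n) = (g + e) / real R ^ 4 * (5000 / 6561) ^ n"
    proof -
      have c_eq: "c n = real R ^ 4 * (6561 / 10000) ^ n"
      proof -
        have "((9/10 :: real) ^ n) ^ 4 = ((9/10) ^ 4) ^ n"
          by (simp only: power_mult[symmetric] mult.commute)
        then show ?thesis by (simp add: c_def power_mult_distrib power4_eq_xxxx)
      qed
      have "(2::real) ^ n / 4 ^ n / (6561 / 10000) ^ n = (2 / 4 / (6561 / 10000)) ^ n"
        by (simp only: power_divide)
      then have "(2::real) ^ n / 4 ^ n / (6561 / 10000) ^ n = (5000 / 6561) ^ n" by simp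
      moreover have "2 ^ n * (g / 4 ^ n / c n) + 2 ^ n * (e / 4 ^ n / c n)
        = (g + e) / real R ^ 4 * (2 ^ n / 4 ^ n / (6561 / 10000) ^ n)"
        unfolding c_eq by (simp only: divide_inverse inverse_mult_distrib) (simp add: algebra_simps)
      ultimately show ?thesis by simp
    qed
    finally show ?thesis by (simp only: tight_const_def g_def e_def)
  qed
  have "mspace (Omega T) - good_paths T \<Lambda> R \<subseteq> (\<Union>n. E n)"
  proof
    fix x assume x: "x \<in> mspace (Omega T) - good_paths T \<Lambda> R"
    then have xP: "x \<in> space P" by (simp add: space_MLam[OF T Lam P])
    have pow: "c n \<le> y ^ 4" if "real R * (9/10) ^ n < \<bar>y\<bar>" for n y
      using power_mono[of "real R * (9/10) ^ n" "\<bar>y\<bar>" 4] that by (simp add: c_def)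
    consider n k where "k < 2 ^ n" "real R * (9/10) ^ n < \<bar>x (tdyad T n (Suc k)) - x (tdyad T n k)\<bar>"
      | n where "real R * (9/10) ^ n < d n x"
      using x unfolding good_paths_def d_def by (auto simp: not_le)
    then show "x \<in> (\<Union>n. E n)"
    proof cases
      case (1 n k)
      then have "x \<in> B n k"
        using xP pow by (simp add: B_def)
      then show ?thesis
        using 1 by (auto simp: E_def)
    next
      case (2 n)
      have "0 \<le> d n x" by (simp add: d_def)
      then have "x \<in> D n"
        using xP pow[of n "d n x"] 2 by (simp add: D_def)
      then show ?thesis by (auto simp: E_def)
    qed
  qed
  then have "emeasure P (mspace (Omega T) - good_paths T \<Lambda> R) \<le> emeasure P (\<Union>n. E n)"
    by (rule emeasure_mono) (use Em in auto)
  also have "\<dots> \<le> (\<Sum>n. emeasure P (E n))"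
    by (rule emeasure_subadditive_countably) (use Em in auto)
  also have "\<dots> \<le> (\<Sum>n. ennreal (tight_const T \<Lambda> / real R ^ 4 * (5000 / 6561) ^ n))"
    by (intro suminf_le E_le) auto
  also have "\<dots> = ennreal (\<Sum>n. tight_const T \<Lambda> / real R ^ 4 * (5000 / 6561) ^ n)"
  proof (rule suminf_ennreal2)
    have "0 \<le> tight_const T \<Lambda>"
      using err_const_nonneg[of 0] gauss_moment_nonneg[of 2] by (simp add: tight_const_def)
    then show "0 \<le> tight_const T \<Lambda> / real R ^ 4 * (5000 / 6561) ^ n" for n by simp
    show "summable (\<lambda>n. tight_const T \<Lambda> / real R ^ 4 * (5000 / 6561) ^ n)"
      by (intro summable_mult summable_geometric) simp
  qed
  \<comment> \<open>The prefactor 6561/1561 is 1 / (1 - 5000/6561).\<close>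
  also have "(\<Sum>n. tight_const T \<Lambda> / real R ^ 4 * (5000 / 6561) ^ n) = 6561 / 1561 * tight_const T \<Lambda> / real R ^ 4"
    by (subst suminf_mult) (auto simp: summable_geometric suminf_geometric)
  finally show ?thesis .
qed

lemma good_paths_tight:
  "(\<lambda>R. SUP P\<in>MLam T \<Lambda>. emeasure P (mspace (Omega T) - good_paths T \<Lambda> R)) \<longlonglongrightarrow> 0"
proof (rule tendsto_sandwich)
  show "\<forall>\<^sub>F R in sequentially. 0 \<le> (SUP P\<in>MLam T \<Lambda>. emeasure P (mspace (Omega T) - good_paths T \<Lambda> R))"
    by simp
  \<comment> \<open>For \<open>R = 0\<close> the threshold in Markov's inequality would be 0, so the
    estimate starts at \<open>R = 1\<close>. It does not depend on \<open>P\<close> and passes to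
    the supremum.\<close>
  show "\<forall>\<^sub>F R in sequentially. (SUP P\<in>MLam T \<Lambda>. emeasure P (mspace (Omega T) - good_paths T \<Lambda> R))
      \<le> ennreal (6561 / 1561 * tight_const T \<Lambda> / real R ^ 4)"
    using eventually_ge_at_top[of 1] by eventually_elim (intro SUP_least emeasure_good_paths_compl)
  have "(\<lambda>R. 6561 / 1561 * tight_const T \<Lambda> / real R ^ 4) \<longlonglongrightarrow> 0"
    by real_asymp
  then show "(\<lambda>R. ennreal (6561 / 1561 * tight_const T \<Lambda> / real R ^ 4)) \<longlonglongrightarrow> 0"
    using tendsto_ennrealI by fastforce
qed simp

lemma qn_Qlim_Lr_uniform:
  assumes r: "2 \<le> r"
  shows "\<exists>C::real. \<forall>n.
    (\<forall>P\<in>MLam T \<Lambda>. integrable P (\<lambda>x. qn_err T \<Lambda> n x powr r)) \<and>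
    (SUP P\<in>MLam T \<Lambda>. ennreal
       ((\<integral>x. qn_err T \<Lambda> n x powr r \<partial>P) powr (1 / r)))
      \<le> ennreal (C * 2 powr (- real n / 2))"
proof -
  \<comment> \<open>Any \<open>l\<close> with \<open>r \<le> real (4 * Suc l)\<close> works; the
    choice depends on \<open>r\<close> alone, so the constant depends on neither \<open>n\<close>
    nor \<open>P\<close>.\<close>
  define l where "l = nat \<lceil>r\<rceil>"
  have l: "r \<le> real (4 * Suc l)"
    using real_nat_ceiling_ge[of r] unfolding l_def by simp
  show ?thesis
  proof (intro exI[of _ "(1 + err_const T \<Lambda> l) powr (1 / r)"] allI conjI ballI SUP_least ennreal_leI)
    fix n P assume P: "P \<in> MLam T \<Lambda>"
    show "integrable P (\<lambda>x. qn_err T \<Lambda> n x powr r)"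
      by (rule integrable_qn_Qlim_dist(2)[OF T Lam P]) (use r in simp)
    show "(\<integral>x. qn_err T \<Lambda> n x powr r \<partial>P) powr (1 / r)
        \<le> (1 + err_const T \<Lambda> l) powr (1 / r) * 2 powr (- real n / 2)"
      by (rule qn_Qlim_Lr[OF T Lam P r l])
  qed
qed

end

theorem theorem3p4:
  fixes T \<Lambda> :: real
  assumes "0 < T" and "0 < \<Lambda>"
  shows
    "(Qlim T \<Lambda> \<in> borel_of (mtopology_of (Omega T))
         \<rightarrow>\<^sub>M borel_of (mtopology_of (submetric (cpaths T) (Abr T \<Lambda>)))
      \<and> causal T (Qlim T \<Lambda>))
   \<and> ((\<forall>P\<in>MLam T \<Lambda>. \<forall>A. is_bracket T P A \<longrightarrow> (AE x in P. \<forall>t\<in>{0..T}. Qlim T \<Lambda> x t = A t x))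
      \<and> (\<forall>r\<ge>2. \<exists>C::real. \<forall>n.
           (\<forall>P\<in>MLam T \<Lambda>. integrable P (\<lambda>x. mdist (cpaths T) (qn T \<Lambda> n x) (Qlim T \<Lambda> x) powr r)) \<and>
           (SUP P\<in>MLam T \<Lambda>. ennreal
              ((\<integral>x. mdist (cpaths T) (qn T \<Lambda> n x) (Qlim T \<Lambda> x) powr r \<partial>P) powr (1 / r)))
             \<le> ennreal (C * 2 powr (- real n / 2))))
   \<and> (\<exists>K :: nat \<Rightarrow> path set.
        (\<forall>R\<ge>1. compactin (mtopology_of (Omega T)) (K R) \<and> K R \<subseteq> K (Suc R)) \<and>
        ((\<lambda>R. SUP P\<in>MLam T \<Lambda>. emeasure P (mspace (Omega T) - K R)) \<longlonglongrightarrow> 0) \<and>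
        (\<forall>R\<ge>1. \<forall>\<epsilon>>0. \<forall>\<^sub>F n in sequentially. \<forall>x\<in>K R.
             mdist (cpaths T) (qn T \<Lambda> n x) (Qlim T \<Lambda> x) < \<epsilon>) \<and>
        (\<forall>R\<ge>1. continuous_map (subtopology (mtopology_of (Omega T)) (K R))
             (mtopology_of (cpaths T)) (Qlim T \<Lambda>)))"
proof (intro conjI)
  have Lam: "0 \<le> \<Lambda>"
    using assms(2) by simp
  show "Qlim T \<Lambda> \<in> borel_of (mtopology_of (Omega T))
         \<rightarrow>\<^sub>M borel_of (mtopology_of (submetric (cpaths T) (Abr T \<Lambda>)))"
    by (rule measurable_Qlim[OF assms(1) Lam])
  show "causal T (Qlim T \<Lambda>)" by (rule causal_Qlim[OF assms(1)])
  show "\<forall>P\<in>MLam T \<Lambda>. \<forall>A. is_bracket T P A \<longrightarrow> (AE x in P. \<forall>t\<in>{0..T}. Qlim T \<Lambda> x t = A t x)"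
    using Qlim_eq_bracket[OF assms(1) Lam] by blast
  show "\<forall>r\<ge>2. \<exists>C::real. \<forall>n.
           (\<forall>P\<in>MLam T \<Lambda>. integrable P (\<lambda>x. mdist (cpaths T) (qn T \<Lambda> n x) (Qlim T \<Lambda> x) powr r)) \<and>
           (SUP P\<in>MLam T \<Lambda>. ennreal
              ((\<integral>x. mdist (cpaths T) (qn T \<Lambda> n x) (Qlim T \<Lambda> x) powr r \<partial>P) powr (1 / r)))
             \<le> ennreal (C * 2 powr (- real n / 2))"
    by (intro allI impI) (rule qn_Qlim_Lr_uniform[OF assms(1) Lam])
  show "\<exists>K :: nat \<Rightarrow> path set.
        (\<forall>R\<ge>1. compactin (mtopology_of (Omega T)) (K R) \<and> K R \<subseteq> K (Suc R)) \<and>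
        ((\<lambda>R. SUP P\<in>MLam T \<Lambda>. emeasure P (mspace (Omega T) - K R)) \<longlonglongrightarrow> 0) \<and>
        (\<forall>R\<ge>1. \<forall>\<epsilon>>0. \<forall>\<^sub>F n in sequentially. \<forall>x\<in>K R.
             mdist (cpaths T) (qn T \<Lambda> n x) (Qlim T \<Lambda> x) < \<epsilon>) \<and>
        (\<forall>R\<ge>1. continuous_map (subtopology (mtopology_of (Omega T)) (K R))
             (mtopology_of (cpaths T)) (Qlim T \<Lambda>))"
  proof (intro exI[of _ "good_paths T \<Lambda>"] conjI allI impI)
    show "compactin (mtopology_of (Omega T)) (good_paths T \<Lambda> R)" for R
      by (rule good_paths_compact[OF assms(1) Lam])
    show "good_paths T \<Lambda> R \<subseteq> good_paths T \<Lambda> (Suc R)" for R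
      by (rule good_paths_mono) simp
    show "(\<lambda>R. SUP P\<in>MLam T \<Lambda>. emeasure P (mspace (Omega T) - good_paths T \<Lambda> R)) \<longlonglongrightarrow> 0"
      by (rule good_paths_tight[OF assms(1) Lam])
    show "\<forall>\<^sub>F n in sequentially. \<forall>x\<in>good_paths T \<Lambda> R. mdist (cpaths T) (qn T \<Lambda> n x) (Qlim T \<Lambda> x) < \<epsilon>"
      if "0 < \<epsilon>" for R and \<epsilon> :: real
      by (rule good_paths_eventually[OF assms(1) Lam that])
    show "continuous_map (subtopology (mtopology_of (Omega T)) (good_paths T \<Lambda> R))
        (mtopology_of (cpaths T)) (Qlim T \<Lambda>)" for R
      by (rule good_paths_continuous[OF assms(1) Lam])
  qed
qed

end
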